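(* Let $(X,b,m)$ be a weighted graph, let $\theta$ be a magnetic potential on $(X,b)$ and let $v:X\to\mathbb{R}$ be an electric potential on $X$ such that $Q^{(c)}_{v,\theta}$ and $Q^{(c)}_{-\mathrm{deg},0}$ are semi-bounded from below and closable in $\ell^2(X,m)$. Then for all $t\geq 0$ and all $x,y\in X$ one has $$\exp(-itL_{v,\theta})(x,y)=\frac{1}{m(y)}\,\mathbb{E}_x\left[1_{\{\mathbb{X}_t=y\}\cap\{N_t(\mathbb{X})<\infty\}}\; i^{N_t(\mathbb{X})}\exp\big(\mathscr{A}_t(v,\theta|\mathbb{X})\big)\right].$$
   Context: Weighted graph: $X$ is a countable set with the discrete topology; $b:X\times X\to[0,\infty)$ is symmetric with $b(x,x)=0$ and $\sum_{y\in X}b(x,y)<\infty$ for all $x\in X$; $m:X\to(0,\infty)$ is any function, viewed as a measure via $m(A)=\sum_{x\in A}m(x)$. No local finiteness is assumed. Write $x\sim y$ if $b(x,y)>0$. The weighted degree is $\mathrm{deg}(x)=\frac1{m(x)}\sum_{y\in X}b(x,y)$. Potentials: a magnetic potential is a function $\theta:\{b>0\}\to\mathbb{R}$ with $\theta(x,y)=-\theta(y,x)$; an electric potential is any function $v:X\to\mathbb{R}$. Forms and operators: all function spaces are complex-valued, $i=\sqrt{-1}$, and $C_c(X)$ denotes the finitely supported functions on $X$. For $f,g\in C_c(X)$, $$Q^{(c)}_{v,\theta}(f,g)=\frac12\sum_{x\sim y}b(x,y)\big(f(x)-e^{i\theta(x,y)}f(y)\big)\overline{\big(g(x)-e^{i\theta(x,y)}g(y)\big)}+\sum_{x\in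 X}v(x)f(x)\overline{g(x)}m(x),$$ the first sum being over ordered pairs $(x,y)$ with $x\sim y$. If this form is bounded from below and closable in $\ell^2(X,m)$, its closure is $Q_{v,\theta}$ and $L_{v,\theta}$ is the associated self-adjoint operator. $Q:=Q_{0,0}$ is always well-defined and is a regular symmetric Dirichlet form; put $L:=L_{0,0}$. The integral kernel of a bounded operator $A$ on $\ell^2(X,m)$ is the unique map $A(\cdot,\cdot):X\times X\to\mathbb{C}$ with $Af(x)=\sum_{y\in X}A(x,y)f(y)m(y)$ for all $f\in\ell^2(X,m)$, $x\in X$. Process: $\hat X=X\cup\{\infty_X\}$ is the Alexandrov compactification if $X$ is infinite, and $\hat X=X$ if $X$ is finite. $\Omega$ is the space of right-continuous paths $\omega:[0,\infty)\to\hat X$ having left limits, with its Borel $\sigma$-algebra, and $\mathbb{X}_t(\omega)=\omega(t)$. For $x\in X$, $\mathbb{P}_x$ (with expectation $\mathbb{E}_x$) is the unique probability measure on $\Omega$ such that for all $0=t_0<t_1<\dots<t_l$, $x_0=x$ and $x_1,\dots,x_l\in\hat X$, $$\mathbb{P}_x\{\mathbb{X}_{t_1}=x_1,\dots,\mathbb{X}_{t_l}=x_l\}=\prod_{j=0}^{l-1}p_{t_{j+1}-t_j}(x_j,x_{j+1}),$$ where $p_t(y,z)=\exp(-tL)(y,z)m(z)$ for $y,z\in X$, $p_t(y,\infty_X)=1-\sum_{z\in X}\exp(-tL)(y,z)m(z)$ for $y\in X$, $p_t(\infty_X,\infty_X)=1$ and $p_t(\infty_X,y)=0$ for $y\in X$.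 Under $\mathbb{P}_x$ the process is a strong Markov process for which $\infty_X$ is a cemetery. $\tau_n$ is the $n$-th jump time of $\mathbb{X}$ ($\tau_0=0$), and $N_t(\mathbb{X})\in\{0,1,2,\dots\}\cup\{\infty\}$ is the number of jumps of $\mathbb{X}|_{[0,t]}$. The stochastic line integral is $\int_0^t\theta(d\mathbb{X}_s)=\sum_{n=1}^{N_t(\mathbb{X})}\theta(\mathbb{X}_{\tau_{n-1}},\mathbb{X}_{\tau_n})$, set to $0$ if $N_t(\mathbb{X})\in\{0,\infty\}$ or if $b(\mathbb{X}_{\tau_{n-1}},\mathbb{X}_{\tau_n})=0$ for some $n\le N_t(\mathbb{X})$. For $w:X\to\mathbb{R}$, $\int_0^tw(\mathbb{X}_s)ds$ is the usual integral of the piecewise constant function $s\mapsto w(\mathbb{X}_s)$ if $N_t(\mathbb{X})<\infty$, and is set to $0$ if $N_t(\mathbb{X})=\infty$. Finally, $$\mathscr{A}_t(v,\theta|\mathbb{X})=i\int_0^t\theta(d\mathbb{X}_s)-i\int_0^t\big(v(\mathbb{X}_s)+\mathrm{deg}(\mathbb{X}_s)\big)ds+\int_0^t\mathrm{deg}(\mathbb{X}_s)ds.$$ *)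

theory Defs
  imports "HOL-Probability.Probability"
begin

section \<open>Weighted graphs and potentials\<close>

text \<open>The vertex set is a type of class \<^class>\<open>countable\<close>; it may be finite or infinite.\<close>

definition weighted_graph :: "('a::countable \<Rightarrow> 'a \<Rightarrow> real) \<Rightarrow> ('a \<Rightarrow> real) \<Rightarrow> bool" where
  "weighted_graph b m \<longleftrightarrow>
     (\<forall>x y. 0 \<le> b x y) \<and> (\<forall>x y. b x y = b y x) \<and> (\<forall>x. b x x = 0) \<and>
     (\<forall>x. (\<lambda>y. b x y) summable_on UNIV) \<and> (\<forall>x. 0 < m x)"

definition weighted_deg :: "('a \<Rightarrow> 'a \<Rightarrow> real) \<Rightarrow> ('a \<Rightarrow> real) \<Rightarrow> 'a \<Rightarrow> real" where
  "weighted_deg b m x = (\<Sum>\<^sub>\<infinity>y. b x y) / m x"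

text \<open>A magnetic potential is only relevant on \<open>{b > 0}\<close>; its values elsewhere are arbitrary
  and never used.\<close>

definition magnetic_potential :: "('a \<Rightarrow> 'a \<Rightarrow> real) \<Rightarrow> ('a \<Rightarrow> 'a \<Rightarrow> real) \<Rightarrow> bool" where
  "magnetic_potential b \<theta> \<longleftrightarrow> (\<forall>x y. 0 < b x y \<longrightarrow> \<theta> x y = - \<theta> y x)"


section \<open>The Hilbert space of square summable functions\<close>

text \<open>Since \<open>m\<close> is strictly positive, no almost-everywhere quotient is needed.\<close>

definition l2 :: "('a \<Rightarrow> real) \<Rightarrow> ('a \<Rightarrow> complex) set" where
  "l2 m = {f. (\<lambda>x. (cmod (f x))\<^sup>2 * m x) summable_on UNIV}"

definition l2_inner :: "('a \<Rightarrow> real) \<Rightarrow> ('a \<Rightarrow> complex) \<Rightarrow> ('a \<Rightarrow> complex) \<Rightarrow> complex" where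
  "l2_inner m f g = (\<Sum>\<^sub>\<infinity>x. f x * cnj (g x) * of_real (m x))"

definition l2_norm :: "('a \<Rightarrow> real) \<Rightarrow> ('a \<Rightarrow> complex) \<Rightarrow> real" where
  "l2_norm m f = sqrt (\<Sum>\<^sub>\<infinity>x. (cmod (f x))\<^sup>2 * m x)"

definition Cc :: "('a \<Rightarrow> complex) set" where
  "Cc = {f. finite {x. f x \<noteq> 0}}"


section \<open>Forms, closures and associated operators\<close>

type_synonym 'a form = "('a \<Rightarrow> complex) \<Rightarrow> ('a \<Rightarrow> complex) \<Rightarrow> complex"

text \<open>An unbounded operator is given by its graph.\<close>

type_synonym 'a unbounded_op = "(('a \<Rightarrow> complex) \<times> ('a \<Rightarrow> complex)) set"

definition magnetic_form ::
    "('a \<Rightarrow> 'a \<Rightarrow> real) \<Rightarrow> ('a \<Rightarrow> real) \<Rightarrow> ('a \<Rightarrow> real) \<Rightarrow> ('a \<Rightarrow> 'a \<Rightarrow> real) \<Rightarrow> 'a form" where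
  "magnetic_form b m v \<theta> f g =
     1 / 2 * (\<Sum>\<^sub>\<infinity>(x, y) \<in> {(x, y). 0 < b x y}.
        of_real (b x y) * (f x - exp (\<i> * of_real (\<theta> x y)) * f y)
          * cnj (g x - exp (\<i> * of_real (\<theta> x y)) * g y))
     + (\<Sum>\<^sub>\<infinity>x. of_real (v x) * f x * cnj (g x) * of_real (m x))"

definition semibounded_form :: "('a \<Rightarrow> real) \<Rightarrow> ('a \<Rightarrow> complex) set \<Rightarrow> 'a form \<Rightarrow> bool" where
  "semibounded_form m D q \<longleftrightarrow> (\<exists>C::real. \<forall>f\<in>D. C * (l2_norm m f)\<^sup>2 \<le> Re (q f f))"

text \<open>Closability and closure follow Kato (Perturbation Theory, Section VI.1): \<open>fs\<close> is
  \<open>q\<close>-convergent to \<open>f\<close> if it converges to \<open>f\<close> in norm and is Cauchy with respect to \<open>q\<close>.\<close>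

definition form_convergent ::
    "('a \<Rightarrow> real) \<Rightarrow> ('a \<Rightarrow> complex) set \<Rightarrow> 'a form \<Rightarrow> (nat \<Rightarrow> 'a \<Rightarrow> complex) \<Rightarrow> ('a \<Rightarrow> complex) \<Rightarrow> bool" where
  "form_convergent m D q fs f \<longleftrightarrow>
     (\<forall>n. fs n \<in> D) \<and> f \<in> l2 m \<and> (\<lambda>n. l2_norm m (fs n - f)) \<longlonglongrightarrow> 0 \<and>
     ((\<lambda>(j, k). q (fs j - fs k) (fs j - fs k)) \<longlongrightarrow> 0) (sequentially \<times>\<^sub>F sequentially)"

definition closable_form :: "('a \<Rightarrow> real) \<Rightarrow> ('a \<Rightarrow> complex) set \<Rightarrow> 'a form \<Rightarrow> bool" where
  "closable_form m D q \<longleftrightarrow>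
     (\<forall>fs. form_convergent m D q fs (\<lambda>_. 0) \<longrightarrow> (\<lambda>n. q (fs n) (fs n)) \<longlonglongrightarrow> 0)"

definition closure_dom :: "('a \<Rightarrow> real) \<Rightarrow> ('a \<Rightarrow> complex) set \<Rightarrow> 'a form \<Rightarrow> ('a \<Rightarrow> complex) set" where
  "closure_dom m D q = {f. \<exists>fs. form_convergent m D q fs f}"

definition closure_form :: "('a \<Rightarrow> real) \<Rightarrow> ('a \<Rightarrow> complex) set \<Rightarrow> 'a form \<Rightarrow> 'a form" where
  "closure_form m D q f g = (THE c. \<exists>fs gs. form_convergent m D q fs f \<and>
      form_convergent m D q gs g \<and> (\<lambda>n. q (fs n) (gs n)) \<longlonglongrightarrow> c)"

definition form_operator :: "('a \<Rightarrow> real) \<Rightarrow> ('a \<Rightarrow> complex) set \<Rightarrow> 'a form \<Rightarrow> 'a unbounded_op" where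
  "form_operator m D q = {(f, g). f \<in> D \<and> g \<in> l2 m \<and> (\<forall>h\<in>D. q f h = l2_inner m g h)}"

definition magnetic_op ::
    "('a \<Rightarrow> 'a \<Rightarrow> real) \<Rightarrow> ('a \<Rightarrow> real) \<Rightarrow> ('a \<Rightarrow> real) \<Rightarrow> ('a \<Rightarrow> 'a \<Rightarrow> real) \<Rightarrow> 'a unbounded_op" where
  "magnetic_op b m v \<theta> =
     form_operator m (closure_dom m Cc (magnetic_form b m v \<theta>))
                     (closure_form m Cc (magnetic_form b m v \<theta>))"


section \<open>Exponentials of unbounded operators and integral kernels\<close>

definition l2_bounded_op :: "('a \<Rightarrow> real) \<Rightarrow> (('a \<Rightarrow> complex) \<Rightarrow> ('a \<Rightarrow> complex)) \<Rightarrow> bool" where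
  "l2_bounded_op m T \<longleftrightarrow>
     (\<forall>f\<in>l2 m. T f \<in> l2 m) \<and>
     (\<forall>f\<in>l2 m. \<forall>g\<in>l2 m. T (\<lambda>x. f x + g x) = (\<lambda>x. T f x + T g x)) \<and>
     (\<forall>c. \<forall>f\<in>l2 m. T (\<lambda>x. c * f x) = (\<lambda>x. c * T f x)) \<and>
     (\<exists>K. \<forall>f\<in>l2 m. l2_norm m (T f) \<le> K * l2_norm m f)"

definition C0_semigroup ::
    "('a \<Rightarrow> real) \<Rightarrow> (real \<Rightarrow> ('a \<Rightarrow> complex) \<Rightarrow> ('a \<Rightarrow> complex)) \<Rightarrow> bool" where
  "C0_semigroup m T \<longleftrightarrow>
     (\<forall>t\<ge>0. l2_bounded_op m (T t)) \<and>
     (\<forall>f\<in>l2 m. T 0 f = f) \<and>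
     (\<forall>s\<ge>0. \<forall>t\<ge>0. \<forall>f\<in>l2 m. T (s + t) f = T s (T t f)) \<and>
     (\<forall>f\<in>l2 m. ((\<lambda>t. l2_norm m (T t f - f)) \<longlongrightarrow> 0) (at_right 0))"

definition generator ::
    "('a \<Rightarrow> real) \<Rightarrow> (real \<Rightarrow> ('a \<Rightarrow> complex) \<Rightarrow> ('a \<Rightarrow> complex)) \<Rightarrow> 'a unbounded_op" where
  "generator m T = {(f, g). f \<in> l2 m \<and> g \<in> l2 m \<and>
     ((\<lambda>t. l2_norm m (\<lambda>x. (T t f x - f x) / of_real t - g x)) \<longlongrightarrow> 0) (at_right 0)}"

definition scale_op :: "complex \<Rightarrow> 'a unbounded_op \<Rightarrow> 'a unbounded_op" where
  "scale_op c A = {(f, \<lambda>x. c * g x) | f g. (f, g) \<in> A}"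

text \<open>\<open>exp_op m A t\<close> is \<open>exp(tA)\<close> for \<open>t \<ge> 0\<close>: the strongly continuous semigroup generated by
  \<open>A\<close>. A semigroup is determined on \<open>l2 m\<close> by its generator, so the choice only concerns the
  irrelevant values outside \<open>l2 m\<close> or for negative times. For self-adjoint \<open>L\<close> and \<open>A = -iL\<close>
  this is the unitary group of Stone's theorem, for \<open>L\<close> bounded below and \<open>A = -L\<close> the heat
  semigroup; both agree with the functional calculus.\<close>

definition exp_op ::
    "('a \<Rightarrow> real) \<Rightarrow> 'a unbounded_op \<Rightarrow> real \<Rightarrow> ('a \<Rightarrow> complex) \<Rightarrow> ('a \<Rightarrow> complex)" where
  "exp_op m A = (SOME T. C0_semigroup m T \<and> generator m T = A)"

definition integral_kernel ::
    "('a \<Rightarrow> real) \<Rightarrow> (('a \<Rightarrow> complex) \<Rightarrow> ('a \<Rightarrow> complex)) \<Rightarrow> 'a \<Rightarrow> 'a \<Rightarrow> complex" where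
  "integral_kernel m T = (THE k. \<forall>f\<in>l2 m. \<forall>x.
     ((\<lambda>y. k x y * f y * of_real (m y)) has_sum T f x) UNIV)"


section \<open>The path space and the laws of the process\<close>

text \<open>Vertices of the compactification are \<open>Some x\<close>; the point at infinity is \<open>None\<close>, which
  is discarded if there are only finitely many vertices.\<close>

definition Xhat :: "'a::countable option topology" where
  "Xhat = (if finite (UNIV :: 'a set)
           then subtopology (Alexandroff_compactification (discrete_topology UNIV)) (range Some)
           else Alexandroff_compactification (discrete_topology UNIV))"

text \<open>Paths are functions on \<open>[0, \<infinity>)\<close>, encoded by the value \<open>undefined\<close> at negative times.\<close>

definition paths :: "(real \<Rightarrow> 'a::countable option) set" where
  "paths = {\<omega> \<in> {0..} \<rightarrow>\<^sub>E topspace Xhat.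
     (\<forall>t\<ge>0. limitin Xhat \<omega> (\<omega> t) (at_right t)) \<and>
     (\<forall>t>0. \<exists>l. limitin Xhat \<omega> l (at_left t))}"

text \<open>The Borel sigma-algebra of the path space, generated by the coordinate maps (this is also
  the Borel sigma-algebra of the Skorokhod topology). The state space is countable and Hausdorff,
  so that all its subsets are Borel.\<close>

definition path_space :: "(real \<Rightarrow> 'a::countable option) measure" where
  "path_space = restrict_space (Pi\<^sub>M {0..} (\<lambda>_. count_space (topspace Xhat))) paths"

definition transition ::
    "('a \<Rightarrow> 'a \<Rightarrow> real) \<Rightarrow> ('a \<Rightarrow> real) \<Rightarrow> real \<Rightarrow> 'a option \<Rightarrow> 'a option \<Rightarrow> complex" where
  "transition b m t p q =
     (let k = integral_kernel m (exp_op m (scale_op (-1) (magnetic_op b m (\<lambda>_. 0) (\<lambda>_ _. 0))) t)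
      in case (p, q) of
           (Some y, Some z) \<Rightarrow> k y z * of_real (m z)
         | (Some y, None) \<Rightarrow> 1 - (\<Sum>\<^sub>\<infinity>z. k y z * of_real (m z))
         | (None, Some _) \<Rightarrow> 0
         | (None, None) \<Rightarrow> 1)"

text \<open>The defining property of the law of the process started at \<open>x\<close>.\<close>

definition process_law ::
    "('a::countable \<Rightarrow> 'a \<Rightarrow> real) \<Rightarrow> ('a \<Rightarrow> real) \<Rightarrow> 'a \<Rightarrow> (real \<Rightarrow> 'a option) measure \<Rightarrow> bool" where
  "process_law b m x P \<longleftrightarrow>
     prob_space P \<and> space P = space path_space \<and> sets P = sets path_space \<and>
     (\<forall>l (ts :: nat \<Rightarrow> real) (xs :: nat \<Rightarrow> 'a option).
        ts 0 = 0 \<and> (\<forall>j<l. ts j < ts (Suc j)) \<and>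
        xs 0 = Some x \<and> (\<forall>j\<in>{1..l}. xs j \<in> topspace Xhat) \<longrightarrow>
        complex_of_real (measure P {\<omega> \<in> space P. \<forall>j\<in>{1..l}. \<omega> (ts j) = xs j}) =
          (\<Prod>j<l. transition b m (ts (Suc j) - ts j) (xs j) (xs (Suc j))))"


section \<open>Jumps and path integrals\<close>

definition jumps :: "(real \<Rightarrow> 'a::countable option) \<Rightarrow> real set" where
  "jumps \<omega> = {s. 0 < s \<and> \<not> limitin Xhat \<omega> (\<omega> s) (at_left s)}"

primrec jump_time :: "(real \<Rightarrow> 'a::countable option) \<Rightarrow> nat \<Rightarrow> real" where
  "jump_time \<omega> 0 = 0"
| "jump_time \<omega> (Suc n) = Inf {s \<in> jumps \<omega>. jump_time \<omega> n < s}"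

definition num_jumps :: "real \<Rightarrow> (real \<Rightarrow> 'a::countable option) \<Rightarrow> enat" where
  "num_jumps t \<omega> = (if finite (jumps \<omega> \<inter> {..t}) then enat (card (jumps \<omega> \<inter> {..t})) else \<infinity>)"

text \<open>Here \<open>b\<close> is understood to vanish as soon as one of its arguments is the point at infinity.\<close>

definition edge_step :: "('a \<Rightarrow> 'a \<Rightarrow> real) \<Rightarrow> 'a option \<Rightarrow> 'a option \<Rightarrow> bool" where
  "edge_step b p q \<longleftrightarrow> (\<exists>x y. p = Some x \<and> q = Some y \<and> b x y \<noteq> 0)"

definition line_integral ::
    "('a::countable \<Rightarrow> 'a \<Rightarrow> real) \<Rightarrow> ('a \<Rightarrow> 'a \<Rightarrow> real) \<Rightarrow> real \<Rightarrow> (real \<Rightarrow> 'a option) \<Rightarrow> real" where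
  "line_integral b \<theta> t \<omega> =
     (if num_jumps t \<omega> \<in> {0, \<infinity>} \<or>
         (\<exists>n\<in>{1..the_enat (num_jumps t \<omega>)}.
            \<not> edge_step b (\<omega> (jump_time \<omega> (n - 1))) (\<omega> (jump_time \<omega> n)))
      then 0
      else (\<Sum>n = 1..the_enat (num_jumps t \<omega>).
              \<theta> (the (\<omega> (jump_time \<omega> (n - 1)))) (the (\<omega> (jump_time \<omega> n)))))"

text \<open>Functions on the vertices are extended by \<open>0\<close> to the point at infinity.\<close>

definition time_integral :: "('a::countable \<Rightarrow> real) \<Rightarrow> real \<Rightarrow> (real \<Rightarrow> 'a option) \<Rightarrow> real" where
  "time_integral w t \<omega> =
     (if num_jumps t \<omega> = \<infinity> then 0 else LINT s:{0..t}|lborel. case_option 0 w (\<omega> s))"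

definition action ::
    "('a::countable \<Rightarrow> 'a \<Rightarrow> real) \<Rightarrow> ('a \<Rightarrow> real) \<Rightarrow> ('a \<Rightarrow> real) \<Rightarrow> ('a \<Rightarrow> 'a \<Rightarrow> real) \<Rightarrow>
     real \<Rightarrow> (real \<Rightarrow> 'a option) \<Rightarrow> complex" where
  "action b m v \<theta> t \<omega> =
     \<i> * of_real (line_integral b \<theta> t \<omega>)
     - \<i> * of_real (time_integral (\<lambda>x. v x + weighted_deg b m x) t \<omega>)
     + of_real (time_integral (weighted_deg b m) t \<omega>)"

definition feynman_integrand ::
    "('a::countable \<Rightarrow> 'a \<Rightarrow> real) \<Rightarrow> ('a \<Rightarrow> real) \<Rightarrow> ('a \<Rightarrow> real) \<Rightarrow> ('a \<Rightarrow> 'a \<Rightarrow> real) \<Rightarrow>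
     real \<Rightarrow> 'a \<Rightarrow> (real \<Rightarrow> 'a option) \<Rightarrow> complex" where
  "feynman_integrand b m v \<theta> t y \<omega> =
     indicator {\<omega>. \<omega> t = Some y \<and> num_jumps t \<omega> < \<infinity>} \<omega>
     * \<i> ^ the_enat (num_jumps t \<omega>) * exp (action b m v \<theta> t \<omega>)"

end

theory Submission
  imports Defs
begin

text \<open>Semi-boundedness of the form with electric potential \<open>-deg\<close> says that the adjacency kernel
  \<open>b x y / sqrt (m x * m y)\<close> defines a bounded operator. Hence every \<open>L\<close> in question is \<open>D - A\<close> with a
  multiplication operator \<open>D = v + deg\<close> which is bounded below and a bounded operator \<open>A\<close>, and
  \<open>exp(-tL)\<close> (for \<open>v = 0\<close>) as well as \<open>exp(-itL)\<close> are given by the solutions of an evolution equation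
  \<open>u' = \<phi> u + B u\<close> with \<open>B\<close> bounded and \<open>Re \<phi> \<le> 0\<close>.

  On the event that the path stays in a finite set \<open>K\<close> of vertices, a multiplicative functional of
  the path is the limit of products along equidistant grids. The expectation of such a product is an
  entry of a power of a matrix on \<open>K\<close> whose first order expansion in the mesh is that of the
  solution semigroup with \<open>B\<close> compressed to \<open>K\<close>, so the powers converge to that semigroup. The
  factor \<open>exp (\<integral> deg)\<close> of the integrand cancels the killing rate and leaves the generator \<open>-iL\<close>
  compressed to \<open>K\<close>. As \<open>K\<close> increases to the whole graph, the solutions converge by stability of
  the evolution equation and the expectations by dominated convergence: the dominating functional
  \<open>exp (\<integral> deg)\<close> has the finite expectation given by the semigroup of the bounded operator \<open>A\<close>.\<close>

section \<open>Square summable functions as a Banach space\<close>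

text \<open>Two features of the objects shape the argument. \<open>exp_op\<close> is a mere choice
  of a semigroup with the right generator, so the closed form is computed explicitly, its operator
  is identified on its maximal domain, and the chosen semigroup is compared with the solutions of
  the evolution equation at unit vectors, which lie in that domain. As \<phi> may be unbounded,
  energy estimates are made on finite sets of coordinates. On the path side the integrand is not
  itself a multiplicative functional: the line integral is reset to 0 as soon as one jump is not
  along an edge, and a path with finitely many jumps might visit infinity and return. On the event
  that the path ends in \<open>y\<close> with finitely many jumps, both are null: the first because
  two jump weights have equal expectations, the second by the cemetery property at rational times. A
  grid factor reads equal end states of a time step as no jump and different ones as a single jump.
  For a fine grid it errs only in steps that contain a jump, so the error in the exponent is at most
  the mesh times a constant of the path.\<close>

definition sqsum :: "('a \<Rightarrow> complex) set" where
  "sqsum = {f. (\<lambda>x. (cmod (f x))\<^sup>2) summable_on UNIV}"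

lemma sqsum_add:
  assumes "f \<in> sqsum" "g \<in> sqsum"
  shows "(\<lambda>x. f x + g x) \<in> sqsum"
proof -
  have s: "(\<lambda>x. 2 * (cmod (f x))\<^sup>2 + 2 * (cmod (g x))\<^sup>2) summable_on UNIV"
    using assms by (auto simp: sqsum_def intro!: summable_on_add summable_on_cmult_right)
  have le: "(cmod (f x + g x))\<^sup>2 \<le> 2 * (cmod (f x))\<^sup>2 + 2 * (cmod (g x))\<^sup>2" for x
  proof -
    have "(cmod (f x + g x))\<^sup>2 \<le> (cmod (f x) + cmod (g x))\<^sup>2"
      by (intro power_mono norm_triangle_ineq) auto
    also have "\<dots> \<le> 2 * (cmod (f x))\<^sup>2 + 2 * (cmod (g x))\<^sup>2"
      using sum_squares_bound[of "cmod (f x)" "cmod (g x)"] by (simp add: power2_sum)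
    finally show ?thesis .
  qed
  show ?thesis unfolding sqsum_def mem_Collect_eq
    by (rule summable_on_comparison_test[OF s]) (use le in auto)
qed

lemma sqsum_mult_bounded:
  assumes "f \<in> sqsum" "\<And>x. cmod (g x) \<le> M"
  shows "(\<lambda>x. g x * f x) \<in> sqsum"
proof -
  have s: "(\<lambda>x. M\<^sup>2 * (cmod (f x))\<^sup>2) summable_on UNIV"
    using assms by (auto simp: sqsum_def intro!: summable_on_cmult_right)
  show ?thesis unfolding sqsum_def mem_Collect_eq
    by (rule summable_on_comparison_test[OF s])
       (auto simp: norm_mult power_mult_distrib assms(2) intro!: mult_right_mono power_mono)
qed

lemma sqsum_product_summable:
  assumes "f \<in> sqsum" "g \<in> sqsum"
  shows "(\<lambda>x. cmod (f x) * cmod (g x)) summable_on UNIV"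
proof -
  have s: "(\<lambda>x. (cmod (f x))\<^sup>2 + (cmod (g x))\<^sup>2) summable_on UNIV"
    using assms by (auto simp: sqsum_def intro!: summable_on_add)
  have "cmod (f x) * cmod (g x) \<le> (cmod (f x))\<^sup>2 + (cmod (g x))\<^sup>2" for x
  proof -
    have "0 \<le> cmod (f x) * cmod (g x)" by simp
    then show ?thesis using sum_squares_bound[of "cmod (f x)" "cmod (g x)"] by linarith
  qed
  then show ?thesis by (intro summable_on_comparison_test[OF s]) auto
qed

lemma sqsum_inner_summable:
  assumes "f \<in> sqsum" "g \<in> sqsum"
  shows "(\<lambda>x. inner (f x) (g x)) summable_on UNIV"
proof (rule abs_summable_summable)
  show "(\<lambda>x. norm (inner (f x) (g x))) summable_on UNIV"
    by (rule summable_on_comparison_test[OF sqsum_product_summable[OF assms]])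
       (auto simp: Cauchy_Schwarz_ineq2)
qed

lemma sqsumI_finite:
  assumes "\<And>A. finite A \<Longrightarrow> (\<Sum>x\<in>A. (cmod (f x))\<^sup>2) \<le> C"
  shows "f \<in> sqsum"
  unfolding sqsum_def mem_Collect_eq
  by (rule nonneg_bdd_above_summable_on) (auto intro!: bdd_aboveI[of _ C] assms)

lemma has_sum_finite_sum:
  fixes f :: "'i \<Rightarrow> 'a \<Rightarrow> 'b::topological_comm_monoid_add"
  assumes "finite A" "\<And>i. i \<in> A \<Longrightarrow> (f i has_sum s i) B"
  shows "((\<lambda>y. \<Sum>i\<in>A. f i y) has_sum sum s A) B"
  using assms by (induction A rule: finite_induct) (auto intro!: has_sum_add)

text \<open>Unweighted, so that the type does not depend on \<open>m\<close>; the weight enters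
  through the unitary map \<open>emb\<close>. Only a real Banach structure is instantiated, which
  suffices for calculus in time; complex scalars act through \<open>cs\<close>.\<close>

typedef 'a ell2 = "sqsum :: ('a \<Rightarrow> complex) set" morphisms coord Abs_ell2
  by (rule exI[of _ "\<lambda>_. 0"]) (simp add: sqsum_def)

lemma coord_sqsum [simp]: "coord F \<in> sqsum"
  by (rule coord)

lemma coord_Abs: "f \<in> sqsum \<Longrightarrow> coord (Abs_ell2 f) = f"
  by (rule Abs_ell2_inverse)

lemma ell2_eqI: "(\<And>x. coord F x = coord G x) \<Longrightarrow> F = G"
  by (simp add: coord_inject[symmetric] fun_eq_iff)

instantiation ell2 :: (type) real_vector
begin

definition zero_ell2 :: "'a ell2" where "0 = Abs_ell2 (\<lambda>_. 0)"
definition plus_ell2 :: "'a ell2 \<Rightarrow> 'a ell2 \<Rightarrow> 'a ell2" where "F + G = Abs_ell2 (\<lambda>x. coord F x + coord G x)"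
definition uminus_ell2 :: "'a ell2 \<Rightarrow> 'a ell2" where "- F = Abs_ell2 (\<lambda>x. - coord F x)"
definition minus_ell2 :: "'a ell2 \<Rightarrow> 'a ell2 \<Rightarrow> 'a ell2" where "F - G = Abs_ell2 (\<lambda>x. coord F x - coord G x)"
definition scaleR_ell2 :: "real \<Rightarrow> 'a ell2 \<Rightarrow> 'a ell2" where "scaleR r F = Abs_ell2 (\<lambda>x. r *\<^sub>R coord F x)"

lemma coord_simps [simp]:
  "coord 0 x = 0" "coord (F + G) x = coord F x + coord G x" "coord (- F) x = - coord F x"
  "coord (F - G) x = coord F x - coord G x" "coord (r *\<^sub>R F) x = r *\<^sub>R coord F x"
proof -
  show "coord 0 x = 0" unfolding zero_ell2_def by (subst coord_Abs) (auto simp: sqsum_def)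
  show "coord (F + G) x = coord F x + coord G x"
    unfolding plus_ell2_def by (subst coord_Abs) (auto intro: sqsum_add)
  have n: "(\<lambda>x. - coord G x) \<in> sqsum" for G :: "'b ell2"
    using sqsum_mult_bounded[of "coord G" "\<lambda>_. -1" 1] by simp
  show "coord (- F) x = - coord F x" unfolding uminus_ell2_def by (subst coord_Abs[OF n]) auto
  have m: "(\<lambda>x. coord F x - coord G x) \<in> sqsum" for F G :: "'b ell2"
    using sqsum_add[OF coord_sqsum[of F] n[of G]] by simp
  show "coord (F - G) x = coord F x - coord G x"
    unfolding minus_ell2_def by (subst coord_Abs[OF m]) auto
  have s: "(\<lambda>x. r *\<^sub>R coord F x) \<in> sqsum"
    using sqsum_mult_bounded[of "coord F" "\<lambda>_. of_real r" "\<bar>r\<bar>"] by (simp add: scaleR_conv_of_real)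
  show "coord (r *\<^sub>R F) x = r *\<^sub>R coord F x"
    unfolding scaleR_ell2_def by (subst coord_Abs[OF s]) auto
qed

instance
  by standard (auto intro!: ell2_eqI simp: algebra_simps)

end

instantiation ell2 :: (type) real_inner
begin

definition inner_ell2 :: "'a ell2 \<Rightarrow> 'a ell2 \<Rightarrow> real" where "inner F G = (\<Sum>\<^sub>\<infinity>x. inner (coord F x) (coord G x))"
definition norm_ell2 :: "'a ell2 \<Rightarrow> real" where "norm F = sqrt (inner F (F :: 'a ell2))"
definition dist_ell2 :: "'a ell2 \<Rightarrow> 'a ell2 \<Rightarrow> real" where "dist F G = norm (F - G :: 'a ell2)"
definition sgn_ell2_def: "sgn (F :: 'a ell2) = scaleR (inverse (norm F)) F"
definition uniformity_ell2 :: "('a ell2 \<times> 'a ell2) filter"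
  where "uniformity_ell2 = (INF e\<in>{0 <..}. principal {(x, y). dist x y < e})"
definition open_ell2 :: "('a ell2) set \<Rightarrow> bool"
  where "open_ell2 S = (\<forall>x\<in>S. \<forall>\<^sub>F (x', y) in uniformity. x' = x \<longrightarrow> y \<in> S)"

instance
proof
  fix F G H :: "'a ell2" and r s :: real
  show "dist F G = norm (F - G)" by (rule dist_ell2_def)
  show "sgn F = inverse (norm F) *\<^sub>R F" by (simp add: sgn_ell2_def)
  show "uniformity = (INF e\<in>{0 <..}. principal {(x, y). dist x (y::'a ell2) < e})"
    by (rule uniformity_ell2_def)
  show "open S = (\<forall>x\<in>S. \<forall>\<^sub>F (x', y) in uniformity. x' = x \<longrightarrow> y \<in> S)" for S :: "'a ell2 set"
    by (rule open_ell2_def)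
  show "norm F = sqrt (inner F F)" by (rule norm_ell2_def)
  show "inner F G = inner G F" unfolding inner_ell2_def by (simp add: inner_commute)
  show "inner (F + G) H = inner F H + inner G H" unfolding inner_ell2_def
    by (simp add: inner_add_left infsum_add sqsum_inner_summable)
  show "inner (r *\<^sub>R F) G = r * inner F G" unfolding inner_ell2_def
    by (simp add: infsum_cmult_right sqsum_inner_summable)
  show "0 \<le> inner F F" unfolding inner_ell2_def by (intro infsum_nonneg) auto
  show "(inner F F = 0) = (F = 0)"
  proof
    assume "inner F F = 0"
    then have "coord F x = 0" for x
      using nonneg_infsum_le_0D[of "\<lambda>x. inner (coord F x) (coord F x)" UNIV x]
      unfolding inner_ell2_def by (simp add: sqsum_inner_summable)
    then show "F = 0" by (auto intro!: ell2_eqI)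
  qed (simp add: inner_ell2_def)
qed

end

lemma norm_ell2_square: "(norm F)\<^sup>2 = (\<Sum>\<^sub>\<infinity>x. (cmod (coord F x))\<^sup>2)"
  by (simp add: power2_norm_eq_inner inner_ell2_def)

lemma has_sum_norm_ell2: "((\<lambda>x. (cmod (coord F x))\<^sup>2) has_sum (norm F)\<^sup>2) UNIV"
  unfolding norm_ell2_square using coord_sqsum[of F] unfolding sqsum_def by auto

lemma finite_sum_le_norm_ell2: "finite A \<Longrightarrow> (\<Sum>x\<in>A. (cmod (coord F x))\<^sup>2) \<le> (norm F)\<^sup>2"
  by (rule finite_sum_le_has_sum[OF has_sum_norm_ell2]) auto

lemma norm_ell2_square_leI:
  assumes "\<And>A. finite A \<Longrightarrow> (\<Sum>x\<in>A. (cmod (coord F x))\<^sup>2) \<le> C"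
  shows "(norm F)\<^sup>2 \<le> C"
  by (rule has_sum_le_finite_sums[OF has_sum_norm_ell2]) (use assms in auto)

lemma norm_ell2_leI:
  assumes "\<And>A. finite A \<Longrightarrow> (\<Sum>x\<in>A. (cmod (coord F x))\<^sup>2) \<le> C\<^sup>2" "0 \<le> C"
  shows "norm F \<le> C"
  using norm_ell2_square_leI[of F "C\<^sup>2"] assms by (meson power2_le_imp_le)

lemma norm_ell2_mono:
  assumes "\<And>x. cmod (coord F x) \<le> C * cmod (coord G x)" "0 \<le> C"
  shows "norm F \<le> C * norm G"
proof (rule norm_ell2_leI)
  fix A :: "'a set" assume "finite A"
  have "(\<Sum>x\<in>A. (cmod (coord F x))\<^sup>2) \<le> (\<Sum>x\<in>A. C\<^sup>2 * (cmod (coord G x))\<^sup>2)"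
    using assms(1) by (intro sum_mono) (simp add: power_mono flip: power_mult_distrib)
  also have "\<dots> \<le> (C * norm G)\<^sup>2"
    using finite_sum_le_norm_ell2[OF \<open>finite A\<close>, of G]
    by (simp add: sum_distrib_left[symmetric] power_mult_distrib mult_left_mono)
  finally show "(\<Sum>x\<in>A. (cmod (coord F x))\<^sup>2) \<le> (C * norm G)\<^sup>2" .
qed (use assms in auto)

lemma coord_le_norm: "cmod (coord F x) \<le> norm F"
  using finite_sum_le_norm_ell2[of "{x}" F] by (auto intro: power2_le_imp_le[of "cmod (coord F x)" "norm F"])

lemma bounded_linear_coord: "bounded_linear (\<lambda>F. coord F x)"
  by (rule bounded_linear_intro[where K = 1]) (auto simp: coord_le_norm)

lemmas continuous_on_coord [continuous_intros] =
  bounded_linear.continuous_on[OF bounded_linear_coord]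
lemmas tendsto_coord [tendsto_intros] = bounded_linear.tendsto[OF bounded_linear_coord]

text \<open>The Cauchy estimate holds for sums over finite sets with a bound independent of the set,
  passes to the coordinatewise limit there, and thus bounds the full norm.\<close>

instance ell2 :: (type) banach
proof
  fix X :: "nat \<Rightarrow> 'a ell2" assume X: "Cauchy X"
  have "Cauchy (\<lambda>n. coord (X n) x)" for x
    by (rule bounded_linear.Cauchy[OF bounded_linear_coord X])
  then have "\<forall>x. \<exists>l. (\<lambda>n. coord (X n) x) \<longlonglongrightarrow> l"
    by (simp add: Cauchy_convergent_iff convergent_def)
  then obtain f where f: "\<And>x. (\<lambda>n. coord (X n) x) \<longlonglongrightarrow> f x"
    using choice[of "\<lambda>x l. (\<lambda>n. coord (X n) x) \<longlonglongrightarrow> l"] by auto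
  have bd: "\<exists>N. \<forall>n\<ge>N. \<forall>A. finite A \<longrightarrow> (\<Sum>x\<in>A. (cmod (coord (X n) x - f x))\<^sup>2) \<le> e\<^sup>2" if "e > 0" for e
  proof -
    obtain N where N: "\<And>k n. k \<ge> N \<Longrightarrow> n \<ge> N \<Longrightarrow> norm (X n - X k) < e"
      using X \<open>e > 0\<close> unfolding Cauchy_def dist_norm by metis
    have "(\<Sum>x\<in>A. (cmod (coord (X n) x - f x))\<^sup>2) \<le> e\<^sup>2" if "n \<ge> N" "finite A" for n A
    proof (rule LIMSEQ_le_const2)
      show "(\<lambda>k. \<Sum>x\<in>A. (cmod (coord (X n) x - coord (X k) x))\<^sup>2) \<longlonglongrightarrow> (\<Sum>x\<in>A. (cmod (coord (X n) x - f x))\<^sup>2)"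
        by (intro tendsto_intros f)
      have "(\<Sum>x\<in>A. (cmod (coord (X n) x - coord (X k) x))\<^sup>2) \<le> e\<^sup>2" if "k \<ge> N" for k
      proof -
        have "(\<Sum>x\<in>A. (cmod (coord (X n - X k) x))\<^sup>2) \<le> (norm (X n - X k))\<^sup>2"
          by (rule finite_sum_le_norm_ell2) fact
        also have "\<dots> \<le> e\<^sup>2" using N[OF that \<open>n \<ge> N\<close>] by (intro power_mono) auto
        finally show ?thesis by simp
      qed
      then show "\<exists>K. \<forall>k\<ge>K. (\<Sum>x\<in>A. (cmod (coord (X n) x - coord (X k) x))\<^sup>2) \<le> e\<^sup>2" by blast
    qed
    then show ?thesis by blast
  qed
  obtain N where "\<forall>n\<ge>N. \<forall>A. finite A \<longrightarrow> (\<Sum>x\<in>A. (cmod (coord (X n) x - f x))\<^sup>2) \<le> 1\<^sup>2"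
    using bd[of 1] by auto
  then have "(\<lambda>x. coord (X N) x - f x) \<in> sqsum" by (intro sqsumI_finite[where C = 1]) auto
  from sqsum_add[OF coord_sqsum[of "X N"] sqsum_mult_bounded[OF this, of "\<lambda>_. -1" 1]]
  have "f \<in> sqsum" by simp
  then have cf: "coord (Abs_ell2 f) = f" by (rule coord_Abs)
  have "X \<longlonglongrightarrow> Abs_ell2 f"
  proof (rule metric_LIMSEQ_I)
    fix r :: real assume "0 < r"
    then obtain N where N: "\<forall>n\<ge>N. \<forall>A. finite A \<longrightarrow> (\<Sum>x\<in>A. (cmod (coord (X n) x - f x))\<^sup>2) \<le> (r/2)\<^sup>2"
      using bd[of "r/2"] by auto
    have "norm (X n - Abs_ell2 f) \<le> r/2" if "n \<ge> N" for n
      using N that \<open>0 < r\<close> by (intro norm_ell2_leI) (auto simp: cf)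
    then show "\<exists>no. \<forall>n\<ge>no. dist (X n) (Abs_ell2 f) < r"
      using \<open>0 < r\<close> by (intro exI[of _ N]) (force simp: dist_norm)
  qed
  then show "convergent X" by (rule convergentI)
qed

subsection \<open>Multiplication operators and unit vectors\<close>

text \<open>Total by \<open>Abs_ell2\<close>, but meaningful only where the product is square
  summable: everywhere for bounded \<open>g\<close>, and on \<open>form_dom\<close> for the possibly
  unbounded multiplier \<open>R\<close> used later.\<close>

definition mulo :: "('a \<Rightarrow> complex) \<Rightarrow> 'a ell2 \<Rightarrow> 'a ell2" where
  "mulo g F = Abs_ell2 (\<lambda>x. g x * coord F x)"

lemma coord_mulo:
  assumes "\<And>x. cmod (g x) \<le> M"
  shows "coord (mulo g F) x = g x * coord F x"
  unfolding mulo_def by (subst coord_Abs[OF sqsum_mult_bounded[OF coord_sqsum assms]]) auto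

lemma norm_mulo_le:
  assumes "\<And>x. cmod (g x) \<le> M" "0 \<le> M"
  shows "norm (mulo g F) \<le> M * norm F"
  by (rule norm_ell2_mono) (use assms in \<open>auto simp: coord_mulo[of g M] norm_mult mult_right_mono\<close>)

lemma bounded_linear_mulo:
  assumes "\<And>x. cmod (g x) \<le> M"
  shows "bounded_linear (mulo g)"
proof (rule bounded_linear_intro[where K = "\<bar>M\<bar>"])
  have M: "\<And>x. cmod (g x) \<le> \<bar>M\<bar>" using assms by (meson abs_ge_self order_trans)
  show "norm (mulo g F) \<le> norm F * \<bar>M\<bar>" for F using norm_mulo_le[OF M] by (simp add: mult.commute)
qed (auto intro!: ell2_eqI simp: coord_mulo[of g, OF assms] algebra_simps)

definition cs :: "complex \<Rightarrow> 'a ell2 \<Rightarrow> 'a ell2" where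
  "cs c = mulo (\<lambda>_. c)"

lemma coord_cs [simp]: "coord (cs c F) x = c * coord F x"
  unfolding cs_def by (rule coord_mulo[of _ "cmod c"]) auto

lemma bounded_linear_cs: "bounded_linear (cs c)"
  unfolding cs_def by (rule bounded_linear_mulo[where M = "cmod c"]) simp

definition unitv :: "'a \<Rightarrow> 'a ell2" where
  "unitv z = Abs_ell2 (\<lambda>x. if x = z then 1 else 0)"

lemma coord_unitv [simp]: "coord (unitv z) x = (if x = z then 1 else 0)"
proof -
  have "(\<lambda>x. if x = z then 1 else (0::complex)) \<in> sqsum" unfolding sqsum_def mem_Collect_eq
    by (rule finite_nonzero_values_imp_summable_on, rule finite_subset[of _ "{z}"]) auto
  then show ?thesis unfolding unitv_def by (simp add: coord_Abs)
qed

lemma norm_unitv_le: "norm (unitv (z :: 'a)) \<le> 1"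
proof (rule norm_ell2_leI)
  fix A :: "'a set" assume "finite A"
  then have "(\<Sum>x\<in>A. (cmod (coord (unitv z) x))\<^sup>2) = (\<Sum>x\<in>A. if x = z then 1 else 0)"
    by (intro sum.cong) auto
  then show "(\<Sum>x\<in>A. (cmod (coord (unitv z) x))\<^sup>2) \<le> 1\<^sup>2" using \<open>finite A\<close> by simp
qed auto

definition trunc :: "'a set \<Rightarrow> 'a ell2 \<Rightarrow> 'a ell2" where
  "trunc K = mulo (\<lambda>x. if x \<in> K then 1 else 0)"

lemma coord_trunc [simp]: "coord (trunc K F) x = (if x \<in> K then coord F x else 0)"
  unfolding trunc_def by (subst coord_mulo[of _ 1]) auto

lemma norm_trunc_le: "norm (trunc K F) \<le> norm F"
  using norm_mulo_le[of "\<lambda>x. if x \<in> K then 1 else 0" 1 F] by (simp add: trunc_def)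

lemma bounded_linear_trunc: "bounded_linear (trunc K)"
  unfolding trunc_def by (rule bounded_linear_mulo[where M = 1]) simp

lemma coord_sum: "finite A \<Longrightarrow> coord (sum f A) x = (\<Sum>i\<in>A. coord (f i) x)"
  by (induction A rule: finite_induct) auto

lemma trunc_finite: "finite K \<Longrightarrow> trunc K F = (\<Sum>z\<in>K. cs (coord F z) (unitv z))"
  by (auto intro!: ell2_eqI simp: coord_sum if_distrib[of "(*) _"] sum.delta cong: if_cong)

lemma trunc_tail:
  assumes "0 < e"
  shows "\<exists>K. finite K \<and> norm (F - trunc K F) < e"
proof -
  have "((\<lambda>x. (cmod (coord F x))\<^sup>2) has_sum (norm F)\<^sup>2) UNIV" by (rule has_sum_norm_ell2)
  then have "(sum (\<lambda>x. (cmod (coord F x))\<^sup>2) \<longlongrightarrow> (norm F)\<^sup>2) (finite_subsets_at_top UNIV)"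
    by (simp add: has_sum_def)
  then have "\<forall>\<^sub>F K in finite_subsets_at_top UNIV. dist (sum (\<lambda>x. (cmod (coord F x))\<^sup>2) K) ((norm F)\<^sup>2) < (e/2)\<^sup>2"
    using \<open>0 < e\<close> by (intro tendstoD) auto
  then obtain K where K: "finite K" "dist (sum (\<lambda>x. (cmod (coord F x))\<^sup>2) K) ((norm F)\<^sup>2) < (e/2)\<^sup>2"
    unfolding eventually_finite_subsets_at_top by auto
  have "norm (F - trunc K F) \<le> e/2"
  proof (rule norm_ell2_leI)
    fix A :: "'a set" assume A: "finite A"
    have "(\<Sum>x\<in>A. (cmod (coord (F - trunc K F) x))\<^sup>2) = (\<Sum>x\<in>A - K. (cmod (coord F x))\<^sup>2)"
      using A by (intro sum.mono_neutral_cong_right) auto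
    also have "\<dots> = (\<Sum>x\<in>(A - K) \<union> K. (cmod (coord F x))\<^sup>2) - (\<Sum>x\<in>K. (cmod (coord F x))\<^sup>2)"
      using A K by (subst sum.union_disjoint) auto
    also have "\<dots> \<le> (norm F)\<^sup>2 - (\<Sum>x\<in>K. (cmod (coord F x))\<^sup>2)"
      using finite_sum_le_norm_ell2[of "(A - K) \<union> K" F] A K by simp
    also have "\<dots> \<le> (e/2)\<^sup>2" using K by (auto simp: dist_real_def)
    finally show "(\<Sum>x\<in>A. (cmod (coord (F - trunc K F) x))\<^sup>2) \<le> (e/2)\<^sup>2" .
  qed (use assms in auto)
  then show ?thesis using K \<open>0 < e\<close> by (intro exI[of _ K]) auto
qed

text \<open>Dominated convergence for multipliers: off a finite set the uniform bound
  \<open>M\<close> meets a small tail of \<open>F\<close>, and on the finite set pointwise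
  convergence is enough. This is the source of strong continuity for unbounded \<phi>.\<close>

lemma tendsto_mulo:
  assumes M: "\<And>t x. cmod (g t x) \<le> M" and lim: "\<And>x. ((\<lambda>t. g t x) \<longlongrightarrow> h x) \<F>"
    and h: "\<And>x. cmod (h x) \<le> M"
  shows "((\<lambda>t. mulo (g t) F) \<longlongrightarrow> mulo h F) \<F>"
proof (rule tendstoI)
  fix e :: real assume e: "0 < e"
  have M0: "0 \<le> M" using h[of undefined] norm_ge_zero order_trans by blast
  \<comment> \<open>The difference of two multipliers is bounded by \<open>2 * M\<close>, so the
    tail contributes at most \<open>e / 2\<close>; the summand 4 keeps the denominator positive when
    \<open>M = 0\<close>.\<close>
  obtain K where K: "finite K" "norm (F - trunc K F) < e / (4 * M + 4)"
    using trunc_tail[of "e / (4 * M + 4)" F] e M0 by auto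
  let ?R = "F - trunc K F"
  have "((\<lambda>t. \<Sum>z\<in>K. cmod (g t z - h z) * norm F) \<longlongrightarrow> (\<Sum>z\<in>K. cmod (h z - h z) * norm F)) \<F>"
    by (intro tendsto_intros lim)
  then have "\<forall>\<^sub>F t in \<F>. (\<Sum>z\<in>K. cmod (g t z - h z) * norm F) < e / 2"
    using e by (auto dest!: order_tendstoD(2)[where a = "e/2"])
  then show "\<forall>\<^sub>F t in \<F>. dist (mulo (g t) F) (mulo h F) < e"
  proof eventually_elim
    case (elim t)
    let ?d = "\<lambda>x. g t x - h x"
    have d: "\<And>x. cmod (?d x) \<le> 2 * M"
      using norm_triangle_ineq4 M h by (smt (verit))
    have eq: "mulo (g t) F - mulo h F = mulo ?d (trunc K F) + mulo ?d ?R"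
      by (rule ell2_eqI) (simp add: coord_mulo[of "g t", OF M] coord_mulo[of h, OF h] coord_mulo[of ?d, OF d] algebra_simps)
    have "mulo ?d (trunc K F) = (\<Sum>z\<in>K. cs (?d z * coord F z) (unitv z))"
      using K by (auto intro!: ell2_eqI simp: coord_mulo[of ?d, OF d] coord_sum if_distrib[of "(*) _"] sum.delta cong: if_cong)
    also have "norm \<dots> \<le> (\<Sum>z\<in>K. cmod (?d z) * norm F)"
    proof (rule sum_norm_le)
      fix z
      have "norm (cs (?d z * coord F z) (unitv z)) \<le> cmod (?d z * coord F z) * norm (unitv z)"
        by (rule norm_ell2_mono) (auto simp: norm_mult)
      also have "\<dots> \<le> cmod (?d z * coord F z)"
        using norm_unitv_le by (intro mult_left_le) auto
      also have "\<dots> \<le> cmod (?d z) * norm F" by (simp add: norm_mult mult_left_mono coord_le_norm)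
      finally show "norm (cs (?d z * coord F z) (unitv z)) \<le> cmod (?d z) * norm F" .
    qed
    finally have 1: "norm (mulo ?d (trunc K F)) < e / 2" using elim by simp
    have "norm (mulo ?d ?R) \<le> 2 * M * norm ?R" by (rule norm_mulo_le[OF d]) (use M0 in auto)
    also have "\<dots> \<le> 2 * M * (e / (4 * M + 4))" using K M0 by (intro mult_left_mono) auto
    also have "\<dots> \<le> e / 2" using M0 e by (simp add: field_simps)
    finally show ?case using 1 norm_triangle_ineq[of "mulo ?d (trunc K F)" "mulo ?d ?R"]
      by (simp add: dist_norm eq)
  qed
qed

lemma tendsto_trunc:
  assumes "\<And>x. \<forall>\<^sub>F n in \<F>. x \<in> K n"
  shows "((\<lambda>n. trunc (K n) F) \<longlongrightarrow> F) \<F>"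
proof -
  have "((\<lambda>n. mulo (\<lambda>x. if x \<in> K n then 1 else 0) F) \<longlongrightarrow> mulo (\<lambda>_. 1) F) \<F>"
    by (rule tendsto_mulo[where M = 1]) (auto intro!: tendsto_eventually intro: eventually_mono[OF assms])
  moreover have "mulo (\<lambda>_. 1) F = F" by (rule ell2_eqI) (simp add: coord_mulo[of _ 1])
  ultimately show ?thesis by (simp add: trunc_def)
qed

subsection \<open>The complex inner product\<close>

text \<open>Linear in the first argument; its real part is the \<open>inner\<close> of the type
  class.\<close>

definition cip :: "'a ell2 \<Rightarrow> 'a ell2 \<Rightarrow> complex" where
  "cip F G = (\<Sum>\<^sub>\<infinity>x. coord F x * cnj (coord G x))"

lemma cip_summable: "(\<lambda>x. coord F x * cnj (coord G x)) summable_on UNIV"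
  by (rule abs_summable_summable)
     (use sqsum_product_summable[OF coord_sqsum[of F] coord_sqsum[of G]] in \<open>simp add: norm_mult\<close>)

lemma finite_sum_mult_le_norm:
  assumes "finite A"
  shows "(\<Sum>x\<in>A. cmod (coord F x) * cmod (coord G x)) \<le> norm F * norm G"
proof -
  have "(\<Sum>x\<in>A. cmod (coord F x) * cmod (coord G x)) \<le> L2_set (\<lambda>x. cmod (coord F x)) A * L2_set (\<lambda>x. cmod (coord G x)) A"
    using L2_set_mult_ineq[of "\<lambda>x. cmod (coord F x)" "\<lambda>x. cmod (coord G x)" A] by simp
  also have "\<dots> \<le> norm F * norm G"
    by (intro mult_mono) (auto simp: L2_set_def real_le_lsqrt sum_nonneg finite_sum_le_norm_ell2[OF assms])
  finally show ?thesis .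
qed

lemma norm_cip_le: "cmod (cip F G) \<le> norm F * norm G"
proof -
  have ab: "(\<lambda>x. norm (coord F x * cnj (coord G x))) summable_on UNIV"
    using sqsum_product_summable[OF coord_sqsum[of F] coord_sqsum[of G]] by (simp add: norm_mult)
  have "cmod (cip F G) \<le> (\<Sum>\<^sub>\<infinity>x. cmod (coord F x * cnj (coord G x)))"
    unfolding cip_def by (rule norm_infsum_bound[OF ab])
  also have "\<dots> \<le> norm F * norm G"
  proof (rule infsum_le_finite_sums[OF ab])
    fix A :: "'a set" assume A: "finite A"
    show "(\<Sum>x\<in>A. cmod (coord F x * cnj (coord G x))) \<le> norm F * norm G"
      using finite_sum_mult_le_norm[OF A, of F G] by (simp add: norm_mult)
  qed
  finally show ?thesis .
qed

lemma bounded_bilinear_cip: "bounded_bilinear cip"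
proof
  show "cip (F + F') G = cip F G + cip F' G" for F F' G :: "'a ell2"
    unfolding cip_def by (simp add: distrib_right infsum_add cip_summable)
  show "cip F (G + G') = cip F G + cip F G'" for F G' G :: "'a ell2"
    unfolding cip_def by (simp add: distrib_left infsum_add cip_summable)
  show "cip (r *\<^sub>R F) G = r *\<^sub>R cip F G" for F G :: "'a ell2" and r
    unfolding cip_def by (simp add: infsum_scaleR_right)
  show "cip F (r *\<^sub>R G) = r *\<^sub>R cip F G" for F G :: "'a ell2" and r
    unfolding cip_def by (simp add: infsum_scaleR_right)
  show "\<exists>K. \<forall>F G. norm (cip F G) \<le> norm F * norm (G :: 'a ell2) * K"
    by (rule exI[of _ 1]) (auto simp: norm_cip_le)
qed

lemmas tendsto_cip = bounded_bilinear.tendsto[OF bounded_bilinear_cip]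

lemma cip_unitv: "cip F (unitv x) = coord F x"
proof -
  have "cip F (unitv x) = (\<Sum>\<^sub>\<infinity>y\<in>{x}. coord F y * cnj (coord (unitv x) y))"
    unfolding cip_def by (rule infsum_cong_neutral) auto
  then show ?thesis by simp
qed

subsection \<open>Bounded kernel operators\<close>

text \<open>Boundedness of the kernel of absolute values, tested on finite sets and nonnegative
  functions. This strong notion survives multiplication of the entries by phases and restriction to
  a set of vertices, always with the same \<open>C\<close>.\<close>

definition bounded_kernel :: "real \<Rightarrow> ('a \<Rightarrow> 'a \<Rightarrow> complex) \<Rightarrow> bool" where
  "bounded_kernel C a \<longleftrightarrow> 0 \<le> C \<and> (\<forall>A f g. finite A \<longrightarrow> (\<forall>x. 0 \<le> f x) \<longrightarrow> (\<forall>x. 0 \<le> g x) \<longrightarrow>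
     (\<Sum>x\<in>A. \<Sum>y\<in>A. cmod (a x y) * f x * g y) \<le> C * L2_set f A * L2_set g A)"

definition kop :: "('a \<Rightarrow> 'a \<Rightarrow> complex) \<Rightarrow> 'a ell2 \<Rightarrow> 'a ell2" where
  "kop a F = Abs_ell2 (\<lambda>x. \<Sum>\<^sub>\<infinity>y. a x y * coord F y)"

lemma bounded_kernel_mono:
  assumes "bounded_kernel C a" "\<And>x y. cmod (a' x y) \<le> cmod (a x y)"
  shows "bounded_kernel C a'"
  unfolding bounded_kernel_def
proof (intro conjI allI impI)
  show "0 \<le> C" using assms by (simp add: bounded_kernel_def)
  fix A :: "'a set" and f g :: "'a \<Rightarrow> real"
  assume h: "finite A" "\<forall>x. 0 \<le> f x" "\<forall>x. 0 \<le> g x"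
  have "(\<Sum>x\<in>A. \<Sum>y\<in>A. cmod (a' x y) * f x * g y) \<le> (\<Sum>x\<in>A. \<Sum>y\<in>A. cmod (a x y) * f x * g y)"
    using h assms(2) by (intro sum_mono mult_right_mono) auto
  also have "\<dots> \<le> C * L2_set f A * L2_set g A" using assms(1) h by (simp add: bounded_kernel_def)
  finally show "(\<Sum>x\<in>A. \<Sum>y\<in>A. cmod (a' x y) * f x * g y) \<le> C * L2_set f A * L2_set g A" .
qed

context
  fixes C :: real and a :: "'a \<Rightarrow> 'a \<Rightarrow> complex"
  assumes bk: "bounded_kernel C a"
begin

lemma bounded_kernel_L2:
  assumes "finite A" "finite B" "\<And>x. 0 \<le> g x"
  shows "(\<Sum>x\<in>A. \<Sum>y\<in>B. cmod (a x y) * g x * cmod (coord F y)) \<le> C * L2_set g A * norm F"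
proof -
  \<comment> \<open>Cutting off to \<open>B\<close> and \<open>A\<close> brings the rectangular sum
    into the square over \<open>A \<union> B\<close> that \<open>bounded_kernel\<close> speaks
    of.\<close>
  let ?f = "\<lambda>y. if y \<in> B then cmod (coord F y) else 0" and ?g = "\<lambda>x. if x \<in> A then g x else 0"
  have C: "0 \<le> C" using bk by (simp add: bounded_kernel_def)
  have "(\<Sum>x\<in>A. \<Sum>y\<in>B. cmod (a x y) * g x * cmod (coord F y)) = (\<Sum>x\<in>A\<union>B. \<Sum>y\<in>A\<union>B. cmod (a x y) * ?g x * ?f y)"
    using assms
    by (intro sum.mono_neutral_cong_left ballI sum.neutral) (auto intro!: sum.mono_neutral_cong_left)
  also have "\<dots> \<le> C * L2_set ?g (A \<union> B) * L2_set ?f (A \<union> B)"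
    using bk assms unfolding bounded_kernel_def by auto
  also have "L2_set ?g (A \<union> B) = L2_set g A"
    unfolding L2_set_def using assms by (intro arg_cong[of _ _ sqrt] sum.mono_neutral_cong_right) auto
  also have "L2_set ?f (A \<union> B) = L2_set (\<lambda>y. cmod (coord F y)) B"
    unfolding L2_set_def using assms by (intro arg_cong[of _ _ sqrt] sum.mono_neutral_cong_right) auto
  also have "C * L2_set g A * \<dots> \<le> C * L2_set g A * norm F"
    using C by (intro mult_left_mono) (auto simp: L2_set_def real_le_lsqrt sum_nonneg finite_sum_le_norm_ell2 assms)
  finally show ?thesis .
qed

lemma kernel_abs_summable: "(\<lambda>y. norm (a x y * coord F y)) summable_on UNIV"
proof (rule nonneg_bdd_above_summable_on)
  show "bdd_above (sum (\<lambda>y. cmod (a x y * coord F y)) ` {B. B \<subseteq> UNIV \<and> finite B})"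
    using bounded_kernel_L2[of "{x}" _ "\<lambda>_. 1"]
    by (intro bdd_aboveI[of _ "C * norm F"]) (auto simp: L2_set_def norm_mult)
qed auto

lemma kernel_summable: "(\<lambda>y. a x y * coord F y) summable_on UNIV"
  by (rule abs_summable_summable[OF kernel_abs_summable])

text \<open>Duality: the kernel is tested against the absolute values of its own image. For the norm
  s of the image on \<open>A\<close> this gives that s squared is at most \<open>C * norm F\<close>
  times s, and one factor s cancels.\<close>

lemma kernel_finite_bound:
  assumes A: "finite A"
  shows "(\<Sum>x\<in>A. (cmod (\<Sum>\<^sub>\<infinity>y. a x y * coord F y))\<^sup>2) \<le> (C * norm F)\<^sup>2"
proof -
  let ?g = "\<lambda>x. cmod (\<Sum>\<^sub>\<infinity>y. a x y * coord F y)"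
  have C: "0 \<le> C" using bk by (simp add: bounded_kernel_def)
  have "(\<Sum>x\<in>A. (?g x)\<^sup>2) \<le> (\<Sum>x\<in>A. ?g x * (\<Sum>\<^sub>\<infinity>y. cmod (a x y * coord F y)))"
    by (intro sum_mono) (auto simp: power2_eq_square intro!: mult_left_mono norm_infsum_bound kernel_abs_summable)
  also have "\<dots> = (\<Sum>\<^sub>\<infinity>y. \<Sum>x\<in>A. ?g x * cmod (a x y * coord F y))"
    using A by (subst infsum_cmult_right[symmetric])
      (auto intro!: kernel_abs_summable infsumI[symmetric] has_sum_finite_sum has_sum_infsum summable_on_cmult_right)
  also have "\<dots> \<le> C * L2_set ?g A * norm F"
  proof (rule infsum_le_finite_sums)
    show "(\<lambda>y. \<Sum>x\<in>A. ?g x * cmod (a x y * coord F y)) summable_on UNIV"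
      using A by (auto intro!: has_sum_imp_summable[OF has_sum_finite_sum] has_sum_infsum summable_on_cmult_right kernel_abs_summable)
    fix B :: "'a set" assume "finite B"
    then show "(\<Sum>y\<in>B. \<Sum>x\<in>A. ?g x * cmod (a x y * coord F y)) \<le> C * L2_set ?g A * norm F"
      using bounded_kernel_L2[OF A, of B ?g F] by (subst sum.swap) (simp add: norm_mult mult_ac)
  qed
  also have "(\<Sum>x\<in>A. (?g x)\<^sup>2) = (L2_set ?g A)\<^sup>2" by (simp add: L2_set_def sum_nonneg)
  finally have "(L2_set ?g A)\<^sup>2 \<le> C * L2_set ?g A * norm F" .
  then have "L2_set ?g A \<le> C * norm F"
    using C L2_set_nonneg[of ?g A] by (cases "L2_set ?g A = 0") (auto simp: power2_eq_square)
  then have "(L2_set ?g A)\<^sup>2 \<le> (C * norm F)\<^sup>2" by (intro power_mono) auto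
  then show ?thesis by (simp add: L2_set_def sum_nonneg)
qed

lemma coord_kop: "coord (kop a F) x = (\<Sum>\<^sub>\<infinity>y. a x y * coord F y)"
  unfolding kop_def by (subst coord_Abs[OF sqsumI_finite[OF kernel_finite_bound]]) auto

lemma norm_kop_le: "norm (kop a F) \<le> C * norm F"
proof (rule norm_ell2_leI)
  show "0 \<le> C * norm F" using bk by (simp add: bounded_kernel_def)
qed (simp add: coord_kop kernel_finite_bound)

lemma bounded_linear_kop: "bounded_linear (kop a)"
  by (rule bounded_linear_intro[where K = C])
     (use norm_kop_le in \<open>auto intro!: ell2_eqI
       simp: coord_kop distrib_left infsum_add kernel_summable infsum_scaleR_right mult.commute[of C]\<close>)

lemma kop_cs: "kop a (cs c F) = cs c (kop a F)"
  by (rule ell2_eqI) (simp add: coord_kop mult.left_commute[of _ c] infsum_cmult_right kernel_summable)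

lemma coord_kop_unitv: "coord (kop a (unitv y)) x = a x y"
proof -
  have "coord (kop a (unitv y)) x = (\<Sum>\<^sub>\<infinity>z\<in>{y}. a x z * coord (unitv y) z)"
    unfolding coord_kop by (rule infsum_cong_neutral) auto
  then show ?thesis by simp
qed

end

section \<open>Evolution equations with bounded perturbation\<close>

text \<open>The function \<open>?H\<close>, the right-hand side of the assumption times the
  integrating factor, has a nonpositive derivative, and \<open>?H 0 = a\<close>.\<close>

lemma gronwall:
  fixes f :: "real \<Rightarrow> real"
  assumes cont: "continuous_on {0..T} f" and "0 \<le> T" "0 \<le> c"
    and le: "\<And>t. t \<in> {0..T} \<Longrightarrow> f t \<le> a + c * integral {0..t} f"
  shows "f T \<le> a * exp (c * T)"
proof -
  let ?I = "\<lambda>s. a + c * integral {0..s} f"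
  let ?H = "\<lambda>s. exp (- c * s) * ?I s"
  have dI: "(?I has_real_derivative c * f s) (at s within {0..T})" if "s \<in> {0..T}" for s
    using integral_has_real_derivative[OF cont that] by (auto intro!: derivative_eq_intros)
  have dH: "(?H has_vector_derivative exp (- c * s) * (c * f s) - c * exp (- c * s) * ?I s) (at s within {0..T})"
    if "s \<in> {0..T}" for s
    unfolding has_real_derivative_iff_has_vector_derivative[symmetric]
    by (rule derivative_eq_intros dI[OF that] refl)+ (auto simp: algebra_simps)
  have I: "((\<lambda>s. exp (- c * s) * (c * f s) - c * exp (- c * s) * ?I s) has_integral ?H T - ?H 0) {0..T}"
    using assms dH by (intro fundamental_theorem_of_calculus) auto
  have bd: "exp (- c * s) * (c * f s) - c * exp (- c * s) * ?I s \<le> 0" if "s \<in> {0..T}" for s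
  proof -
    have "exp (- c * s) * c * f s \<le> exp (- c * s) * c * ?I s"
      using le[OF that] \<open>0 \<le> c\<close> by (intro mult_left_mono) auto
    then show ?thesis by (simp add: mult_ac)
  qed
  have "?H T - ?H 0 \<le> 0"
    by (rule has_integral_le[OF I has_integral_0]) (rule bd)
  then have "exp (- c * T) * ?I T \<le> a" by simp
  then have "exp (c * T) * (exp (- c * T) * ?I T) \<le> exp (c * T) * a"
    by (intro mult_left_mono) auto
  moreover have "exp (c * T) * (exp (- c * T) * ?I T) = ?I T"
    unfolding mult.assoc[symmetric] exp_add[symmetric] by simp
  ultimately have "?I T \<le> exp (c * T) * a" by (simp only:)
  then show ?thesis using le[of T] \<open>0 \<le> T\<close> by (simp add: mult.commute)
qed

text \<open>The values of \<open>w\<close> need not lie in the domain of \<phi>, so the full squared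
  norm cannot be differentiated directly. On a finite set of coordinates the derivative exists, and
  there the contribution of \<phi> has the sign of \<open>Re \<phi>\<close> and drops out, so the
  bound does not depend on the set.\<close>

lemma energy:
  assumes re: "\<And>x. Re (\<phi> x) \<le> 0"
    and cw: "continuous_on {0..} w" and cr: "continuous_on {0..} r"
    and der: "\<And>x s. 0 \<le> s \<Longrightarrow> ((\<lambda>s. coord (w s) x) has_vector_derivative
       (\<phi> x * coord (w s) x + coord (r s) x)) (at s within {0..})"
    and t: "0 \<le> t"
  shows "(norm (w t))\<^sup>2 \<le> (norm (w 0))\<^sup>2 + integral {0..t} (\<lambda>s. 2 * (norm (r s) * norm (w s)))"
proof (rule norm_ell2_square_leI)
  fix A :: "'a set" assume A: "finite A"
  let ?g = "\<lambda>s. \<Sum>x\<in>A. inner (coord (w s) x) (coord (w s) x)"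
  let ?d = "\<lambda>s x. \<phi> x * coord (w s) x + coord (r s) x"
  let ?g' = "\<lambda>s. \<Sum>x\<in>A. inner (coord (w s) x) (?d s x) + inner (?d s x) (coord (w s) x)"
  have "(?g has_vector_derivative ?g' s) (at s within {0..t})" if "s \<in> {0..t}" for s
    using that
    by (intro has_vector_derivative_sum bounded_bilinear.has_vector_derivative[OF bounded_bilinear_inner]
        has_vector_derivative_within_subset[OF der]) auto
  then have I: "(?g' has_integral ?g t - ?g 0) {0..t}"
    using t by (intro fundamental_theorem_of_calculus) auto
  have "continuous_on {0..t} (\<lambda>s. 2 * (norm (r s) * norm (w s)))"
    by (intro continuous_intros continuous_on_subset[OF cw] continuous_on_subset[OF cr]) auto
  then have J: "((\<lambda>s. 2 * (norm (r s) * norm (w s))) has_integral integral {0..t} (\<lambda>s. 2 * (norm (r s) * norm (w s)))) {0..t}"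
    by (intro integrable_integral integrable_continuous_real)
  have le: "?g' s \<le> 2 * (norm (r s) * norm (w s))" for s
  proof -
    have "inner u (p * u + q) + inner (p * u + q) u \<le> 2 * (cmod q * cmod u)" if "Re p \<le> 0" for p q u
    proof -
      have "inner u (p * u) = Re p * (cmod u)\<^sup>2"
        by (simp add: inner_complex_def cmod_power2 algebra_simps) (simp add: power2_eq_square algebra_simps)
      moreover have "inner u (p * u) = inner (p * u) u" "inner u q = inner q u" by (simp_all add: inner_commute)
      moreover have "Re p * (cmod u)\<^sup>2 \<le> 0" using that by (simp add: mult_nonpos_nonneg)
      moreover have "inner u q \<le> cmod q * cmod u" using norm_cauchy_schwarz[of q u] by (simp add: inner_commute)
      ultimately show ?thesis unfolding inner_add_left inner_add_right by linarith
    qed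
    then have "?g' s \<le> (\<Sum>x\<in>A. 2 * (cmod (coord (r s) x) * cmod (coord (w s) x)))"
      by (intro sum_mono) (use re in auto)
    also have "\<dots> \<le> 2 * (norm (r s) * norm (w s))"
      unfolding sum_distrib_left[symmetric] by (intro mult_left_mono finite_sum_mult_le_norm A) auto
    finally show ?thesis .
  qed
  have "?g t - ?g 0 \<le> integral {0..t} (\<lambda>s. 2 * (norm (r s) * norm (w s)))"
    by (rule has_integral_le[OF I J]) (rule le)
  moreover have "?g s = (\<Sum>x\<in>A. (cmod (coord (w s) x))\<^sup>2)" for s
    by (simp add: power2_norm_eq_inner)
  moreover have "(\<Sum>x\<in>A. (cmod (coord (w 0) x))\<^sup>2) \<le> (norm (w 0))\<^sup>2"
    by (rule finite_sum_le_norm_ell2[OF A])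
  ultimately show "(\<Sum>x\<in>A. (cmod (coord (w t) x))\<^sup>2) \<le> (norm (w 0))\<^sup>2 + integral {0..t} (\<lambda>s. 2 * (norm (r s) * norm (w s)))"
    by simp
qed

lemma has_vector_derivative_at_right_0:
  fixes f :: "real \<Rightarrow> 'b::real_normed_vector"
  assumes "(f has_vector_derivative D) (at_right 0)"
  shows "((\<lambda>h. (f h - f 0) /\<^sub>R h) \<longlongrightarrow> D) (at_right 0)"
proof -
  have "((\<lambda>h. (1 / norm (h - 0)) *\<^sub>R (f h - (f 0 + (h - 0) *\<^sub>R D))) \<longlongrightarrow> 0) (at_right 0)"
    using assms unfolding has_vector_derivative_def has_derivative_within by auto
  then have "((\<lambda>h. (f h - f 0) /\<^sub>R h - D) \<longlongrightarrow> 0) (at_right 0)"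
    by (rule Lim_transform_eventually)
       (auto simp: eventually_at_filter field_simps scaleR_diff_right intro!: always_eventually)
  then show ?thesis by (rule LIM_zero_cancel)
qed

text \<open>The derivative is taken coordinatewise, since \<open>\<phi>\<close> may be unbounded and the values of \<open>u\<close> need
  not lie in the domain of the multiplication operator.\<close>

definition evol :: "('a \<Rightarrow> complex) \<Rightarrow> ('a ell2 \<Rightarrow> 'a ell2) \<Rightarrow> (real \<Rightarrow> 'a ell2) \<Rightarrow> bool" where
  "evol \<phi> B u \<longleftrightarrow> continuous_on {0..} u \<and> (\<forall>x. \<forall>s\<ge>0. ((\<lambda>s. coord (u s) x) has_vector_derivative
     (\<phi> x * coord (u s) x + coord (B (u s)) x)) (at s within {0..}))"

text \<open>\<open>bounded_linear\<close> refers to real scalars only; compatibility of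
  \<open>B\<close> with complex scalars is recorded as \<open>cs_commute\<close>. The condition on
  \<open>Re \<phi>\<close> admits both \<open>- deg\<close> and
  \<open>- \<i> * (v + deg)\<close>.\<close>

locale evolution =
  fixes \<phi> :: "'a \<Rightarrow> complex" and B :: "'a ell2 \<Rightarrow> 'a ell2" and C :: real
  assumes Re_nonpos: "\<And>x. Re (\<phi> x) \<le> 0"
    and bl: "bounded_linear B" and bound: "\<And>F. norm (B F) \<le> C * norm F" and C: "0 \<le> C"
    and cs_commute: "\<And>c F. B (cs c F) = cs c (B F)"
begin

lemmas B_cont [continuous_intros] = bounded_linear.continuous_on[OF bl]

text \<open>\<open>energy\<close> and \<open>gronwall\<close> are applied to the squared norm,
  whence the rate \<open>2 * C\<close> inside and \<open>C\<close> after taking the root.\<close>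

lemma evol_norm_le:
  assumes "evol \<phi> B u" "0 \<le> t"
  shows "norm (u t) \<le> exp (C * t) * norm (u 0)"
proof -
  have cu: "continuous_on {0..} u" using assms by (simp add: evol_def)
  have "(norm (u t))\<^sup>2 \<le> (norm (u 0))\<^sup>2 * exp (2 * C * t)"
  proof (rule gronwall)
    show "continuous_on {0..t} (\<lambda>t. (norm (u t))\<^sup>2)"
      by (intro continuous_intros continuous_on_subset[OF cu]) auto
    show "0 \<le> 2 * C" using C by simp
    fix s assume s: "s \<in> {0..t}"
    have cus: "continuous_on {0..s} u" by (rule continuous_on_subset[OF cu]) auto
    have "(norm (u s))\<^sup>2 \<le> (norm (u 0))\<^sup>2 + integral {0..s} (\<lambda>s. 2 * (norm (B (u s)) * norm (u s)))"
      using assms s by (intro energy[OF Re_nonpos]) (auto simp: evol_def intro!: continuous_intros)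
    also have "integral {0..s} (\<lambda>s. 2 * (norm (B (u s)) * norm (u s))) \<le> integral {0..s} (\<lambda>s. 2 * C * (norm (u s))\<^sup>2)"
    proof (intro integral_le integrable_continuous_real continuous_intros cus)
      fix r
      have "norm (B (u r)) * norm (u r) \<le> (C * norm (u r)) * norm (u r)"
        by (intro mult_right_mono bound) auto
      then show "2 * (norm (B (u r)) * norm (u r)) \<le> 2 * C * (norm (u r))\<^sup>2"
        by (simp add: power2_eq_square)
    qed
    finally show "(norm (u s))\<^sup>2 \<le> (norm (u 0))\<^sup>2 + 2 * C * integral {0..s} (\<lambda>t. (norm (u t))\<^sup>2)"
      by simp
  qed (use assms in auto)
  also have "\<dots> = (exp (C * t) * norm (u 0))\<^sup>2"
    by (simp add: power_mult_distrib power2_eq_square exp_add[symmetric])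
  finally show ?thesis by (rule power2_le_imp_le) auto
qed

lemma evol_add: "evol \<phi> B u \<Longrightarrow> evol \<phi> B w \<Longrightarrow> evol \<phi> B (\<lambda>t. u t + w t)"
  unfolding evol_def by (auto intro!: continuous_intros derivative_eq_intros
      simp: linear_add[OF bounded_linear.linear[OF bl]] algebra_simps)

lemma evol_cs: "evol \<phi> B u \<Longrightarrow> evol \<phi> B (\<lambda>t. cs c (u t))"
  unfolding evol_def
  by (auto intro!: bounded_linear.continuous_on[OF bounded_linear_cs] derivative_eq_intros
      simp: cs_commute algebra_simps)

lemma evol_shift:
  assumes u: "evol \<phi> B u" and "0 \<le> a"
  shows "evol \<phi> B (\<lambda>t. u (a + t))"
  unfolding evol_def
proof (intro conjI allI impI)
  show "continuous_on {0..} (\<lambda>t. u (a + t))"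
  proof (rule continuous_on_compose2[of "{0..}" u "{0..}" "\<lambda>t. a + t"])
    show "continuous_on {0..} u" using u by (simp add: evol_def)
    show "continuous_on {0..} (\<lambda>t. a + t)" by (intro continuous_intros)
  qed (use assms in auto)
  fix x and s :: real assume s: "0 \<le> s"
  have "((\<lambda>s. coord (u s) x) has_vector_derivative (\<phi> x * coord (u (a + s)) x + coord (B (u (a + s))) x))
     (at (a + s) within (+) a ` {0..})"
    by (rule has_vector_derivative_within_subset[of _ _ _ "{0..}"]) (use assms s in \<open>auto simp: evol_def\<close>)
  moreover have "((+) a has_vector_derivative 1) (at s within {0..})"
    by (auto intro!: derivative_eq_intros)
  ultimately show "((\<lambda>s. coord (u (a + s)) x) has_vector_derivative \<phi> x * coord (u (a + s)) x + coord (B (u (a + s))) x)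
      (at s within {0..})"
    using vector_diff_chain_within[of "(+) a" 1 s "{0..}" "\<lambda>s. coord (u s) x"] by (simp add: o_def)
qed

lemma evol_unique:
  assumes "evol \<phi> B u" "evol \<phi> B w" "u 0 = w 0" "0 \<le> t"
  shows "u t = w t"
proof -
  have "evol \<phi> B (\<lambda>t. u t + cs (-1) (w t))" by (intro evol_add evol_cs assms)
  from evol_norm_le[OF this assms(4)] have "norm (u t + cs (- 1) (w t)) \<le> exp (C * t) * norm (u 0 + cs (- 1) (u 0))"
    by (simp add: assms(3))
  moreover have "F + cs (-1) G = F - G" for F G :: "'a ell2" by (rule ell2_eqI) simp
  ultimately show ?thesis by simp
qed

subsection \<open>Existence by contraction\<close>

text \<open>Rate of an exponential damping that turns the Duhamel map into a contraction on the
  whole half line, with constant \<open>C / damp < 1\<close>; the added 1 keeps it positive when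
  \<open>C = 0\<close>.\<close>

definition damp :: real where "damp = 2 * C + 1"

text \<open>The damped semigroup of the multiplication part. \<open>max 0 t\<close> extends it by
  the identity to negative times, because the fixed point is sought among bounded continuous
  functions on all of the reals.\<close>

definition Sd :: "real \<Rightarrow> 'a ell2 \<Rightarrow> 'a ell2" where
  "Sd t = mulo (\<lambda>x. exp (of_real (max 0 t) * (\<phi> x - of_real damp)))"

lemma Sd_mult_bound: "cmod (exp (of_real (max 0 t) * (\<phi> x - of_real damp))) \<le> exp (- damp * max 0 t)"
proof -
  have "max 0 t * Re (\<phi> x) \<le> 0" using Re_nonpos[of x] by (simp add: mult_nonneg_nonpos)
  then show ?thesis by (simp add: algebra_simps)
qed

lemma damp_pos: "0 < damp" using C by (simp add: damp_def)

lemma Sd_mult_bound1: "cmod (exp (of_real (max 0 t) * (\<phi> x - of_real damp))) \<le> 1"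
  using Sd_mult_bound[of t x] damp_pos order_trans[OF Sd_mult_bound[of t x], of 1] by simp

lemma norm_Sd_le: "norm (Sd t F) \<le> exp (- damp * max 0 t) * norm F"
  unfolding Sd_def by (rule norm_mulo_le[OF Sd_mult_bound]) auto

lemma norm_Sd_le1: "norm (Sd t F) \<le> norm F"
  unfolding Sd_def using norm_mulo_le[of _ 1 F, OF Sd_mult_bound1] by simp

lemma bounded_linear_Sd: "bounded_linear (Sd t)"
  unfolding Sd_def by (rule bounded_linear_mulo[OF Sd_mult_bound1])

lemma coord_Sd: "coord (Sd t F) x = exp (of_real (max 0 t) * (\<phi> x - of_real damp)) * coord F x"
  unfolding Sd_def by (rule coord_mulo[OF Sd_mult_bound1])

text \<open>Continuity in time holds strongly, while the operator norm is controlled by 1: moving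
  the vector costs at most the distance, and for a fixed vector \<open>tendsto_mulo\<close>
  applies.\<close>

lemma Sd_jointly_continuous: "continuous_on UNIV (\<lambda>p. Sd (fst p) (snd p))"
  unfolding continuous_on_def
proof (intro ballI)
  fix p :: "real \<times> 'a ell2"
  let ?f = "\<lambda>q. Sd (fst q) (snd q - snd p)" and ?g = "\<lambda>q. Sd (fst q) (snd p)"
  have "((\<lambda>q. norm (snd q - snd p)) \<longlongrightarrow> norm (snd p - snd p)) (at p)"
    by (intro tendsto_intros)
  then have f: "(?f \<longlongrightarrow> 0) (at p)"
    by (intro Lim_null_comparison[of ?f "\<lambda>q. norm (snd q - snd p)"]) (auto intro!: always_eventually norm_Sd_le1)
  have g: "(?g \<longlongrightarrow> Sd (fst p) (snd p)) (at p)" unfolding Sd_def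
    by (rule tendsto_mulo[OF Sd_mult_bound1 _ Sd_mult_bound1]) (intro tendsto_intros)
  have "(\<lambda>q. Sd (fst q) (snd q)) = (\<lambda>q. ?f q + ?g q)"
    by (rule ext) (simp add: linear_diff[OF bounded_linear.linear[OF bounded_linear_Sd]])
  then show "((\<lambda>q. Sd (fst q) (snd q)) \<longlongrightarrow> Sd (fst p) (snd p)) (at p)"
    using tendsto_add[OF f g] by simp
qed

lemma continuous_on_Sd [continuous_intros]:
  assumes "continuous_on A f" "continuous_on A g"
  shows "continuous_on A (\<lambda>s. Sd (f s) (g s))"
  using continuous_on_compose2[OF Sd_jointly_continuous continuous_on_Pair[OF assms]] by simp

text \<open>Convolution of the damped semigroup with a forcing term, that is, the Duhamel
  integral.\<close>

definition conv :: "(real \<Rightarrow> 'a ell2) \<Rightarrow> real \<Rightarrow> 'a ell2" where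
  "conv w t = integral {0..t} (\<lambda>s. Sd (t - s) (w s))"

text \<open>Rescaling the interval of integration to \<open>{0..1}\<close> moves the dependence on
  \<open>t\<close> into the integrand, where continuity in a parameter can be used.\<close>

lemma conv_continuous:
  assumes w: "continuous_on UNIV w"
  shows "continuous_on {0..} (conv w)"
proof -
  have eq: "conv w t = t *\<^sub>R integral {0..1} (\<lambda>r. Sd (t - t * r) (w (t * r)))" if "0 \<le> t" for t
  proof (cases "t = 0")
    case False
    then have t: "0 < t" using that by simp
    have "((\<lambda>s. Sd (t - s) (w s)) has_integral conv w t) {0..t}" unfolding conv_def
      by (intro integrable_integral integrable_continuous_real continuous_intros continuous_on_subset[OF w]) auto
    from has_integral_stretch_real[OF this, of t] t
    have "((\<lambda>r. Sd (t - t * r) (w (t * r))) has_integral (1 / t) *\<^sub>R conv w t) ((\<lambda>x. x / t) ` {0..t})" by simp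
    moreover have "(\<lambda>x. x / t) ` {0..t} = {0..1}"
      using t by (auto simp: image_iff field_simps intro!: bexI[of _ "_ * t"])
    ultimately have "integral {0..1} (\<lambda>r. Sd (t - t * r) (w (t * r))) = (1 / t) *\<^sub>R conv w t"
      by (metis integral_unique)
    then show ?thesis using t by simp
  qed (simp add: conv_def)
  have "continuous_on ({0..} \<times> cbox 0 (1::real)) (\<lambda>(t, r). Sd (t - t * r) (w (t * r)))"
    unfolding split_beta by (intro continuous_intros continuous_on_compose2[OF w]) auto
  from integral_continuous_on_param[OF this]
  have "continuous_on {0..} (\<lambda>t. t *\<^sub>R integral {0..1} (\<lambda>r. Sd (t - t * r) (w (t * r))))"
    by (intro continuous_intros) auto
  then show ?thesis by (rule continuous_on_eq) (simp add: eq)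
qed

text \<open>\<open>1 / damp\<close> bounds the total mass of the damping factor over the half
  line.\<close>

lemma norm_conv_le:
  assumes w: "continuous_on UNIV w" and bd: "\<And>s. norm (w s) \<le> M" and t: "0 \<le> t"
  shows "norm (conv w t) \<le> M / damp"
proof -
  have M: "0 \<le> M" using bd[of 0] norm_ge_zero order_trans by blast
  have I: "((\<lambda>s. exp (- damp * (t - s)) * M) has_integral M / damp - exp (- damp * t) * (M / damp)) {0..t}"
  proof -
    have "((\<lambda>s. exp (- damp * (t - s)) * M) has_integral
        exp (- damp * (t - t)) * M / damp - exp (- damp * (t - 0)) * M / damp) {0..t}"
      using t damp_pos
      by (intro fundamental_theorem_of_calculus)
         (auto simp: has_real_derivative_iff_has_vector_derivative[symmetric] intro!: derivative_eq_intros)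
    then show ?thesis by simp
  qed
  have "norm (conv w t) \<le> integral {0..t} (\<lambda>s. exp (- damp * (t - s)) * M)"
    unfolding conv_def
  proof (rule integral_norm_bound_integral)
    show "(\<lambda>s. Sd (t - s) (w s)) integrable_on {0..t}"
      by (intro integrable_continuous_real continuous_intros continuous_on_subset[OF w]) auto
    show "(\<lambda>s. exp (- damp * (t - s)) * M) integrable_on {0..t}" using I by auto
    fix s assume "s \<in> {0..t}"
    then have "norm (Sd (t - s) (w s)) \<le> exp (- damp * (t - s)) * norm (w s)"
      using norm_Sd_le[of "t - s" "w s"] by simp
    also have "\<dots> \<le> exp (- damp * (t - s)) * M" by (intro mult_left_mono bd) auto
    finally show "norm (Sd (t - s) (w s)) \<le> exp (- damp * (t - s)) * M" .
  qed
  also have "\<dots> \<le> M / damp" using integral_unique[OF I] M damp_pos by simp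
  finally show ?thesis .
qed

text \<open>In a single coordinate the factor depending on \<open>t\<close> can be pulled out of the
  integral, leaving an ordinary primitive to differentiate. On the level of operators the remaining
  backward factor may be unbounded.\<close>

lemma coord_conv:
  assumes w: "continuous_on UNIV w" and t: "0 \<le> t"
  shows "coord (conv w t) x = exp (of_real t * (\<phi> x - of_real damp)) *
    integral {0..t} (\<lambda>s. exp (- of_real s * (\<phi> x - of_real damp)) * coord (w s) x)"
proof -
  have "(\<lambda>s. Sd (t - s) (w s)) integrable_on {0..t}"
    by (intro integrable_continuous_real continuous_intros continuous_on_subset[OF w]) auto
  from integral_linear[OF this bounded_linear_coord[of x]]
  have "coord (conv w t) x = integral {0..t} (\<lambda>s. coord (Sd (t - s) (w s)) x)"
    unfolding conv_def by (simp add: o_def)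
  also have "\<dots> = integral {0..t} (\<lambda>s. exp (of_real t * (\<phi> x - of_real damp)) *
      (exp (- of_real s * (\<phi> x - of_real damp)) * coord (w s) x))"
  proof (rule integral_cong)
    fix s assume s: "s \<in> {0..t}"
    have "exp (of_real (t - s) * (\<phi> x - of_real damp)) =
      exp (of_real t * (\<phi> x - of_real damp)) * exp (- of_real s * (\<phi> x - of_real damp))"
      by (simp add: left_diff_distrib flip: exp_add)
    then show "coord (Sd (t - s) (w s)) x = exp (of_real t * (\<phi> x - of_real damp)) *
      (exp (- of_real s * (\<phi> x - of_real damp)) * coord (w s) x)"
      using s by (simp only: coord_Sd mult.assoc) simp
  qed
  finally show ?thesis by (simp add: integral_mult_right)
qed

lemma Picard:
  assumes v: "continuous_on UNIV v" "\<And>s. norm (v s) \<le> M"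
  shows "(\<lambda>t. Sd t F + conv (\<lambda>s. B (v s)) (max 0 t)) \<in> bcontfun"
  unfolding bcontfun_def mem_Collect_eq
proof
  have w: "continuous_on UNIV (\<lambda>s. B (v s))" by (intro continuous_intros v)
  show "continuous_on UNIV (\<lambda>t. Sd t F + conv (\<lambda>s. B (v s)) (max 0 t))"
    by (intro continuous_intros continuous_on_compose2[OF conv_continuous[OF w]]) auto
  have b: "norm (B (v s)) \<le> C * M" for s
    by (rule order_trans[OF bound]) (intro mult_left_mono v C)
  have "norm (Sd t F + conv (\<lambda>s. B (v s)) (max 0 t)) \<le> norm F + C * M / damp" for t
    by (intro order_trans[OF norm_triangle_ineq] add_mono norm_Sd_le1 norm_conv_le[OF w b]) auto
  then show "bounded (range (\<lambda>t. Sd t F + conv (\<lambda>s. B (v s)) (max 0 t)))"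
    by (auto intro!: boundedI[of _ "norm F + C * M / damp"])
qed

lemma fixed_point: "\<exists>v. continuous_on UNIV v \<and> (\<forall>t\<ge>0. v t = Sd t F + conv (\<lambda>s. B (v s)) t)"
proof -
  let ?T = "\<lambda>v::real \<Rightarrow>\<^sub>C 'a ell2. Bcontfun (\<lambda>t. Sd t F + conv (\<lambda>s. B (v s)) (max 0 t))"
  have cont: "continuous_on UNIV (\<lambda>s. B (apply_bcontfun v s))" for v
    by (intro continuous_intros) auto
  have app: "apply_bcontfun (?T v) t = Sd t F + conv (\<lambda>s. B (v s)) (max 0 t)" for v t
  proof -
    obtain M where "\<And>s. norm (apply_bcontfun v s) \<le> M"
      using bounded_apply_bcontfun[of v] by (auto simp: bounded_iff)
    from Picard[OF _ this] show ?thesis by (simp add: Bcontfun_inverse)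
  qed
  \<comment> \<open>The free term cancels, so only the Duhamel integral of the difference remains;
    it gains \<open>C\<close> from \<open>B\<close> and \<open>1 / damp\<close> from the
    damping.\<close>
  have "dist (?T v) (?T w) \<le> (C / damp) * dist v w" for v w
  proof (rule dist_bound)
    fix t
    let ?w = "\<lambda>s. B (v s) - B (w s)"
    have cw: "continuous_on UNIV ?w" by (intro continuous_intros) auto
    have b: "norm (?w s) \<le> C * dist v w" for s
    proof -
      have "norm (?w s) \<le> C * norm (v s - w s)" using bound by (simp add: linear_diff[OF bounded_linear.linear[OF bl], symmetric])
      also have "\<dots> \<le> C * dist v w" using C dist_bounded[of v s w] by (intro mult_left_mono) (auto simp: dist_norm)
      finally show ?thesis .
    qed
    have "conv (\<lambda>s. B (v s)) r - conv (\<lambda>s. B (w s)) r = conv ?w r" for r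
      unfolding conv_def
      by (subst integral_diff[symmetric])
         (auto simp: linear_diff[OF bounded_linear.linear[OF bounded_linear_Sd]]
           intro!: integrable_continuous_real continuous_intros continuous_on_subset[OF cont])
    then show "dist (apply_bcontfun (?T v) t) (apply_bcontfun (?T w) t) \<le> (C / damp) * dist v w"
      using norm_conv_le[OF cw b, of "max 0 t"] by (simp add: app dist_norm)
  qed
  moreover have "0 \<le> C / damp" "C / damp < 1" using C damp_pos by (auto simp: damp_def)
  ultimately obtain v where v: "?T v = v"
    using banach_fix_type[of "C / damp" ?T] by auto
  have "apply_bcontfun v t = Sd t F + conv (\<lambda>s. B (v s)) t" if "0 \<le> t" for t
    using app[of v t] that unfolding v by simp
  then show ?thesis by (intro exI[of _ "apply_bcontfun v"]) auto
qed

lemma evol_exists: "\<exists>u. evol \<phi> B u \<and> u 0 = F"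
proof -
  obtain v where cv: "continuous_on UNIV v" and v: "\<And>t. 0 \<le> t \<Longrightarrow> v t = Sd t F + conv (\<lambda>s. B (v s)) t"
    using fixed_point[of F] by auto
  have cB: "continuous_on UNIV (\<lambda>s. B (v s))" by (intro continuous_intros cv)
  \<comment> \<open>Removes the damping: the term \<open>- damp\<close> in the exponent of
    \<open>Sd\<close> is undone by this factor.\<close>
  let ?u = "\<lambda>t. exp (damp * t) *\<^sub>R v t"
  have "evol \<phi> B ?u"
    unfolding evol_def
  proof (intro conjI allI impI)
    show "continuous_on {0..} ?u" by (intro continuous_intros continuous_on_subset[OF cv]) auto
    fix x and s :: real assume s: "0 \<le> s"
    let ?p = "\<phi> x - of_real damp"
    let ?J = "\<lambda>t. coord F x + integral {0..t} (\<lambda>s. exp (- of_real s * ?p) * coord (B (v s)) x)"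
    have cv: "coord (v t) x = exp (of_real t * ?p) * ?J t" if "0 \<le> t" for t
    proof -
      have "coord (v t) x = coord (Sd t F) x + coord (conv (\<lambda>s. B (v s)) t) x"
        by (subst v[OF that]) simp
      also have "coord (Sd t F) x = exp (of_real t * ?p) * coord F x" using that by (simp add: coord_Sd)
      finally show ?thesis by (simp only: coord_conv[OF cB that] distrib_left)
    qed
    have E: "of_real (exp (damp * t)) * exp (of_real t * ?p) = exp (of_real t * \<phi> x)" for t
      by (simp add: right_diff_distrib mult.commute flip: exp_of_real exp_add)
    have eq: "coord (?u t) x = exp (of_real t * \<phi> x) * ?J t" if "0 \<le> t" for t
      using that unfolding coord_simps cv[OF that] scaleR_conv_of_real by (simp only: E[symmetric] mult.assoc)
    have E': "exp (of_real s * \<phi> x) * exp (- of_real s * ?p) = of_real (exp (damp * s))"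
      by (simp add: right_diff_distrib mult.commute flip: exp_of_real exp_add)
    \<comment> \<open>The primitive is differentiated on a compact interval; \<open>{0..s+1}\<close>
      is a neighbourhood of \<open>s\<close> in the half line, so the filters agree in the
      end.\<close>
    have dJ: "(?J has_vector_derivative exp (- of_real s * ?p) * coord (B (v s)) x) (at s within {0..s+1})"
    proof -
      have "((\<lambda>t. integral {0..t} (\<lambda>s. exp (- of_real s * ?p) * coord (B (v s)) x)) has_vector_derivative
        exp (- of_real s * ?p) * coord (B (v s)) x) (at s within {0..s+1})"
        using s by (intro integral_has_vector_derivative continuous_intros continuous_on_subset[OF cB]) auto
      then show ?thesis by (auto intro!: derivative_eq_intros)
    qed
    have dE: "((\<lambda>t. exp (of_real t * \<phi> x)) has_vector_derivative exp (of_real s * \<phi> x) * \<phi> x) (at s within {0..s+1})"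
    proof -
      have "((\<lambda>z. exp (z * \<phi> x)) has_field_derivative exp (of_real s * \<phi> x) * \<phi> x) (at (of_real s))"
        by (auto intro!: derivative_eq_intros)
      from has_vector_derivative_real_field[OF this] show ?thesis .
    qed
    have "((\<lambda>t. exp (of_real t * \<phi> x) * ?J t) has_vector_derivative
       exp (of_real s * \<phi> x) * (exp (- of_real s * ?p) * coord (B (v s)) x) + exp (of_real s * \<phi> x) * \<phi> x * ?J s)
       (at s within {0..s+1})"
      using has_vector_derivative_mult[OF dE dJ] .
    also have "exp (of_real s * \<phi> x) * (exp (- of_real s * ?p) * coord (B (v s)) x) = coord (B (?u s)) x"
      unfolding linear_scale[OF bounded_linear.linear[OF bl]] coord_simps scaleR_conv_of_real by (simp only: E'[symmetric] mult.assoc)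
    also have "exp (of_real s * \<phi> x) * \<phi> x * ?J s = \<phi> x * coord (?u s) x"
      using eq[OF s] by simp
    finally have "((\<lambda>t. exp (of_real t * \<phi> x) * ?J t) has_vector_derivative
       \<phi> x * coord (?u s) x + coord (B (?u s)) x) (at s within {0..s+1})" by (simp add: add.commute)
    then have "((\<lambda>t. coord (?u t) x) has_vector_derivative
       \<phi> x * coord (?u s) x + coord (B (?u s)) x) (at s within {0..s+1})"
      by (rule has_vector_derivative_transform[rotated -1]) (use s eq in auto)
    moreover have "at s within {0..s+1} = at s within {0..}"
      using s by (intro at_within_nhd[of s "{..<s+1}"]) auto
    ultimately show "((\<lambda>s. coord (?u s) x) has_vector_derivative
       \<phi> x * coord (?u s) x + coord (B (?u s)) x) (at s within {0..})" by simp
  qed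
  moreover have "?u 0 = F"
    using v[of 0] by (auto simp: conv_def coord_Sd intro!: ell2_eqI)
  ultimately show ?thesis by blast
qed

subsection \<open>The solution semigroup\<close>

text \<open>The choice of a solution is harmless for nonnegative times, where
  \<open>evol_unique\<close> determines the value.\<close>

definition V :: "real \<Rightarrow> 'a ell2 \<Rightarrow> 'a ell2" where
  "V t F = (SOME u. evol \<phi> B u \<and> u 0 = F) t"

lemma V_evol: "evol \<phi> B (\<lambda>t. V t F)" and V_0 [simp]: "V 0 F = F"
  using someI_ex[OF evol_exists[of F]] unfolding V_def by auto

lemma V_eqI: "evol \<phi> B u \<Longrightarrow> 0 \<le> t \<Longrightarrow> V t (u 0) = u t"
  by (rule evol_unique[OF V_evol]) auto

lemma V_add: "0 \<le> t \<Longrightarrow> V t (F + G) = V t F + V t G"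
  using V_eqI[OF evol_add[OF V_evol V_evol]] by simp

lemma V_cs: "0 \<le> t \<Longrightarrow> V t (cs c F) = cs c (V t F)"
  using V_eqI[OF evol_cs[OF V_evol]] by simp

lemma V_semigroup: "0 \<le> s \<Longrightarrow> 0 \<le> t \<Longrightarrow> V (s + t) F = V t (V s F)"
  using V_eqI[OF evol_shift[OF V_evol]] by simp

lemma norm_V_le: "0 \<le> t \<Longrightarrow> norm (V t F) \<le> exp (C * t) * norm F"
  using evol_norm_le[OF V_evol] by simp

lemma V_bounded_linear:
  assumes "0 \<le> t" shows "bounded_linear (V t)"
proof (rule bounded_linear_intro[where K = "exp (C * t)"])
  fix r and F :: "'a ell2"
  have "r *\<^sub>R G = cs (of_real r) G" for G :: "'a ell2" by (rule ell2_eqI) (simp add: scaleR_conv_of_real)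
  then show "V t (r *\<^sub>R F) = r *\<^sub>R V t F" using assms by (simp add: V_cs)
next
  show "norm (V t F) \<le> norm F * exp (C * t)" for F
    using norm_V_le[OF assms, of F] by (simp only: mult.commute)
qed (simp add: assms V_add)

lemma V_continuous: "continuous_on {0..} (\<lambda>t. V t F)"
  using V_evol[of F] by (simp add: evol_def)

lemma V_derivative: "0 \<le> s \<Longrightarrow> ((\<lambda>s. coord (V s F) x) has_vector_derivative
     (\<phi> x * coord (V s F) x + coord (B (V s F)) x)) (at s within {0..})"
  using V_evol[of F] by (simp add: evol_def)

text \<open>Both sides solve the same initial value problem.\<close>

lemma V_integral:
  assumes G: "\<And>x. coord G x = \<phi> x * coord F x + coord (B F) x" and t: "0 \<le> t"
  shows "V t F = F + integral {0..t} (\<lambda>s. V s G)"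
proof -
  let ?z = "\<lambda>t. F + integral {0..t} (\<lambda>s. V s G)"
  have int: "(\<lambda>s. V s G) integrable_on {0..t}" for t
    by (intro integrable_continuous_real continuous_on_subset[OF V_continuous]) auto
  have dz: "(?z has_vector_derivative V s G) (at s within {0..})" if "0 \<le> s" for s
  proof -
    have "((\<lambda>t. integral {0..t} (\<lambda>s. V s G)) has_vector_derivative V s G) (at s within {0..s+1})"
      using that by (intro integral_has_vector_derivative continuous_on_subset[OF V_continuous]) auto
    moreover have "at s within {0..s+1} = at s within {0..}"
      using that by (intro at_within_nhd[of s "{..<s+1}"]) auto
    ultimately show ?thesis by (auto intro!: derivative_eq_intros)
  qed
  have "evol \<phi> B ?z"
    unfolding evol_def
  proof (intro conjI allI impI)
    show "continuous_on {0..} ?z"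
      unfolding continuous_on_eq_continuous_within using has_vector_derivative_continuous[OF dz] by auto
    fix x and s :: real assume s: "0 \<le> s"
    have d: "((\<lambda>r. coord (V r G) x) has_vector_derivative
        \<phi> x * coord (V r G) x + coord (B (V r G)) x) (at r within {0..s})" if "r \<in> {0..s}" for r
      using that by (intro has_vector_derivative_within_subset[OF V_derivative]) auto
    \<comment> \<open>Integrating the equation for the orbit of \<open>G\<close> over
      \<open>{0..s}\<close> in two ways expresses \<open>coord (V s G) x\<close> through the
      integral of the orbit, which is the equation required of \<open>?z\<close>.\<close>
    have "((\<lambda>r. \<phi> x * coord (V r G) x + coord (B (V r G)) x) has_integral coord (V s G) x - coord (V 0 G) x) {0..s}"
      using s d by (intro fundamental_theorem_of_calculus) auto
    moreover have "((\<lambda>r. \<phi> x * coord (V r G) x + coord (B (V r G)) x) has_integral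
        \<phi> x * coord (integral {0..s} (\<lambda>s. V s G)) x + coord (B (integral {0..s} (\<lambda>s. V s G))) x) {0..s}"
    proof (intro has_integral_add has_integral_mult_right)
      show "((\<lambda>r. coord (V r G) x) has_integral coord (integral {0..s} (\<lambda>s. V s G)) x) {0..s}"
        using has_integral_linear[OF integrable_integral[OF int] bounded_linear_coord] by (simp add: o_def)
      show "((\<lambda>r. coord (B (V r G)) x) has_integral coord (B (integral {0..s} (\<lambda>s. V s G))) x) {0..s}"
        using has_integral_linear[OF integrable_integral[OF int] bounded_linear_compose[OF bounded_linear_coord bl]] by (simp add: o_def)
    qed
    ultimately have eq: "coord (V s G) x = coord G x + \<phi> x * coord (integral {0..s} (\<lambda>s. V s G)) x + coord (B (integral {0..s} (\<lambda>s. V s G))) x"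
      by (smt (verit, best) V_0 add.assoc add.commute diff_add_cancel has_integral_unique)
    have "((\<lambda>s. coord (?z s) x) has_vector_derivative coord (V s G) x) (at s within {0..})"
      by (rule bounded_linear.has_vector_derivative[OF bounded_linear_coord dz[OF s]])
    then show "((\<lambda>s. coord (?z s) x) has_vector_derivative \<phi> x * coord (?z s) x + coord (B (?z s)) x) (at s within {0..})"
      unfolding eq G by (simp add: linear_add[OF bounded_linear.linear[OF bl]] algebra_simps)
  qed
  from V_eqI[OF this t] show ?thesis by simp
qed

text \<open>The generator acts as \<phi> plus \<open>B\<close> on its maximal domain. Coordinates of
  the difference quotient are read off from the equation; conversely, \<open>V_integral\<close>
  exhibits the quotient as a time average of the continuous orbit of \<open>G\<close>.\<close>

lemma V_generator_iff:
  "((\<lambda>h. (V h F - F) /\<^sub>R h) \<longlongrightarrow> G) (at_right 0) \<longleftrightarrow>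
    (\<forall>x. coord G x = \<phi> x * coord F x + coord (B F) x)" (is "?L \<longleftrightarrow> ?R")
proof
  assume L: ?L
  show ?R
  proof
    fix x
    have "((\<lambda>h. (coord (V h F) x - coord (V 0 F) x) /\<^sub>R h) \<longlongrightarrow> \<phi> x * coord F x + coord (B F) x) (at_right 0)"
      using V_derivative[of 0 F x]
      by (intro has_vector_derivative_at_right_0) (simp add: at_within_Ici_at_right)
    moreover have "((\<lambda>h. coord ((V h F - F) /\<^sub>R h) x) \<longlongrightarrow> coord G x) (at_right 0)"
      by (intro tendsto_intros L)
    ultimately show "coord G x = \<phi> x * coord F x + coord (B F) x"
      by (intro tendsto_unique[of "at_right (0::real)"]) auto
  qed
next
  assume R: ?R
  have "((\<lambda>t. integral {0..t} (\<lambda>s. V s G)) has_vector_derivative V 0 G) (at 0 within {0..1})"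
    by (intro integral_has_vector_derivative continuous_on_subset[OF V_continuous]) auto
  then have "((\<lambda>h. (integral {0..h} (\<lambda>s. V s G) - integral {0..0} (\<lambda>s. V s G)) /\<^sub>R h) \<longlongrightarrow> V 0 G) (at_right 0)"
    by (intro has_vector_derivative_at_right_0) (simp add: at_within_Icc_at_right)
  then have "((\<lambda>h. (integral {0..h} (\<lambda>s. V s G)) /\<^sub>R h) \<longlongrightarrow> G) (at_right 0)" by simp
  then show ?L
    by (rule Lim_transform_eventually)
       (use V_integral[of G F] R in \<open>auto simp: eventually_at_filter intro!: always_eventually\<close>)
qed

end

text \<open>Strong convergence of \<open>Bn\<close> is enough. The difference of the two orbits
  solves the equation with \<open>Bn\<close> and a forcing term, namely \<open>Bn\<close> minus
  \<open>B\<close> along the fixed limit orbit, so the energy inequality reduces the claim to a time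
  integral of the forcing.\<close>

lemma V_convergence:
  assumes ev: "evolution \<phi> B C" and evn: "\<And>n. evolution \<phi> (Bn n) C"
    and lim: "\<And>F. (\<lambda>n. Bn n F) \<longlonglongrightarrow> B F" and t: "0 \<le> t"
  shows "(\<lambda>n. evolution.V \<phi> (Bn n) t F) \<longlonglongrightarrow> evolution.V \<phi> B t F"
proof -
  interpret e: evolution \<phi> B C by fact
  interpret en: evolution \<phi> "Bn n" C for n by fact
  let ?u = "\<lambda>s. e.V s F" and ?w = "\<lambda>n s. en.V n s F - e.V s F"
  let ?\<rho> = "\<lambda>n s. Bn n (?u s) - B (?u s)"
  note cont = continuous_on_subset[OF e.V_continuous] continuous_on_subset[OF en.V_continuous]
  note lin = linear_diff[OF bounded_linear.linear[OF en.bl]] linear_diff[OF bounded_linear.linear[OF e.bl]]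
  \<comment> \<open>In the rate, \<open>2 * C\<close> comes from \<open>Bn\<close>, and 1 from
    estimating twice a product by the sum of squares, which separates the forcing from the
    difference.\<close>
  have bnd: "(norm (?w n t))\<^sup>2 \<le> integral {0..t} (\<lambda>s. (norm (?\<rho> n s))\<^sup>2) * exp ((2 * C + 1) * t)" for n
  proof (rule gronwall)
    show "continuous_on {0..t} (\<lambda>s. (norm (?w n s))\<^sup>2)" by (intro continuous_intros cont) auto
    show "0 \<le> 2 * C + 1" using e.C by simp
    fix s assume s: "s \<in> {0..t}"
    let ?r = "\<lambda>s. Bn n (?w n s) + ?\<rho> n s"
    have "(norm (?w n s))\<^sup>2 \<le> (norm (?w n 0))\<^sup>2 + integral {0..s} (\<lambda>s. 2 * (norm (?r s) * norm (?w n s)))"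
    proof (rule energy[OF e.Re_nonpos])
      show "continuous_on {0..} (?w n)" "continuous_on {0..} ?r"
        by (intro continuous_intros en.B_cont cont; simp)+
      fix x and s :: real assume "0 \<le> s"
      from has_vector_derivative_diff[OF en.V_derivative[OF this] e.V_derivative[OF this]]
      show "((\<lambda>s. coord (?w n s) x) has_vector_derivative \<phi> x * coord (?w n s) x + coord (?r s) x) (at s within {0..})"
        by (simp add: lin algebra_simps)
    qed (use s in auto)
    also have "\<dots> \<le> integral {0..s} (\<lambda>s. (norm (?\<rho> n s))\<^sup>2 + (2 * C + 1) * (norm (?w n s))\<^sup>2)"
      unfolding e.V_0 en.V_0 diff_self norm_zero zero_power2 add_0
    proof (intro integral_le integrable_continuous_real continuous_intros en.B_cont cont)
      fix r
      let ?a = "norm (?\<rho> n r)" and ?b = "norm (?w n r)"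
      have "norm (?r r) \<le> C * ?b + ?a"
        using norm_triangle_ineq[of "Bn n (?w n r)" "?\<rho> n r"] en.bound[of n "?w n r"] by linarith
      then have "norm (?r r) * ?b \<le> (C * ?b + ?a) * ?b" by (rule mult_right_mono) auto
      moreover have "2 * ?a * ?b \<le> ?a\<^sup>2 + ?b\<^sup>2" by (rule sum_squares_bound)
      ultimately show "2 * (norm (?r r) * ?b) \<le> ?a\<^sup>2 + (2 * C + 1) * ?b\<^sup>2"
        by (simp add: power2_eq_square algebra_simps)
    qed auto
    also have "\<dots> = integral {0..s} (\<lambda>s. (norm (?\<rho> n s))\<^sup>2) + (2 * C + 1) * integral {0..s} (\<lambda>s. (norm (?w n s))\<^sup>2)"
      by (subst integral_add) (auto intro!: integrable_continuous_real continuous_intros en.B_cont cont)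
    also have "integral {0..s} (\<lambda>s. (norm (?\<rho> n s))\<^sup>2) \<le> integral {0..t} (\<lambda>s. (norm (?\<rho> n s))\<^sup>2)"
      using s by (intro integral_subset_le) (auto intro!: integrable_continuous_real continuous_intros en.B_cont cont)
    finally show "(norm (?w n s))\<^sup>2 \<le> integral {0..t} (\<lambda>s. (norm (?\<rho> n s))\<^sup>2) + (2 * C + 1) * integral {0..s} (\<lambda>s. (norm (?w n s))\<^sup>2)"
      by simp
  qed (use t in auto)
  have "(\<lambda>n. integral {0..t} (\<lambda>s. (norm (?\<rho> n s))\<^sup>2)) \<longlonglongrightarrow> integral {0..t} (\<lambda>s. 0)"
  proof (rule dominated_convergence(2))
    show "(\<lambda>s. (norm (?\<rho> n s))\<^sup>2) integrable_on {0..t}" for n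
      by (auto intro!: integrable_continuous_real continuous_intros en.B_cont cont)
    show "(\<lambda>s. (2 * C * norm (?u s))\<^sup>2) integrable_on {0..t}"
      by (auto intro!: integrable_continuous_real continuous_intros cont)
    fix s n
    have "norm (?\<rho> n s) \<le> 2 * C * norm (?u s)"
      using norm_triangle_ineq4[of "Bn n (?u s)" "B (?u s)"] e.bound[of "?u s"] en.bound[of n "?u s"] by linarith
    then show "norm ((norm (?\<rho> n s))\<^sup>2) \<le> (2 * C * norm (?u s))\<^sup>2" by (simp add: power_mono)
  next
    fix s
    have "(\<lambda>n. (norm (?\<rho> n s))\<^sup>2) \<longlonglongrightarrow> (norm (B (?u s) - B (?u s)))\<^sup>2"
      by (intro tendsto_intros lim)
    then show "(\<lambda>n. (norm (?\<rho> n s))\<^sup>2) \<longlonglongrightarrow> 0" by simp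
  qed
  from tendsto_mult_right[OF this, of "exp ((2 * C + 1) * t)"]
  have "(\<lambda>n. integral {0..t} (\<lambda>s. (norm (?\<rho> n s))\<^sup>2) * exp ((2 * C + 1) * t)) \<longlonglongrightarrow> 0" by simp
  then have "(\<lambda>n. (norm (?w n t))\<^sup>2) \<longlonglongrightarrow> 0"
    by (rule tendsto_sandwich[OF _ _ tendsto_const, rotated 2]) (auto intro!: always_eventually bnd)
  then have "(\<lambda>n. norm (?w n t)) \<longlonglongrightarrow> 0"
    using tendsto_real_sqrt[of "\<lambda>n. (norm (?w n t))\<^sup>2" 0] by simp
  then show ?thesis by (simp add: tendsto_norm_zero_iff LIM_zero_iff)
qed

section \<open>Strongly continuous semigroups\<close>

text \<open>Banach-Steinhaus for sequences. The closed sets \<open>A k\<close> cover the space, so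
  by Baire one of them contains a ball; the bound \<open>2 * real k / e\<close> results from writing
  a small vector as a difference of two points of that ball.\<close>

lemma uniform_boundedness:
  fixes T :: "nat \<Rightarrow> 'b::banach \<Rightarrow> 'c::real_normed_vector"
  assumes bl: "\<And>n. bounded_linear (T n)" and pw: "\<And>x. \<exists>M. \<forall>n. norm (T n x) \<le> M"
  shows "\<exists>M. \<forall>n x. norm (T n x) \<le> M * norm x"
proof -
  define A where "A k = {x. \<forall>n. norm (T n x) \<le> real k}" for k
  have cl: "closed (A k)" for k
    unfolding A_def
    by (intro closed_Collect_all closed_Collect_le continuous_intros bounded_linear.continuous_on[OF bl])
  have "\<exists>k. x \<in> A k" for x
  proof -
    obtain M where "\<forall>n. norm (T n x) \<le> M" using pw by blast
    moreover obtain k where "M \<le> real k" using real_arch_simple by blast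
    ultimately have "\<forall>n. norm (T n x) \<le> real k" using order_trans by blast
    then show ?thesis unfolding A_def by blast
  qed
  then have cov: "(\<Union>k. A k) = UNIV" by auto
  have "\<exists>k. interior (A k) \<noteq> {}"
  proof (rule ccontr)
    assume "\<nexists>k. interior (A k) \<noteq> {}"
    then have e: "interior (A k) = {}" for k by auto
    have "Met_TC.mtopology interior_of \<Union>(range A) = {}"
      by (rule Met_TC.metric_Baire_category_alt)
         (use cl e in \<open>auto simp: complete_UNIV euclidean_interior_of\<close>)
    then show False using cov by (simp add: euclidean_interior_of)
  qed
  then obtain k x0 where "x0 \<in> interior (A k)" by auto
  then obtain e where e: "0 < e" "cball x0 e \<subseteq> A k" by (auto simp: mem_interior_cball)
  have "norm (T n x) \<le> (2 * real k / e) * norm x" for n x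
  proof (cases "x = 0")
    case True then show ?thesis by (simp add: linear_0[OF bounded_linear.linear[OF bl]])
  next
    case False
    define y where "y = (e / norm x) *\<^sub>R x"
    have "x0 + y \<in> A k" "x0 \<in> A k" using e False by (auto simp: y_def dist_norm subset_iff)
    then have "norm (T n (x0 + y)) \<le> k" "norm (T n x0) \<le> k" by (auto simp: A_def)
    moreover have "T n y = T n (x0 + y) - T n x0" by (simp add: linear_add[OF bounded_linear.linear[OF bl]])
    ultimately have "norm (T n y) \<le> 2 * k" using norm_triangle_ineq4[of "T n (x0 + y)" "T n x0"] by simp
    then have "(e / norm x) * norm (T n x) \<le> 2 * k"
      using e by (simp add: y_def linear_scale[OF bounded_linear.linear[OF bl]])
    then show ?thesis using e False by (simp add: field_simps)
  qed
  then show ?thesis by blast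
qed

definition c0sg :: "(real \<Rightarrow> 'b::banach \<Rightarrow> 'b) \<Rightarrow> bool" where
  "c0sg W \<longleftrightarrow> (\<forall>t\<ge>0. bounded_linear (W t)) \<and> (\<forall>F. W 0 F = F) \<and>
     (\<forall>s\<ge>0. \<forall>t\<ge>0. \<forall>F. W (s + t) F = W s (W t F)) \<and> (\<forall>F. ((\<lambda>t. W t F) \<longlongrightarrow> F) (at_right 0))"

definition gen :: "(real \<Rightarrow> 'b::banach \<Rightarrow> 'b) \<Rightarrow> 'b \<Rightarrow> 'b \<Rightarrow> bool" where
  "gen W F G \<longleftrightarrow> ((\<lambda>h. (W h F - F) /\<^sub>R h) \<longlongrightarrow> G) (at_right 0)"

context
  fixes W :: "real \<Rightarrow> 'b::banach \<Rightarrow> 'b"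
  assumes W: "c0sg W"
begin

lemma W_bl: "0 \<le> t \<Longrightarrow> bounded_linear (W t)"
  and W_0 [simp]: "W 0 F = F"
  and W_add: "0 \<le> s \<Longrightarrow> 0 \<le> t \<Longrightarrow> W (s + t) F = W s (W t F)"
  and W_right_0: "((\<lambda>t. W t F) \<longlongrightarrow> F) (at_right 0)"
  using W by (auto simp: c0sg_def)

text \<open>Otherwise there are times tending to 0 at which the operator norms are unbounded,
  although the values at each vector converge and hence stay bounded, against
  \<open>uniform_boundedness\<close>.\<close>

lemma W_bounded_near_0: "\<exists>d>0. \<exists>M. \<forall>t\<in>{0..d}. \<forall>F. norm (W t F) \<le> M * norm F"
proof (rule ccontr)
  assume "\<not> ?thesis"
  then have neg: "\<And>d M. 0 < d \<Longrightarrow> \<exists>t\<in>{0..d}. \<exists>F. M * norm F < norm (W t F)" by (meson not_le)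
  have "\<exists>t F. 0 \<le> t \<and> t \<le> 1 / (1 + real n) \<and> real n * norm F < norm (W t F)" for n
    using neg[of "1 / (1 + real n)" "real n"] by auto
  then obtain t F where t: "\<And>n. 0 \<le> t n" "\<And>n. t n \<le> 1 / (1 + real n)"
    and F: "\<And>n. real n * norm (F n) < norm (W (t n) (F n))" by metis
  have "(\<lambda>n. 1 / (1 + real n)) \<longlonglongrightarrow> 0" by real_asymp
  then have t0: "t \<longlonglongrightarrow> 0" using t
    by (intro tendsto_sandwich[of "\<lambda>_. 0" t sequentially "\<lambda>n. 1 / (1 + real n)"]) (auto intro!: always_eventually)
  have "\<exists>M. \<forall>n. norm (W (t n) x) \<le> M" for x
  proof -
    have "continuous (at 0 within {0..}) (\<lambda>t. W t x)"
      using W_right_0[of x] by (simp add: continuous_within at_within_Ici_at_right)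
    then have "(\<lambda>n. W (t n) x) \<longlonglongrightarrow> W 0 x"
      by (rule continuous_within_tendsto_compose) (use t t0 in auto)
    then have "Bseq (\<lambda>n. W (t n) x)" by (intro convergent_imp_Bseq convergentI)
    then show ?thesis by (auto simp: Bseq_def)
  qed
  then obtain M where M: "\<And>n x. norm (W (t n) x) \<le> M * norm x"
    using uniform_boundedness[of "\<lambda>n. W (t n)"] W_bl t(1) by blast
  obtain n where n: "M \<le> real n" using real_arch_simple by blast
  have "norm (W (t n) (F n)) \<le> real n * norm (F n)"
    using M[of n "F n"] n by (meson mult_right_mono norm_ge_zero order_trans)
  then show False using F[of n] by simp
qed

lemma W_bounded: "\<exists>M\<ge>0. \<forall>t\<in>{0..T}. \<forall>F. norm (W t F) \<le> M * norm F"
proof -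
  obtain d M where d: "0 < d" and M: "\<And>t F. t \<in> {0..d} \<Longrightarrow> norm (W t F) \<le> M * norm F"
    using W_bounded_near_0 by blast
  \<comment> \<open>A bound of at least 1 has increasing powers, so that one power serves a whole
    time interval covered by steps of length \<open>d\<close>.\<close>
  let ?M = "max 1 M"
  have M1: "norm (W t F) \<le> ?M * norm F" if "t \<in> {0..d}" for t F
    using M[OF that, of F] by (meson max.cobounded2 mult_right_mono norm_ge_zero order_trans)
  have "\<forall>t\<in>{0..real k * d}. \<forall>F. norm (W t F) \<le> ?M ^ k * norm F" for k
  proof (induction k)
    case (Suc k)
    show ?case
    proof (intro ballI allI)
      fix t F assume t: "t \<in> {0..real (Suc k) * d}"
      show "norm (W t F) \<le> ?M ^ Suc k * norm F"
      proof (cases "t \<le> d")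
        case True
        have "norm (W t F) \<le> ?M * norm F" using M1 t True by simp
        also have "\<dots> \<le> ?M ^ Suc k * norm F"
          using power_increasing[of 1 "Suc k" ?M] by (intro mult_right_mono) auto
        finally show ?thesis .
      next
        case False
        then have "W t F = W d (W (t - d) F)" using W_add[of d "t - d" F] d by simp
        then have "norm (W t F) \<le> ?M * norm (W (t - d) F)" using M1[of d] d by simp
        also have "\<dots> \<le> ?M * (?M ^ k * norm F)"
          using Suc t False by (intro mult_left_mono) (auto simp: algebra_simps)
        finally show ?thesis by simp
      qed
    qed
  qed simp
  moreover obtain k where "T / d \<le> real k" using real_arch_simple by blast
  then have "T \<le> real k * d" using d by (simp add: field_simps)
  ultimately show ?thesis by (intro exI[of _ "?M ^ k"]) fastforce
qed

lemma W_diff_le: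
  assumes M: "\<forall>t\<in>{0..T}. \<forall>F. norm (W t F) \<le> M * norm F" and st: "s \<in> {0..T}" "t \<in> {0..T}"
  shows "norm (W s F - W t F) \<le> M * norm (W \<bar>s - t\<bar> F - F)"
proof -
  have *: "norm (W s F - W t F) \<le> M * norm (W (s - t) F - F)" if "t \<le> s" "t \<in> {0..T}" for s t
  proof -
    have "W s F = W t (W (s - t) F)" using W_add[of t "s - t" F] that by simp
    then have "W s F - W t F = W t (W (s - t) F - F)"
      using that by (simp add: linear_diff[OF bounded_linear.linear[OF W_bl]])
    then show ?thesis using M that by simp
  qed
  show ?thesis
    using *[of t s] *[of s t] st by (cases "t \<le> s") (auto simp: norm_minus_commute abs_if)
qed

lemma tendsto_abs_diff:
  fixes t :: real
  assumes "(f \<longlongrightarrow> l) (at_right 0)"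
  shows "((\<lambda>s. f \<bar>s - t\<bar>) \<longlongrightarrow> l) (at t within S)"
proof (rule filterlim_compose[OF assms])
  have "((\<lambda>s. \<bar>s - t\<bar>) \<longlongrightarrow> \<bar>t - t\<bar>) (at t within S)" by (intro tendsto_intros)
  then show "filterlim (\<lambda>s. \<bar>s - t\<bar>) (at_right 0) (at t within S)"
    by (auto simp: filterlim_at eventually_at_filter)
qed

lemma W_continuous: "continuous_on {0..} (\<lambda>t. W t F)"
  unfolding continuous_on_def
proof
  fix t :: real assume "t \<in> {0..}"
  then have t: "0 \<le> t" by simp
  obtain M where M: "\<forall>r\<in>{0..t+1}. \<forall>F. norm (W r F) \<le> M * norm F" using W_bounded by blast
  have "((\<lambda>s. W \<bar>s - t\<bar> F) \<longlongrightarrow> F) (at t within {0..})"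
    by (rule tendsto_abs_diff[OF W_right_0])
  then have "((\<lambda>s. M * norm (W \<bar>s - t\<bar> F - F)) \<longlongrightarrow> M * norm (F - F)) (at t within {0..})"
    by (intro tendsto_intros)
  then have z: "((\<lambda>s. M * norm (W \<bar>s - t\<bar> F - F)) \<longlongrightarrow> 0) (at t within {0..})" by simp
  have "\<forall>\<^sub>F s in at t within {0..}. s \<in> {..<t+1}"
    unfolding eventually_at_topological by (rule exI[of _ "{..<t+1}"]) auto
  moreover have "\<forall>\<^sub>F s in at t within {0..}. s \<in> {0..}" by (auto simp: eventually_at_filter)
  ultimately have "\<forall>\<^sub>F s in at t within {0..}. norm (W s F - W t F) \<le> M * norm (W \<bar>s - t\<bar> F - F)"
    by eventually_elim (use W_diff_le[OF M] t in auto)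
  from Lim_null_comparison[OF this z] show "((\<lambda>t. W t F) \<longlongrightarrow> W t F) (at t within {0..})"
    by (simp add: LIM_zero_iff)
qed

text \<open>The generator provides a right derivative at 0 only. Factoring out
  \<open>W (min s t)\<close> expresses the difference quotients on either side of \<open>t\<close>
  through that one, and local boundedness of \<open>W\<close> carries the limit over.\<close>

lemma W_vector_derivative:
  assumes G: "gen W F G" and t: "0 \<le> t"
  shows "((\<lambda>s. W s F) has_vector_derivative W t G) (at t within {0..})"
proof -
  obtain M where M: "\<forall>r\<in>{0..t+1}. \<forall>F. norm (W r F) \<le> M * norm F" using W_bounded by blast
  let ?q = "\<lambda>h. (W h F - F) /\<^sub>R h"
  let ?B = "\<lambda>s. M * norm (?q \<bar>s - t\<bar> - G) + norm (W (min s t) G - W t G)"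
  have "((\<lambda>s. ?q \<bar>s - t\<bar>) \<longlongrightarrow> G) (at t within {0..})"
    by (rule tendsto_abs_diff[OF G[unfolded gen_def]])
  moreover have "((\<lambda>s. W (min s t) G) \<longlongrightarrow> W t G) (at t within {0..})"
  proof -
    have "continuous_on {0..} (\<lambda>s. W (min s t) G)"
      by (rule continuous_on_compose2[OF W_continuous]) (use t in \<open>auto intro!: continuous_intros\<close>)
    then have "\<forall>r\<in>{0..}. ((\<lambda>s. W (min s t) G) \<longlongrightarrow> W (min r t) G) (at r within {0..})"
      by (simp add: continuous_on_def)
    from bspec[OF this, of t] t show ?thesis by simp
  qed
  ultimately have "(?B \<longlongrightarrow> M * norm (G - G) + norm (W t G - W t G)) (at t within {0..})"
    by (intro tendsto_intros)
  then have z: "(?B \<longlongrightarrow> 0) (at t within {0..})" by simp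
  have near: "\<forall>\<^sub>F s in at t within {0..}. s \<in> {..<t+1}"
    unfolding eventually_at_topological by (rule exI[of _ "{..<t+1}"]) auto
  have pos: "\<forall>\<^sub>F s in at t within {0..}. s \<in> {0..} \<and> s \<noteq> t" by (auto simp: eventually_at_filter)
  have quot: "(W s F - W t F) /\<^sub>R (s - t) = W (min s t) (?q \<bar>s - t\<bar>)" if "0 \<le> s" "s \<noteq> t" for s
  proof -
    have *: "(W b F - W a F) /\<^sub>R (b - a) = W a (?q (b - a))" if "0 \<le> a" "a < b" for a b
      using that W_add[of a "b - a" F]
      by (simp add: linear_diff[OF bounded_linear.linear[OF W_bl]] linear_scale[OF bounded_linear.linear[OF W_bl]])
    show ?thesis
    proof (cases "s < t")
      case True
      have "(W s F - W t F) /\<^sub>R (s - t) = (W t F - W s F) /\<^sub>R (t - s)"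
        using inverse_minus_eq[of "t - s"] by (simp add: scaleR_diff_right)
      then show ?thesis using *[of s t] that True by simp
    next
      case False then show ?thesis using *[of t s] that t by simp
    qed
  qed
  have "\<forall>\<^sub>F s in at t within {0..}. norm ((1 / norm (s - t)) *\<^sub>R (W s F - (W t F + (s - t) *\<^sub>R W t G))) \<le> ?B s"
    using near pos
  proof eventually_elim
    case (elim s)
    have "norm ((1 / norm (s - t)) *\<^sub>R (W s F - (W t F + (s - t) *\<^sub>R W t G)))
      = norm ((1 / (s - t)) *\<^sub>R (W s F - (W t F + (s - t) *\<^sub>R W t G)))" by simp
    also have "(1 / (s - t)) *\<^sub>R (W s F - (W t F + (s - t) *\<^sub>R W t G)) = (W s F - W t F) /\<^sub>R (s - t) - W t G"
      using elim by (simp add: scaleR_diff_right scaleR_add_right divide_inverse)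
    also have "\<dots> = W (min s t) (?q \<bar>s - t\<bar> - G) + (W (min s t) G - W t G)"
      using elim t by (simp add: quot linear_diff[OF bounded_linear.linear[OF W_bl]])
    also have "norm \<dots> \<le> ?B s"
      using elim t M by (intro order_trans[OF norm_triangle_ineq] add_mono) auto
    finally show ?case .
  qed
  from Lim_null_comparison[OF this z] show ?thesis
    unfolding has_vector_derivative_def has_derivative_within
    by (auto intro: bounded_linear_scaleR_left)
qed

lemma gen_orbit:
  assumes G: "gen W F G" and t: "0 \<le> t"
  shows "gen W (W t F) (W t G)"
proof -
  have "((\<lambda>h. W t ((W h F - F) /\<^sub>R h)) \<longlongrightarrow> W t G) (at_right 0)"
    by (rule bounded_linear.tendsto[OF W_bl[OF t] G[unfolded gen_def]])
  moreover have "\<forall>\<^sub>F h in at_right 0. W t ((W h F - F) /\<^sub>R h) = (W h (W t F) - W t F) /\<^sub>R h"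
  proof -
    have "W h (W t F) = W t (W h F)" if "0 < h" for h
      using W_add[of h t F] W_add[of t h F] t that by (simp add: add.commute)
    then show ?thesis
      using t by (auto simp: eventually_at_filter linear_diff[OF bounded_linear.linear[OF W_bl]]
          linear_scale[OF bounded_linear.linear[OF W_bl]] intro!: always_eventually)
  qed
  ultimately show ?thesis unfolding gen_def by (rule Lim_transform_eventually)
qed

end

text \<open>The orbits of both semigroups solve the same evolution equation.\<close>

lemma (in evolution) c0sg_eq_V:
  assumes W: "c0sg W" and sub: "\<And>F G x. gen W F G \<Longrightarrow> coord G x = \<phi> x * coord F x + coord (B F) x"
    and G: "gen W F G" and t: "0 \<le> t"
  shows "W t F = V t F"
proof -
  have "evol \<phi> B (\<lambda>t. W t F)"
    unfolding evol_def
  proof (intro conjI allI impI)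
    show "continuous_on {0..} (\<lambda>t. W t F)" by (rule W_continuous[OF W])
    fix x and s :: real assume s: "0 \<le> s"
    from bounded_linear.has_vector_derivative[OF bounded_linear_coord W_vector_derivative[OF W G s]]
    show "((\<lambda>s. coord (W s F) x) has_vector_derivative \<phi> x * coord (W s F) x + coord (B (W s F)) x) (at s within {0..})"
      unfolding sub[OF gen_orbit[OF W G s]] .
  qed
  from V_eqI[OF this t] show ?thesis using W_0[OF W] by simp
qed

section \<open>Transfer to weighted square summable functions\<close>

text \<open>Multiplication by the root of \<open>m\<close> maps \<open>l2 m\<close> unitarily onto
  \<open>ell2\<close> and turns the adjacency operator into one with a symmetric kernel.\<close>

definition emb :: "('a \<Rightarrow> real) \<Rightarrow> ('a \<Rightarrow> complex) \<Rightarrow> 'a ell2" where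
  "emb m f = Abs_ell2 (\<lambda>x. of_real (sqrt (m x)) * f x)"

definition unemb :: "('a \<Rightarrow> real) \<Rightarrow> 'a ell2 \<Rightarrow> 'a \<Rightarrow> complex" where
  "unemb m F = (\<lambda>x. coord F x / of_real (sqrt (m x)))"

locale weight =
  fixes m :: "'a \<Rightarrow> real"
  assumes m_pos: "\<And>x. 0 < m x"
begin

lemma sqrt_m [simp]: "sqrt (m x) \<noteq> 0" "0 < sqrt (m x)" "m x \<noteq> 0" "0 \<le> m x"
  using m_pos[of x] by auto

lemma l2_iff: "f \<in> l2 m \<longleftrightarrow> (\<lambda>x. of_real (sqrt (m x)) * f x) \<in> sqsum"
  by (simp add: l2_def sqsum_def norm_mult power_mult_distrib mult.commute)

lemma coord_emb: "f \<in> l2 m \<Longrightarrow> coord (emb m f) x = of_real (sqrt (m x)) * f x"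
  unfolding emb_def by (subst coord_Abs) (auto simp: l2_iff)

lemma unemb_l2 [simp]: "unemb m F \<in> l2 m"
  unfolding l2_iff unemb_def by simp

lemma emb_unemb [simp]: "emb m (unemb m F) = F"
  by (rule ell2_eqI) (simp add: coord_emb, simp add: unemb_def)

lemma unemb_emb: "f \<in> l2 m \<Longrightarrow> unemb m (emb m f) = f"
  by (auto simp: unemb_def coord_emb)

lemma l2_norm_eq: "f \<in> l2 m \<Longrightarrow> l2_norm m f = norm (emb m f)"
proof -
  assume f: "f \<in> l2 m"
  have "(norm (emb m f))\<^sup>2 = (\<Sum>\<^sub>\<infinity>x. (cmod (f x))\<^sup>2 * m x)"
    unfolding norm_ell2_square using f by (simp add: coord_emb norm_mult power_mult_distrib mult.commute)
  then show ?thesis unfolding l2_norm_def by (metis norm_ge_zero real_sqrt_unique)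
qed

lemma l2_inner_eq: "f \<in> l2 m \<Longrightarrow> g \<in> l2 m \<Longrightarrow> l2_inner m f g = cip (emb m f) (emb m g)"
proof -
  assume f: "f \<in> l2 m" and g: "g \<in> l2 m"
  have "complex_of_real (sqrt (m x)) * complex_of_real (sqrt (m x)) = of_real (m x)" for x
    using m_pos[of x] by (simp flip: of_real_mult)
  then have "f x * cnj (g x) * of_real (m x) = coord (emb m f) x * cnj (coord (emb m g) x)" for x
    by (simp add: coord_emb f g algebra_simps)
  then show ?thesis by (simp add: l2_inner_def cip_def)
qed

lemma l2_add: "f \<in> l2 m \<Longrightarrow> g \<in> l2 m \<Longrightarrow> (\<lambda>x. f x + g x) \<in> l2 m"
  unfolding l2_iff by (auto dest: sqsum_add simp: distrib_left)

lemma l2_mult: "f \<in> l2 m \<Longrightarrow> (\<lambda>x. c * f x) \<in> l2 m"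
  unfolding l2_iff using sqsum_mult_bounded[of _ "\<lambda>_. c" "cmod c"] by (auto simp: mult.left_commute)

lemma l2_diff: "f \<in> l2 m \<Longrightarrow> g \<in> l2 m \<Longrightarrow> (\<lambda>x. f x - g x) \<in> l2 m"
  using l2_add[of f "\<lambda>x. -1 * g x"] l2_mult[of g "-1"] by simp

lemma emb_add: "f \<in> l2 m \<Longrightarrow> g \<in> l2 m \<Longrightarrow> emb m (\<lambda>x. f x + g x) = emb m f + emb m g"
  by (rule ell2_eqI) (simp add: coord_emb l2_add distrib_left)

lemma emb_diff: "f \<in> l2 m \<Longrightarrow> g \<in> l2 m \<Longrightarrow> emb m (\<lambda>x. f x - g x) = emb m f - emb m g"
  by (rule ell2_eqI) (simp add: coord_emb l2_diff right_diff_distrib)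

lemma emb_mult: "f \<in> l2 m \<Longrightarrow> emb m (\<lambda>x. c * f x) = cs c (emb m f)"
  by (rule ell2_eqI) (simp add: coord_emb l2_mult)

lemma unemb_add: "unemb m (F + G) = (\<lambda>x. unemb m F x + unemb m G x)"
  and unemb_cs: "unemb m (cs c F) = (\<lambda>x. c * unemb m F x)"
  by (auto simp: unemb_def add_divide_distrib)

text \<open>Conjugation by \<open>emb\<close>; values of \<open>T\<close> outside
  \<open>l2 m\<close> never enter.\<close>

definition lift_op :: "(('a \<Rightarrow> complex) \<Rightarrow> 'a \<Rightarrow> complex) \<Rightarrow> 'a ell2 \<Rightarrow> 'a ell2" where
  "lift_op T F = emb m (T (unemb m F))"

lemma scaleR_cs: "r *\<^sub>R F = cs (of_real r) F"
  by (rule ell2_eqI) (simp add: scaleR_conv_of_real)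

lemma lift_op_cs: "l2_bounded_op m T \<Longrightarrow> lift_op T (cs c F) = cs c (lift_op T F)"
  by (simp add: lift_op_def unemb_cs l2_bounded_op_def emb_mult)

lemma lift_op_bounded_linear:
  assumes T: "l2_bounded_op m T"
  shows "bounded_linear (lift_op T)"
proof -
  obtain K where K: "\<forall>f\<in>l2 m. l2_norm m (T f) \<le> K * l2_norm m f"
    using T by (auto simp: l2_bounded_op_def)
  have T2: "T f \<in> l2 m" if "f \<in> l2 m" for f using T that by (auto simp: l2_bounded_op_def)
  show ?thesis
  proof (rule bounded_linear_intro[where K = K])
    fix F G :: "'a ell2" and r :: real
    show "lift_op T (F + G) = lift_op T F + lift_op T G"
      using T by (simp add: lift_op_def unemb_add l2_bounded_op_def emb_add)
    show "lift_op T (r *\<^sub>R F) = r *\<^sub>R lift_op T F"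
      by (simp add: scaleR_cs lift_op_cs[OF T])
    show "norm (lift_op T F) \<le> norm F * K"
      using K[rule_format, of "unemb m F"] by (simp add: l2_norm_eq T2 lift_op_def mult.commute)
  qed
qed

lemma C0_lift:
  assumes T: "C0_semigroup m T"
  shows "c0sg (\<lambda>t. lift_op (T t))"
  unfolding c0sg_def
proof (intro conjI allI impI)
  have T2: "T t f \<in> l2 m" if "f \<in> l2 m" "0 \<le> t" for f t
    using T that by (auto simp: C0_semigroup_def l2_bounded_op_def)
  fix t s :: real and F :: "'a ell2"
  show "bounded_linear (lift_op (T t))" if "0 \<le> t"
    using T that by (auto simp: C0_semigroup_def intro: lift_op_bounded_linear)
  show "lift_op (T 0) F = F" using T by (simp add: C0_semigroup_def lift_op_def)
  show "lift_op (T (s + t)) F = lift_op (T s) (lift_op (T t) F)" if "0 \<le> s" "0 \<le> t"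
    using T that T2 by (simp add: C0_semigroup_def lift_op_def unemb_emb)
  have "((\<lambda>t. l2_norm m (T t (unemb m F) - unemb m F)) \<longlongrightarrow> 0) (at_right 0)"
    using T by (simp add: C0_semigroup_def)
  then have "((\<lambda>t. norm (lift_op (T t) F - F)) \<longlongrightarrow> 0) (at_right 0)"
    by (rule Lim_transform_eventually)
       (auto simp: eventually_at_filter l2_norm_eq l2_diff T2 emb_diff lift_op_def fun_diff_def
         intro!: always_eventually)
  then show "((\<lambda>t. lift_op (T t) F) \<longlongrightarrow> F) (at_right 0)"
    by (simp add: tendsto_norm_zero_iff LIM_zero_iff)
qed

lemma gen_lift:
  assumes T: "C0_semigroup m T"
  shows "(f, g) \<in> generator m T \<longleftrightarrow> f \<in> l2 m \<and> g \<in> l2 m \<and> gen (\<lambda>t. lift_op (T t)) (emb m f) (emb m g)"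
proof -
  have T2: "T t f \<in> l2 m" if "f \<in> l2 m" "0 \<le> t" for f t
    using T that by (auto simp: C0_semigroup_def l2_bounded_op_def)
  have "((\<lambda>t. l2_norm m (\<lambda>x. (T t f x - f x) / of_real t - g x)) \<longlongrightarrow> 0) (at_right 0) \<longleftrightarrow>
     gen (\<lambda>t. lift_op (T t)) (emb m f) (emb m g)" if f: "f \<in> l2 m" and g: "g \<in> l2 m"
  proof -
    have "l2_norm m (\<lambda>x. (T h f x - f x) / of_real h - g x) = norm ((lift_op (T h) (emb m f) - emb m f) /\<^sub>R h - emb m g)"
      if "0 < h" for h
    proof -
      have 1: "(\<lambda>x. (1 / of_real h) * (T h f x - f x)) \<in> l2 m" using f T2 that by (intro l2_mult l2_diff) auto
      have "l2_norm m (\<lambda>x. (T h f x - f x) / of_real h - g x) = norm (emb m (\<lambda>x. (1 / of_real h) * (T h f x - f x) - g x))"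
        using l2_norm_eq[OF l2_diff[OF 1 g]] by simp
      also have "emb m (\<lambda>x. (1 / of_real h) * (T h f x - f x) - g x) = cs (1 / of_real h) (emb m (T h f) - emb m f) - emb m g"
        using that unfolding emb_diff[OF 1 g] by (subst emb_mult) (simp_all add: l2_diff emb_diff f T2)
      finally show ?thesis using f
        by (simp add: lift_op_def unemb_emb scaleR_cs inverse_eq_divide)
    qed
    then have "((\<lambda>t. l2_norm m (\<lambda>x. (T t f x - f x) / of_real t - g x)) \<longlongrightarrow> 0) (at_right 0) \<longleftrightarrow>
      ((\<lambda>h. norm ((lift_op (T h) (emb m f) - emb m f) /\<^sub>R h - emb m g)) \<longlongrightarrow> 0) (at_right 0)"
      by (intro tendsto_cong) (auto simp: eventually_at_filter intro!: always_eventually)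
    also have "\<dots> \<longleftrightarrow> gen (\<lambda>t. lift_op (T t)) (emb m f) (emb m g)"
      unfolding gen_def by (simp add: tendsto_norm_zero_iff LIM_zero_iff)
    finally show ?thesis .
  qed
  then show ?thesis by (auto simp: generator_def)
qed

text \<open>The expansion of \<open>f\<close> in unit vectors converges over finite subsets and
  \<open>T\<close> is continuous; testing with unit vectors fixes the kernel. Since the kernel acts
  against \<open>m\<close>, the root of \<open>m y\<close> ends up in the denominator.\<close>

lemma integral_kernel_eq:
  assumes T: "l2_bounded_op m T"
  shows "integral_kernel m T x y = coord (lift_op T (unitv y)) x / of_real (sqrt (m x) * sqrt (m y))"
proof -
  let ?k = "\<lambda>x y. coord (lift_op T (unitv y)) x / of_real (sqrt (m x) * sqrt (m y))"
  have mm: "complex_of_real (sqrt (m x)) * of_real (sqrt (m x)) = of_real (m x)" for x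
    using m_pos[of x] by (simp flip: of_real_mult)
  have T2: "T f \<in> l2 m" if "f \<in> l2 m" for f using T that by (auto simp: l2_bounded_op_def)
  have sum: "((\<lambda>y. ?k x y * f y * of_real (m y)) has_sum T f x) UNIV" if f: "f \<in> l2 m" for f x
  proof -
    let ?F = "emb m f"
    have "((\<lambda>K. coord (lift_op T (trunc K ?F)) x) \<longlongrightarrow> coord (lift_op T ?F) x) (finite_subsets_at_top UNIV)"
      by (intro tendsto_intros bounded_linear.tendsto[OF lift_op_bounded_linear[OF T]] tendsto_trunc)
         (auto simp: eventually_finite_subsets_at_top intro!: exI[of _ "{_}"])
    then have "((\<lambda>K. \<Sum>y\<in>K. coord ?F y * coord (lift_op T (unitv y)) x) \<longlongrightarrow> coord (lift_op T ?F) x) (finite_subsets_at_top UNIV)"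
    proof (rule Lim_transform_eventually)
      have "coord (lift_op T (trunc K ?F)) x = (\<Sum>y\<in>K. coord ?F y * coord (lift_op T (unitv y)) x)" if "finite K" for K
        unfolding trunc_finite[OF that] linear_sum[OF bounded_linear.linear[OF lift_op_bounded_linear[OF T]]]
        using that by (simp add: coord_sum lift_op_cs[OF T])
      then show "\<forall>\<^sub>F K in finite_subsets_at_top UNIV. coord (lift_op T (trunc K ?F)) x = (\<Sum>y\<in>K. coord ?F y * coord (lift_op T (unitv y)) x)"
        by (auto simp: eventually_finite_subsets_at_top)
    qed
    then have "((\<lambda>y. coord ?F y * coord (lift_op T (unitv y)) x) has_sum coord (lift_op T ?F) x) UNIV"
      by (simp add: has_sum_def)
    from has_sum_cmult_right[OF this, of "1 / of_real (sqrt (m x))"]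
    have "((\<lambda>y. 1 / of_real (sqrt (m x)) * (coord ?F y * coord (lift_op T (unitv y)) x)) has_sum T f x) UNIV"
      using f by (simp add: lift_op_def unemb_emb coord_emb T2)
    moreover have "1 / of_real (sqrt (m x)) * (coord ?F y * coord (lift_op T (unitv y)) x) = ?k x y * f y * of_real (m y)" for y
      using f by (simp add: coord_emb mm[symmetric] field_simps)
    ultimately show ?thesis by simp
  qed
  have "integral_kernel m T = ?k"
    unfolding integral_kernel_def
  proof (rule the_equality)
    show "\<forall>f\<in>l2 m. \<forall>x. ((\<lambda>y. ?k x y * f y * of_real (m y)) has_sum T f x) UNIV" using sum by blast
    fix k assume k: "\<forall>f\<in>l2 m. \<forall>x. ((\<lambda>y. k x y * f y * of_real (m y)) has_sum T f x) UNIV"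
    have "k x z = ?k x z" for x z
    proof -
      let ?f = "unemb m (unitv z)"
      have pt: "j z * ?f z * of_real (m z) = S" if "((\<lambda>y. j y * ?f y * of_real (m y)) has_sum S) UNIV" for j S
      proof -
        have "((\<lambda>y. j y * ?f y * of_real (m y)) has_sum S) {z}"
          using that iffD1[OF has_sum_cong_neutral[of "{z}" UNIV "\<lambda>y. j y * ?f y * of_real (m y)" "\<lambda>y. j y * ?f y * of_real (m y)" S]]
          by (auto simp: unemb_def)
        then show ?thesis using has_sum_unique[OF _ has_sum_finite[of "{z}"]] by fastforce
      qed
      have "k x z * ?f z * of_real (m z) = ?k x z * ?f z * of_real (m z)"
        using pt[of "k x"] pt[of "?k x"] k sum[of ?f x] by simp
      moreover have "?f z * of_real (m z) \<noteq> 0" by (simp add: unemb_def)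
      ultimately show ?thesis unfolding mult.assoc by (metis mult_right_cancel)
    qed
    then show "k = ?k" by blast
  qed
  then show ?thesis by simp
qed

end

locale weighted_evolution = evolution \<phi> B C + weight m for \<phi> :: "'a \<Rightarrow> complex" and B C and m :: "'a \<Rightarrow> real"
begin

text \<open>Maximal domain: apart from \<open>f \<in> l2 m\<close>, the condition on
  \<open>f\<close> is that the right-hand side be square summable, expressed by the existence of
  \<open>g\<close>.\<close>

definition evol_op :: "'a unbounded_op" where
  "evol_op = {(f, g). f \<in> l2 m \<and> g \<in> l2 m \<and>
     (\<forall>x. coord (emb m g) x = \<phi> x * coord (emb m f) x + coord (B (emb m f)) x)}"

text \<open>A witness for the choice in \<open>exp_op\<close>: without it nothing would be known
  about the chosen semigroup.\<close>

lemma exp_op_exists: "\<exists>T. C0_semigroup m T \<and> generator m T = evol_op"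
proof -
  let ?T = "\<lambda>t f. unemb m (V t (emb m f))"
  have C0: "C0_semigroup m ?T"
    unfolding C0_semigroup_def
  proof (intro conjI allI impI ballI)
    fix t s :: real and f
    show "l2_bounded_op m (?T t)" if "0 \<le> t"
      unfolding l2_bounded_op_def
      using that norm_V_le[OF that]
      by (auto simp: emb_add emb_mult V_add V_cs unemb_add unemb_cs l2_norm_eq intro!: exI[of _ "exp (C * t)"])
    show "?T 0 f = f" if "f \<in> l2 m" using that by (simp add: unemb_emb)
    show "?T (s + t) f = ?T s (?T t f)" if "0 \<le> s" "0 \<le> t"
      using that V_semigroup[of t s "emb m f"] by (simp add: add.commute)
    show "((\<lambda>t. l2_norm m (?T t f - f)) \<longlongrightarrow> 0) (at_right 0)" if "f \<in> l2 m"
    proof -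
      have "((\<lambda>t. V t (emb m f)) \<longlongrightarrow> V 0 (emb m f)) (at 0 within {0..})"
        using V_continuous[of "emb m f"] unfolding continuous_on_def by (metis atLeast_iff order_refl)
      then have "((\<lambda>t. norm (V t (emb m f) - emb m f)) \<longlongrightarrow> 0) (at_right 0)"
        by (simp add: at_within_Ici_at_right tendsto_norm_zero_iff LIM_zero_iff)
      moreover have "l2_norm m (?T t f - f) = norm (V t (emb m f) - emb m f)" for t
        using that by (simp add: fun_diff_def l2_norm_eq l2_diff emb_diff)
      ultimately show ?thesis by simp
    qed
  qed
  have eq: "lift_op (?T h) F = V h F" for h F by (simp add: lift_op_def)
  have "generator m ?T = evol_op"
    unfolding evol_op_def
    by (auto simp: gen_lift[OF C0] gen_def eq V_generator_iff)
  then show ?thesis using C0 by blast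
qed

lemma exp_op_props:
  "C0_semigroup m (exp_op m evol_op)" "generator m (exp_op m evol_op) = evol_op"
  using someI_ex[OF exp_op_exists] by (auto simp: exp_op_def)

lemma unitv_domain: "coord (cs (\<phi> y) (unitv y) + B (unitv y)) x = \<phi> x * coord (unitv y) x + coord (B (unitv y)) x"
  by simp

text \<open>The semigroup chosen by \<open>exp_op\<close> is known only through its generator. Its
  kernel is determined by the orbits of the unit vectors, which lie in the domain of the generator,
  and there \<open>c0sg_eq_V\<close> identifies them.\<close>

theorem integral_kernel_exp_op:
  assumes t: "0 \<le> t"
  shows "integral_kernel m (exp_op m evol_op t) x y = coord (V t (unitv y)) x / of_real (sqrt (m x) * sqrt (m y))"
proof -
  let ?T = "exp_op m evol_op" and ?W = "\<lambda>t. lift_op (exp_op m evol_op t)"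
  have W: "c0sg ?W" by (rule C0_lift[OF exp_op_props(1)])
  have gen: "gen ?W F G \<longleftrightarrow> (\<forall>x. coord G x = \<phi> x * coord F x + coord (B F) x)" for F G
    using gen_lift[OF exp_op_props(1), of "unemb m F" "unemb m G"] exp_op_props(2) by (simp add: evol_op_def)
  have "?W t (unitv y) = V t (unitv y)"
    by (rule c0sg_eq_V[OF W]) (use gen unitv_domain t in blast)+
  then show ?thesis
    using exp_op_props(1) t by (subst integral_kernel_eq) (auto simp: C0_semigroup_def)
qed

end

section \<open>The magnetic form and its operator\<close>

lemma has_sum_change_set:
  assumes "(f has_sum s) S" "\<And>x. x \<in> T - S \<Longrightarrow> f x = 0" "\<And>x. x \<in> S - T \<Longrightarrow> f x = 0"
  shows "(f has_sum s) T"
  using assms(1) has_sum_cong_neutral[of T S f f s] assms(2,3) by auto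

lemma has_sum_difference:
  fixes f g :: "'i \<Rightarrow> complex"
  assumes "(f has_sum s) A" "(g has_sum t) A"
  shows "((\<lambda>x. f x - g x) has_sum s - t) A"
  using has_sum_add[OF assms(1), of "\<lambda>x. - g x" "- t"] assms(2) by (simp add: has_sum_uminus)

locale graph =
  fixes b :: "'a::countable \<Rightarrow> 'a \<Rightarrow> real" and m :: "'a \<Rightarrow> real"
  assumes graph: "weighted_graph b m"
begin

lemma b_nonneg: "0 \<le> b x y" and b_sym: "b x y = b y x" and b_diag [simp]: "b x x = 0"
  and b_summable: "(\<lambda>y. b x y) summable_on UNIV"
  using graph by (auto simp: weighted_graph_def)

sublocale weight m
  by standard (use graph in \<open>auto simp: weighted_graph_def\<close>)

text \<open>The matrix of the adjacency operator after conjugation with the root of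
  \<open>m\<close>, with a factor \<psi> on the edges that will carry phases, scalars and
  cut-offs.\<close>

definition kern :: "('a \<Rightarrow> 'a \<Rightarrow> complex) \<Rightarrow> 'a \<Rightarrow> 'a \<Rightarrow> complex" where
  "kern \<psi> x y = of_real (b x y / (sqrt (m x) * sqrt (m y))) * \<psi> x y"

definition phase :: "('a \<Rightarrow> 'a \<Rightarrow> real) \<Rightarrow> 'a \<Rightarrow> 'a \<Rightarrow> complex" where
  "phase \<theta> x y = exp (\<i> * of_real (\<theta> x y))"

lemma cmod_phase [simp]: "cmod (phase \<theta> x y) = 1"
  by (simp add: phase_def)

abbreviation deg :: "'a \<Rightarrow> real" where
  "deg \<equiv> weighted_deg b m"

lemma deg_nonneg: "0 \<le> deg x"
  unfolding weighted_deg_def by (intro divide_nonneg_nonneg infsum_nonneg) (auto simp: b_nonneg)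

lemma b_has_sum: "((\<lambda>y. complex_of_real (b x y)) has_sum of_real (deg x * m x)) UNIV"
  using has_sum_infsum[OF b_summable[of x]] by (simp add: weighted_deg_def has_sum_of_real_iff)

text \<open>Expanding the product gives two diagonal sums, which reversal of edges interchanges, and
  two mixed sums, which coincide by antisymmetry of \<theta>. A vertex may have infinitely many
  neighbours; the diagonal sums converge because each row of \<open>b\<close> does.\<close>

lemma magnetic_form_finite:
  assumes \<theta>: "magnetic_potential b \<theta>" and K: "finite K" "\<And>x. x \<notin> K \<Longrightarrow> f x = 0" "\<And>x. x \<notin> K \<Longrightarrow> g x = 0"
  shows "magnetic_form b m v \<theta> f g =
    (\<Sum>x\<in>K. of_real ((v x + deg x) * m x) * f x * cnj (g x))
    - (\<Sum>x\<in>K. \<Sum>y\<in>K. of_real (b x y) * phase \<theta> x y * f y * cnj (g x))"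
proof -
  let ?E = "{(x, y). 0 < b x y}"
  let ?e = "phase \<theta>"
  have b0: "0 < b x y \<longleftrightarrow> b x y \<noteq> 0" for x y using b_nonneg[of x y] by linarith
  let ?S = "\<Sum>x\<in>K. f x * cnj (g x) * of_real (deg x * m x)"
  have T1: "((\<lambda>(x, y). of_real (b x y) * (f x * cnj (g x))) has_sum ?S) ?E"
  proof -
    have "((\<lambda>(x, y). of_real (b x y) * (f x * cnj (g x))) has_sum ?S) (\<Union>x\<in>K. {x} \<times> UNIV)"
    proof (rule sum_has_sum[OF K(1)])
      fix x
      have "((\<lambda>y. f x * cnj (g x) * of_real (b x y)) has_sum f x * cnj (g x) * of_real (deg x * m x)) UNIV"
        by (rule has_sum_cmult_right[OF b_has_sum])
      then have "((\<lambda>(x, y). of_real (b x y) * (f x * cnj (g x))) has_sum f x * cnj (g x) * of_real (deg x * m x)) (Pair x ` UNIV)"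
        by (subst has_sum_reindex) (auto simp: o_def mult_ac inj_on_def)
      moreover have "Pair x ` (UNIV :: 'a set) = {x} \<times> UNIV" by auto
      ultimately show "((\<lambda>(x, y). of_real (b x y) * (f x * cnj (g x))) has_sum f x * cnj (g x) * of_real (deg x * m x)) ({x} \<times> UNIV)"
        by (simp only:)
    qed auto
    then show ?thesis
      by (rule has_sum_change_set) (use b0 K in auto)
  qed
  have T4: "((\<lambda>(x, y). of_real (b x y) * (f y * cnj (g y))) has_sum ?S) ?E"
  proof -
    have "((\<lambda>(x, y). of_real (b x y) * (f y * cnj (g y))) has_sum ?S) (prod.swap ` ?E)"
      using T1 by (subst has_sum_reindex) (auto simp: o_def b_sym case_prod_unfold)
    moreover have "prod.swap ` ?E = ?E" by (auto simp: image_iff b_sym)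
    ultimately show ?thesis by simp
  qed
  let ?R = "\<Sum>x\<in>K. \<Sum>y\<in>K. of_real (b x y) * ?e x y * f y * cnj (g x)"
  have kf: "f x \<noteq> 0 \<Longrightarrow> x \<in> K" and kg: "g x \<noteq> 0 \<Longrightarrow> x \<in> K" for x using K by blast+
  have T3: "((\<lambda>(x, y). of_real (b x y) * ?e x y * f y * cnj (g x)) has_sum ?R) ?E"
  proof -
    have "((\<lambda>(x, y). of_real (b x y) * ?e x y * f y * cnj (g x)) has_sum ?R) (K \<times> K)"
      using K(1) by (simp add: has_sum_finiteI sum.cartesian_product)
    then show ?thesis
      by (rule has_sum_change_set) (use b0 kf kg in auto)
  qed
  \<comment> \<open>Reversing an edge conjugates the phase, so this mixed sum is a reindexing of
    \<open>T3\<close>.\<close>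
  have T2: "((\<lambda>(x, y). of_real (b x y) * cnj (?e x y) * f x * cnj (g y)) has_sum ?R) ?E"
  proof -
    have "((\<lambda>(x, y). of_real (b y x) * ?e y x * f x * cnj (g y)) has_sum ?R) (prod.swap ` ?E)"
      using T3 by (subst has_sum_reindex) (auto simp: o_def case_prod_unfold)
    moreover have "prod.swap ` ?E = ?E" by (auto simp: image_iff b_sym)
    ultimately have "((\<lambda>(x, y). of_real (b y x) * ?e y x * f x * cnj (g y)) has_sum ?R) ?E" by simp
    then show ?thesis
    proof (rule iffD1[OF has_sum_cong, rotated])
      fix p assume "p \<in> ?E"
      then obtain x y where p: "p = (x, y)" "0 < b x y" by auto
      then have "\<theta> y x = - \<theta> x y" using \<theta> unfolding magnetic_potential_def by force
      then have "?e y x = cnj (?e x y)" by (simp add: phase_def exp_cnj)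
      then show "(case p of (x, y) \<Rightarrow> of_real (b y x) * ?e y x * f x * cnj (g y)) =
        (case p of (x, y) \<Rightarrow> of_real (b x y) * cnj (?e x y) * f x * cnj (g y))"
        using p b_sym[of x y] by simp
    qed
  qed
  have ee: "?e x y * cnj (?e x y) = 1" for x y
    by (simp add: complex_norm_square[symmetric])
  have expand: "of_real (b x y) * (f x - ?e x y * f y) * cnj (g x - ?e x y * g y) =
     of_real (b x y) * (f x * cnj (g x)) - of_real (b x y) * cnj (?e x y) * f x * cnj (g y)
     - of_real (b x y) * ?e x y * f y * cnj (g x) + of_real (b x y) * (f y * cnj (g y))" for x y
  proof -
    have "of_real (b x y) * (f x - ?e x y * f y) * cnj (g x - ?e x y * g y) =
     of_real (b x y) * (f x * cnj (g x)) - of_real (b x y) * cnj (?e x y) * f x * cnj (g y)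
     - of_real (b x y) * ?e x y * f y * cnj (g x) + of_real (b x y) * ((?e x y * cnj (?e x y)) * (f y * cnj (g y)))"
      by (simp add: algebra_simps)
    then show ?thesis by (simp add: ee)
  qed
  have "((\<lambda>(x, y). of_real (b x y) * (f x - ?e x y * f y) * cnj (g x - ?e x y * g y)) has_sum ?S - ?R - ?R + ?S) ?E"
    using has_sum_add[OF has_sum_difference[OF has_sum_difference[OF T1 T2] T3] T4]
    by (simp only: case_prod_unfold expand)
  then have 1: "(\<Sum>\<^sub>\<infinity>(x, y)\<in>?E. of_real (b x y) * (f x - ?e x y * f y) * cnj (g x - ?e x y * g y)) = 2 * (?S - ?R)"
    by (simp add: infsumI)
  have "(\<Sum>\<^sub>\<infinity>x. of_real (v x) * f x * cnj (g x) * of_real (m x)) = (\<Sum>\<^sub>\<infinity>x\<in>K. of_real (v x) * f x * cnj (g x) * of_real (m x))"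
    by (rule infsum_cong_neutral) (use K in auto)
  then have 2: "(\<Sum>\<^sub>\<infinity>x. of_real (v x) * f x * cnj (g x) * of_real (m x)) = (\<Sum>x\<in>K. of_real (v x) * f x * cnj (g x) * of_real (m x))"
    using K by simp
  have "magnetic_form b m v \<theta> f g = 1 / 2 * (2 * (?S - ?R)) + (\<Sum>x\<in>K. of_real (v x) * f x * cnj (g x) * of_real (m x))"
    unfolding magnetic_form_def 2 1[unfolded phase_def] phase_def ..
  also have "\<dots> = (?S + (\<Sum>x\<in>K. of_real (v x) * f x * cnj (g x) * of_real (m x))) - ?R" by simp
  also have "?S + (\<Sum>x\<in>K. of_real (v x) * f x * cnj (g x) * of_real (m x)) = (\<Sum>x\<in>K. of_real ((v x + deg x) * m x) * f x * cnj (g x))"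
    unfolding sum.distrib[symmetric] by (intro sum.cong) (auto simp: algebra_simps)
  finally show ?thesis .
qed

lemma Cc_l2: "f \<in> Cc \<Longrightarrow> f \<in> l2 m"
  unfolding l2_def Cc_def mem_Collect_eq
  by (rule finite_nonzero_values_imp_summable_on) (auto elim: finite_subset[rotated])

lemma finite_support_l2_norm:
  assumes "finite K" "\<And>x. x \<notin> K \<Longrightarrow> f x = 0"
  shows "(l2_norm m f)\<^sup>2 = (\<Sum>x\<in>K. (cmod (f x))\<^sup>2 * m x)"
proof -
  have "(\<Sum>\<^sub>\<infinity>x. (cmod (f x))\<^sup>2 * m x) = (\<Sum>\<^sub>\<infinity>x\<in>K. (cmod (f x))\<^sup>2 * m x)"
    by (rule infsum_cong_neutral) (use assms in auto)
  then show ?thesis using assms by (simp add: l2_norm_def sum_nonneg)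
qed

text \<open>The form with electric potential \<open>-deg\<close> is minus the quadratic form of the adjacency
  kernel, so its semi-boundedness makes the adjacency operator bounded.\<close>

lemma bounded_adjacency:
  assumes sb: "semibounded_form m Cc (magnetic_form b m (\<lambda>x. - deg x) (\<lambda>_ _. 0))"
  shows "\<exists>C. bounded_kernel C (kern (\<lambda>_ _. 1))"
proof -
  let ?q = "magnetic_form b m (\<lambda>x. - deg x) (\<lambda>_ _. 0)"
  let ?\<beta> = "\<lambda>x y. b x y / (sqrt (m x) * sqrt (m y))"
  have \<beta>: "0 \<le> ?\<beta> x y" for x y using b_nonneg by simp
  obtain C0 where C0: "\<And>f. f \<in> Cc \<Longrightarrow> C0 * (l2_norm m f)\<^sup>2 \<le> Re (?q f f)"
    using sb unfolding semibounded_form_def by blast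
  let ?C = "\<bar>C0\<bar>"
  \<comment> \<open>The test function is \<open>p\<close> divided by the root of \<open>m\<close>,
    whose weighted norm is the plain norm of \<open>p\<close> on \<open>A\<close>. The resulting
    bound is one-sided.\<close>
  have diag: "(\<Sum>x\<in>A. \<Sum>y\<in>A. ?\<beta> x y * p x * p y) \<le> ?C * (\<Sum>x\<in>A. (p x)\<^sup>2)" if A: "finite A" for A p
  proof -
    let ?f = "\<lambda>x. if x \<in> A then complex_of_real (p x / sqrt (m x)) else 0"
    have "?f \<in> Cc" unfolding Cc_def using A by (auto intro: finite_subset[of _ A])
    have "?q ?f ?f = - (\<Sum>x\<in>A. \<Sum>y\<in>A. of_real (?\<beta> x y * p x * p y))"
    proof -
      have mp: "magnetic_potential b (\<lambda>_ _. 0)" by (simp add: magnetic_potential_def)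
      show ?thesis
        by (subst magnetic_form_finite[OF mp A])
           (auto simp: phase_def sum_negf[symmetric] algebra_simps intro!: sum.cong)
    qed
    then have "Re (?q ?f ?f) = - (\<Sum>x\<in>A. \<Sum>y\<in>A. ?\<beta> x y * p x * p y)"
      by (simp only: of_real_sum[symmetric] of_real_minus[symmetric] Re_complex_of_real)
    moreover have "(l2_norm m ?f)\<^sup>2 = (\<Sum>x\<in>A. (p x)\<^sup>2)"
      using A by (subst finite_support_l2_norm[OF A]) (auto simp: power_divide norm_divide intro!: sum.cong)
    ultimately have "(\<Sum>x\<in>A. \<Sum>y\<in>A. ?\<beta> x y * p x * p y) \<le> - C0 * (\<Sum>x\<in>A. (p x)\<^sup>2)"
      using C0[OF \<open>?f \<in> Cc\<close>] by simp
    also have "\<dots> \<le> ?C * (\<Sum>x\<in>A. (p x)\<^sup>2)" by (intro mult_right_mono sum_nonneg) auto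
    finally show ?thesis .
  qed
  have pol: "(\<Sum>x\<in>A. \<Sum>y\<in>A. ?\<beta> x y * f x * g y) \<le> ?C * ((L2_set f A)\<^sup>2 + (L2_set g A)\<^sup>2)"
    if A: "finite A" and nn: "\<And>x. 0 \<le> f x" "\<And>x. 0 \<le> g x" for A f g
  proof -
    let ?B = "\<lambda>f g. \<Sum>x\<in>A. \<Sum>y\<in>A. ?\<beta> x y * f x * g y"
    have sym: "?B g f = ?B f g"
      by (subst sum.swap) (auto simp: b_sym[of _ "_"] mult_ac intro!: sum.cong)
    have nonneg: "0 \<le> ?B f f" "0 \<le> ?B g g" by (intro sum_nonneg mult_nonneg_nonneg \<beta> nn)+
    have "?B (\<lambda>x. f x + g x) (\<lambda>x. f x + g x) = ?B f f + ?B f g + ?B g f + ?B g g"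
      unfolding sum.distrib[symmetric] by (intro sum.cong refl) (simp add: algebra_simps add_divide_distrib)
    then have "2 * ?B f g \<le> ?B (\<lambda>x. f x + g x) (\<lambda>x. f x + g x)" using nonneg sym by linarith
    also have "\<dots> \<le> ?C * (\<Sum>x\<in>A. (f x + g x)\<^sup>2)" by (rule diag[OF A])
    also have "(\<Sum>x\<in>A. (f x + g x)\<^sup>2) \<le> (\<Sum>x\<in>A. 2 * (f x)\<^sup>2 + 2 * (g x)\<^sup>2)"
    proof (rule sum_mono)
      fix x show "(f x + g x)\<^sup>2 \<le> 2 * (f x)\<^sup>2 + 2 * (g x)\<^sup>2"
        using sum_squares_bound[of "f x" "g x"] by (simp add: power2_sum)
    qed
    then have "?C * (\<Sum>x\<in>A. (f x + g x)\<^sup>2) \<le> ?C * (2 * (L2_set f A)\<^sup>2 + 2 * (L2_set g A)\<^sup>2)"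
      by (intro mult_left_mono) (auto simp: L2_set_def sum_nonneg sum.distrib sum_distrib_left)
    finally show ?thesis by (simp add: algebra_simps)
  qed
  have "bounded_kernel (2 * ?C) (kern (\<lambda>_ _. 1))"
    unfolding bounded_kernel_def
  proof (intro conjI allI impI)
    fix A :: "'a set" and f g :: "'a \<Rightarrow> real"
    assume A: "finite A" and nn: "\<forall>x. 0 \<le> f x" "\<forall>x. 0 \<le> g x"
    have cm: "cmod (kern (\<lambda>_ _. 1) x y) = ?\<beta> x y" for x y
      using \<beta>[of x y] b_nonneg[of x y] by (simp add: kern_def norm_divide norm_mult)
    let ?a = "L2_set f A" and ?c = "L2_set g A"
    show "(\<Sum>x\<in>A. \<Sum>y\<in>A. cmod (kern (\<lambda>_ _. 1) x y) * f x * g y) \<le> 2 * ?C * ?a * ?c"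
    proof (cases "?a = 0 \<or> ?c = 0")
      case True
      then have "(\<forall>x\<in>A. f x = 0) \<or> (\<forall>x\<in>A. g x = 0)" using A by (simp add: L2_set_eq_0_iff)
      then show ?thesis using True by auto
    next
      case False
      \<comment> \<open>Scaling both functions to norm 1 makes the sum of squares equal to 2;
        scaling back produces the product of the norms.\<close>
      then have pos: "0 < ?a" "0 < ?c" using L2_set_nonneg by (metis order_less_le)+
      have "L2_set (\<lambda>x. f x / ?a) A = 1" "L2_set (\<lambda>x. g x / ?c) A = 1"
        using L2_set_right_distrib[of "1 / ?a" f A] L2_set_right_distrib[of "1 / ?c" g A] pos by auto
      then have "(\<Sum>x\<in>A. \<Sum>y\<in>A. ?\<beta> x y * (f x / ?a) * (g y / ?c)) \<le> ?C * (1 + 1)"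
        using pol[OF A, of "\<lambda>x. f x / ?a" "\<lambda>x. g x / ?c"] nn pos by simp
      moreover have "(\<Sum>x\<in>A. \<Sum>y\<in>A. ?\<beta> x y * (f x / ?a) * (g y / ?c)) = (\<Sum>x\<in>A. \<Sum>y\<in>A. ?\<beta> x y * f x * g y) / (?a * ?c)"
        by (simp add: sum_divide_distrib mult.assoc)
      ultimately have "(\<Sum>x\<in>A. \<Sum>y\<in>A. ?\<beta> x y * f x * g y) / (?a * ?c) \<le> ?C * (1 + 1)" by (simp only:)
      then have "(\<Sum>x\<in>A. \<Sum>y\<in>A. ?\<beta> x y * f x * g y) \<le> ?C * (1 + 1) * (?a * ?c)"
        using pos by (simp only: pos_divide_le_eq mult_pos_pos)
      then show ?thesis by (simp only: cm) (simp add: mult_ac)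
    qed
  qed auto
  then show ?thesis by blast
qed

lemma bounded_kern:
  assumes "bounded_kernel C (kern (\<lambda>_ _. 1))" "\<And>x y. cmod (\<psi> x y) \<le> 1"
  shows "bounded_kernel C (kern \<psi>)"
  by (rule bounded_kernel_mono[OF assms(1)])
     (simp only: kern_def norm_mult norm_one mult_1_right, intro mult_left_le assms(2) norm_ge_zero)

lemma unemb_unitv_Cc: "unemb m (unitv x) \<in> Cc"
  unfolding Cc_def unemb_def by (auto intro: finite_subset[of _ "{x}"])

text \<open>The form at a normalised point mass is the diagonal entry \<open>v x + deg x\<close>, as
  \<open>b x x = 0\<close>.\<close>

lemma potential_bounded_below:
  assumes \<theta>: "magnetic_potential b \<theta>" and sb: "semibounded_form m Cc (magnetic_form b m v \<theta>)"
  shows "\<exists>c. \<forall>x. 0 \<le> v x + deg x + c"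
proof -
  obtain C where C: "\<And>f. f \<in> Cc \<Longrightarrow> C * (l2_norm m f)\<^sup>2 \<le> Re (magnetic_form b m v \<theta> f f)"
    using sb unfolding semibounded_form_def by blast
  have "0 \<le> v x + deg x + (- C)" for x
  proof -
    let ?f = "unemb m (unitv x)"
    have s0: "y \<notin> {x} \<Longrightarrow> ?f y = 0" for y by (simp add: unemb_def)
    have sm: "(cmod (?f x))\<^sup>2 * m x = 1"
      using m_pos[of x] by (simp add: unemb_def norm_divide power_divide)
    have "Re (magnetic_form b m v \<theta> ?f ?f) = (v x + deg x) * (m x * (cmod (?f x))\<^sup>2)"
    proof -
      have "magnetic_form b m v \<theta> ?f ?f = of_real ((v x + deg x) * m x) * (?f x * cnj (?f x))"
        using magnetic_form_finite[OF \<theta>, of "{x}" ?f ?f v] s0 by (simp add: mult.assoc)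
      then show ?thesis unfolding complex_norm_square[symmetric] by (simp del: of_real_mult of_real_add flip: of_real_power)
    qed
    moreover have "(l2_norm m ?f)\<^sup>2 = 1" using sm finite_support_l2_norm[of "{x}" ?f] s0 by simp
    ultimately show ?thesis using C[OF unemb_unitv_Cc[of x]] sm by (simp add: mult.commute)
  qed
  then show ?thesis by blast
qed

end

section \<open>Explicit closure of the magnetic form and its operator\<close>

locale magnetic_graph = graph b m for b :: "'a::countable \<Rightarrow> 'a \<Rightarrow> real" and m +
  fixes v :: "'a \<Rightarrow> real" and \<theta> :: "'a \<Rightarrow> 'a \<Rightarrow> real" and C c :: real
  assumes potential: "magnetic_potential b \<theta>"
    and adj_bounded: "bounded_kernel C (kern (phase \<theta>))"
    and below: "\<And>x. 0 \<le> v x + deg x + c"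
begin

abbreviation "q \<equiv> magnetic_form b m v \<theta>"
abbreviation "A \<equiv> kop (kern (phase \<theta>))"

text \<open>Square root of the diagonal part, shifted by \<open>c\<close> to be nonnegative. The
  closed form lives on the domain of multiplication by \<open>R\<close>, since the remainder is
  bounded.\<close>

definition R :: "'a \<Rightarrow> complex" where
  "R x = of_real (sqrt (v x + deg x + c))"

definition form_dom :: "'a ell2 \<Rightarrow> bool" where
  "form_dom F \<longleftrightarrow> (\<lambda>x. R x * coord F x) \<in> sqsum"

text \<open>The candidate for the closed form, carried over to \<open>ell2\<close>: the shift by
  \<open>c\<close> is subtracted again and the adjacency part is a bounded perturbation.\<close>

definition qb :: "'a ell2 \<Rightarrow> 'a ell2 \<Rightarrow> complex" where
  "qb F H = cip (mulo R F) (mulo R H) - of_real c * cip F H - cip (A F) H"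

lemma cnj_R [simp]: "cnj (R x) = R x" and R_square: "R x * R x = of_real (v x + deg x + c)"
  using below[of x] by (simp_all add: R_def flip: of_real_mult)

lemma coord_R: "form_dom F \<Longrightarrow> coord (mulo R F) x = R x * coord F x"
  unfolding mulo_def form_dom_def by (subst coord_Abs) auto

lemma form_dom_diff: "form_dom F \<Longrightarrow> form_dom G \<Longrightarrow> form_dom (F - G)"
  using sqsum_add[of "\<lambda>x. R x * coord F x" "\<lambda>x. -1 * (R x * coord G x)"]
    sqsum_mult_bounded[of "\<lambda>x. R x * coord G x" "\<lambda>_. -1" 1]
  by (simp add: form_dom_def algebra_simps)

lemma mulo_R_diff: "form_dom F \<Longrightarrow> form_dom G \<Longrightarrow> mulo R (F - G) = mulo R F - mulo R G"
  by (rule ell2_eqI) (simp add: coord_R form_dom_diff algebra_simps)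

lemma form_dom_finite:
  assumes "finite {x. coord F x \<noteq> 0}" shows "form_dom F"
  unfolding form_dom_def sqsum_def mem_Collect_eq
  by (rule finite_nonzero_values_imp_summable_on) (rule finite_subset[OF _ assms], auto)

lemma form_dom_Cc: "f \<in> Cc \<Longrightarrow> form_dom (emb m f)"
  by (rule form_dom_finite) (auto simp: coord_emb Cc_l2 Cc_def elim: finite_subset[rotated])

lemma cip_finite:
  assumes "finite K" "\<And>x. x \<notin> K \<Longrightarrow> coord H x = 0"
  shows "cip F H = (\<Sum>x\<in>K. coord F x * cnj (coord H x))"
proof -
  have "cip F H = (\<Sum>\<^sub>\<infinity>x\<in>K. coord F x * cnj (coord H x))"
    unfolding cip_def by (rule infsum_cong_neutral) (use assms in auto)
  then show ?thesis using assms by simp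
qed

lemma q_Cc:
  assumes f: "f \<in> Cc" and h: "h \<in> Cc"
  shows "q f h = qb (emb m f) (emb m h)"
proof -
  let ?K = "{x. f x \<noteq> 0} \<union> {x. h x \<noteq> 0}" and ?F = "emb m f" and ?H = "emb m h"
  have K: "finite ?K" using f h by (simp add: Cc_def)
  have cF: "coord ?F x = of_real (sqrt (m x)) * f x" and cH: "coord ?H x = of_real (sqrt (m x)) * h x" for x
    using f h by (auto simp: coord_emb Cc_l2)
  have H0: "x \<notin> ?K \<Longrightarrow> coord ?H x = 0" for x by (simp add: cH)
  have RH0: "x \<notin> ?K \<Longrightarrow> coord (mulo R ?H) x = 0" for x by (simp add: coord_R form_dom_Cc h cH)
  have mm: "complex_of_real (sqrt (m x)) * of_real (sqrt (m x)) = of_real (m x)" for x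
    by (simp flip: of_real_mult)
  have AF: "coord (A ?F) x = (\<Sum>y\<in>?K. kern (phase \<theta>) x y * coord ?F y)" for x
  proof -
    have "coord (A ?F) x = (\<Sum>\<^sub>\<infinity>y\<in>?K. kern (phase \<theta>) x y * coord ?F y)"
      unfolding coord_kop[OF adj_bounded] by (rule infsum_cong_neutral) (auto simp: cF)
    then show ?thesis using K by simp
  qed
  have 1: "cip (mulo R ?F) (mulo R ?H) = (\<Sum>x\<in>?K. of_real ((v x + deg x + c) * m x) * f x * cnj (h x))"
  proof (subst cip_finite[OF K], erule RH0, rule sum.cong[OF refl])
    fix x
    have "coord (mulo R ?F) x * cnj (coord (mulo R ?H) x) = (R x * R x) * (of_real (sqrt (m x)) * of_real (sqrt (m x))) * f x * cnj (h x)"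
      by (simp add: coord_R form_dom_Cc f h cF cH mult_ac)
    then show "coord (mulo R ?F) x * cnj (coord (mulo R ?H) x) = of_real ((v x + deg x + c) * m x) * f x * cnj (h x)"
      unfolding R_square mm by simp
  qed
  have 2: "cip ?F ?H = (\<Sum>x\<in>?K. of_real (m x) * f x * cnj (h x))"
    by (subst cip_finite[OF K], erule H0, rule sum.cong[OF refl]) (simp add: cF cH mm[symmetric] mult_ac)
  have 3: "cip (A ?F) ?H = (\<Sum>x\<in>?K. \<Sum>y\<in>?K. of_real (b x y) * phase \<theta> x y * f y * cnj (h x))"
  proof (subst cip_finite[OF K], erule H0, unfold AF sum_distrib_right, intro sum.cong refl)
    fix x y
    show "kern (phase \<theta>) x y * coord ?F y * cnj (coord ?H x) = of_real (b x y) * phase \<theta> x y * f y * cnj (h x)"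
      by (simp add: kern_def cF cH)
  qed
  have "q f h = (\<Sum>x\<in>?K. of_real ((v x + deg x) * m x) * f x * cnj (h x)) -
      (\<Sum>x\<in>?K. \<Sum>y\<in>?K. of_real (b x y) * phase \<theta> x y * f y * cnj (h x))"
    by (rule magnetic_form_finite[OF potential K]) auto
  also have "(\<Sum>x\<in>?K. of_real ((v x + deg x) * m x) * f x * cnj (h x)) =
     (\<Sum>x\<in>?K. of_real ((v x + deg x + c) * m x) * f x * cnj (h x)) - of_real c * (\<Sum>x\<in>?K. of_real (m x) * f x * cnj (h x))"
    unfolding sum_distrib_left sum_subtractf[symmetric] by (rule sum.cong) (auto simp: algebra_simps)
  finally show ?thesis unfolding qb_def 1 2 3 .
qed

lemma Cc_diff: "f \<in> Cc \<Longrightarrow> g \<in> Cc \<Longrightarrow> f - g \<in> Cc"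
  unfolding Cc_def mem_Collect_eq
  by (rule finite_subset[of _ "{x. f x \<noteq> 0} \<union> {x. g x \<noteq> 0}"]) auto

lemma emb_minus: "f \<in> l2 m \<Longrightarrow> g \<in> l2 m \<Longrightarrow> emb m (f - g) = emb m f - emb m g"
  using emb_diff[of f g] by (simp add: fun_diff_def)

text \<open>The formula for \<open>qb\<close> solved for its leading term. It makes a sequence that
  is Cauchy for the form and for the norm also Cauchy after multiplication by
  \<open>R\<close>.\<close>

lemma norm_mulo_R_le:
  assumes "f \<in> Cc"
  shows "(norm (mulo R (emb m f)))\<^sup>2 \<le> cmod (q f f) + (\<bar>c\<bar> + C) * (norm (emb m f))\<^sup>2"
proof -
  let ?F = "emb m f"
  have n: "cip G G = of_real ((norm G)\<^sup>2)" for G :: "'a ell2"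
  proof -
    have "((\<lambda>x. complex_of_real ((cmod (coord G x))\<^sup>2)) has_sum of_real ((norm G)\<^sup>2)) UNIV"
      using has_sum_norm_ell2[of G] by (simp only: has_sum_of_real_iff)
    then show ?thesis unfolding cip_def by (intro infsumI) (simp only: complex_norm_square)
  qed
  have "complex_of_real ((norm (mulo R ?F))\<^sup>2) = q f f + of_real (c * (norm ?F)\<^sup>2) + cip (A ?F) ?F"
    unfolding q_Cc[OF assms assms] qb_def n by simp
  then have "(norm (mulo R ?F))\<^sup>2 = cmod (q f f + of_real (c * (norm ?F)\<^sup>2) + cip (A ?F) ?F)"
    by (metis abs_of_nonneg norm_of_real zero_le_power2)
  also have "\<dots> \<le> cmod (q f f) + \<bar>c\<bar> * (norm ?F)\<^sup>2 + cmod (cip (A ?F) ?F)"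
    by (intro order_trans[OF norm_triangle_ineq] add_mono) (auto simp: abs_mult norm_mult norm_power)
  also have "cmod (cip (A ?F) ?F) \<le> C * (norm ?F)\<^sup>2"
    using norm_cip_le[of "A ?F" ?F] mult_right_mono[OF norm_kop_le[OF adj_bounded, of ?F], of "norm ?F"]
    by (simp add: power2_eq_square)
  finally show ?thesis by (simp add: algebra_simps)
qed

text \<open>By \<open>norm_mulo_R_le\<close> the images under \<open>R\<close> converge; their limit
  is identified coordinatewise, which is the closedness of multiplication by
  \<open>R\<close>.\<close>

lemma form_convergent_limits:
  assumes fc: "form_convergent m Cc q fs f"
  shows "(\<lambda>n. emb m (fs n)) \<longlonglongrightarrow> emb m f" "form_dom (emb m f)"
    "(\<lambda>n. mulo R (emb m (fs n))) \<longlonglongrightarrow> mulo R (emb m f)"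
proof -
  let ?F = "\<lambda>n. emb m (fs n)" and ?G = "\<lambda>n. mulo R (emb m (fs n))"
  have fs: "fs n \<in> Cc" and f: "f \<in> l2 m" for n using fc by (auto simp: form_convergent_def)
  have "(\<lambda>n. l2_norm m (fs n - f)) \<longlonglongrightarrow> 0" using fc by (simp add: form_convergent_def)
  moreover have "l2_norm m (fs n - f) = norm (?F n - emb m f)" for n
    using l2_norm_eq[OF l2_diff[OF Cc_l2[OF fs[of n]] f]] Cc_l2[OF fs[of n]] f
    by (simp add: emb_diff fun_diff_def)
  ultimately show lim: "?F \<longlonglongrightarrow> emb m f" by (simp add: tendsto_norm_zero_iff LIM_zero_iff)
  have qlim: "((\<lambda>(j, k). q (fs j - fs k) (fs j - fs k)) \<longlongrightarrow> 0) (sequentially \<times>\<^sub>F sequentially)"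
    using fc by (simp add: form_convergent_def)
  have le: "(norm (?G j - ?G k))\<^sup>2 \<le> cmod (q (fs j - fs k) (fs j - fs k)) + (\<bar>c\<bar> + C) * (norm (?F j - ?F k))\<^sup>2" for j k
    using norm_mulo_R_le[OF Cc_diff[OF fs[of j] fs[of k]]] fs
    by (simp add: emb_minus Cc_l2 mulo_R_diff form_dom_Cc)
  have "((\<lambda>p. cmod (q (fs (fst p) - fs (snd p)) (fs (fst p) - fs (snd p)))
      + (\<bar>c\<bar> + C) * (norm (?F (fst p) - ?F (snd p)))\<^sup>2) \<longlongrightarrow>
      cmod 0 + (\<bar>c\<bar> + C) * (norm (emb m f - emb m f))\<^sup>2) (sequentially \<times>\<^sub>F sequentially)"
    using qlim by (intro tendsto_intros filterlim_compose[OF lim filterlim_fst] filterlim_compose[OF lim filterlim_snd])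
      (simp add: case_prod_unfold)
  then have bound0: "((\<lambda>p. cmod (q (fs (fst p) - fs (snd p)) (fs (fst p) - fs (snd p)))
      + (\<bar>c\<bar> + C) * (norm (?F (fst p) - ?F (snd p)))\<^sup>2) \<longlongrightarrow> 0) (sequentially \<times>\<^sub>F sequentially)"
    by simp
  have "Cauchy ?G"
  proof (rule metric_CauchyI)
    fix e :: real assume e: "0 < e"
    have "\<forall>\<^sub>F p in sequentially \<times>\<^sub>F sequentially. cmod (q (fs (fst p) - fs (snd p)) (fs (fst p) - fs (snd p)))
      + (\<bar>c\<bar> + C) * (norm (?F (fst p) - ?F (snd p)))\<^sup>2 < e\<^sup>2"
      using order_tendstoD(2)[OF bound0, of "e\<^sup>2"] e by simp
    then obtain N where "\<forall>j\<ge>N. \<forall>k\<ge>N. cmod (q (fs k - fs j) (fs k - fs j))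
      + (\<bar>c\<bar> + C) * (norm (?F k - ?F j))\<^sup>2 < e\<^sup>2"
      unfolding eventually_prod_sequentially by auto
    then have "(norm (?G k - ?G j))\<^sup>2 < e\<^sup>2" if "k \<ge> N" "j \<ge> N" for k j
      using le[of k j] that by fastforce
    then have "norm (?G k - ?G j) < e" if "k \<ge> N" "j \<ge> N" for k j
      using that e by (intro power2_less_imp_less[of "norm (?G k - ?G j)" e]) auto
    then show "\<exists>N. \<forall>m\<ge>N. \<forall>n\<ge>N. dist (?G m) (?G n) < e"
      unfolding dist_norm by blast
  qed
  then obtain G where G: "?G \<longlonglongrightarrow> G" using Cauchy_convergent convergent_def by blast
  have cG: "coord G x = R x * coord (emb m f) x" for x
  proof (rule LIMSEQ_unique)
    show "(\<lambda>n. coord (?G n) x) \<longlonglongrightarrow> coord G x" by (intro tendsto_intros G)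
    show "(\<lambda>n. coord (?G n) x) \<longlonglongrightarrow> R x * coord (emb m f) x"
      unfolding coord_R[OF form_dom_Cc[OF fs]] by (intro tendsto_intros lim)
  qed
  then have "(\<lambda>x. R x * coord (emb m f) x) = coord G" by auto
  then show dom: "form_dom (emb m f)" by (simp add: form_dom_def)
  have "mulo R (emb m f) = G" by (rule ell2_eqI) (simp add: coord_R[OF dom] cG)
  then show "?G \<longlonglongrightarrow> mulo R (emb m f)" using G by simp
qed

lemma qb_tendsto:
  assumes "(F \<longlongrightarrow> F0) \<F>" "(H \<longlongrightarrow> H0) \<F>" "((\<lambda>n. mulo R (F n)) \<longlongrightarrow> RF) \<F>" "((\<lambda>n. mulo R (H n)) \<longlongrightarrow> RH) \<F>"
  shows "((\<lambda>n. qb (F n) (H n)) \<longlongrightarrow> cip RF RH - of_real c * cip F0 H0 - cip (A F0) H0) \<F>"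
  unfolding qb_def
  by (intro tendsto_intros tendsto_cip assms bounded_linear.tendsto[OF bounded_linear_kop[OF adj_bounded]])

text \<open>Truncation along the enumeration \<open>to_nat\<close> commutes with \<open>R\<close>,
  so \<open>emb m f\<close> and its image under \<open>R\<close> are approximated at once, and with
  them the form.\<close>

lemma form_convergent_exists:
  assumes f: "f \<in> l2 m" and dom: "form_dom (emb m f)"
  shows "\<exists>fs. form_convergent m Cc q fs f"
proof -
  let ?K = "\<lambda>n. {x :: 'a. to_nat x < n}" and ?F = "emb m f"
  define fs where "fs n x = (if x \<in> ?K n then f x else 0)" for n x
  have finK: "finite (?K n)" for n
    by (rule finite_imageD[of to_nat]) (auto intro: finite_subset[of _ "{..<n}"])
  have fs: "fs n \<in> Cc" for n
    unfolding Cc_def fs_def mem_Collect_eq by (rule finite_subset[OF _ finK[of n]]) auto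
  have emb: "emb m (fs n) = trunc (?K n) ?F" for n
    by (rule ell2_eqI) (simp add: coord_emb Cc_l2 fs f, simp add: fs_def)
  have mul: "mulo R (emb m (fs n)) = trunc (?K n) (mulo R ?F)" for n
    by (rule ell2_eqI) (simp add: coord_R form_dom_Cc fs dom, simp add: emb)
  have ex: "\<forall>\<^sub>F n in sequentially. x \<in> ?K n" for x
    using eventually_gt_at_top[of "to_nat x"] by simp
  have l1: "(\<lambda>n. emb m (fs n)) \<longlonglongrightarrow> ?F" unfolding emb by (rule tendsto_trunc[OF ex])
  have l2: "(\<lambda>n. mulo R (emb m (fs n))) \<longlonglongrightarrow> mulo R ?F" unfolding mul by (rule tendsto_trunc[OF ex])
  let ?D = "\<lambda>p. emb m (fs (fst p) - fs (snd p))"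
  have eD: "?D p = emb m (fs (fst p)) - emb m (fs (snd p))" for p by (simp add: emb_minus Cc_l2 fs)
  have rD: "mulo R (?D p) = mulo R (emb m (fs (fst p))) - mulo R (emb m (fs (snd p)))" for p
    by (simp add: eD mulo_R_diff form_dom_Cc fs)
  have d1: "(?D \<longlongrightarrow> ?F - ?F) (sequentially \<times>\<^sub>F sequentially)" unfolding eD
    by (intro tendsto_intros filterlim_compose[OF l1 filterlim_fst] filterlim_compose[OF l1 filterlim_snd])
  have d2: "((\<lambda>p. mulo R (?D p)) \<longlongrightarrow> mulo R ?F - mulo R ?F) (sequentially \<times>\<^sub>F sequentially)" unfolding rD
    by (intro tendsto_intros filterlim_compose[OF l2 filterlim_fst] filterlim_compose[OF l2 filterlim_snd])
  have z: "cip 0 G = 0" for G :: "'a ell2" by (simp add: cip_def)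
  have "((\<lambda>p. qb (?D p) (?D p)) \<longlongrightarrow> 0) (sequentially \<times>\<^sub>F sequentially)"
    using qb_tendsto[OF d1 d1 d2 d2]
    by (simp add: z linear_0[OF bounded_linear.linear[OF bounded_linear_kop[OF adj_bounded]]])
  then have "((\<lambda>(j, k). q (fs j - fs k) (fs j - fs k)) \<longlongrightarrow> 0) (sequentially \<times>\<^sub>F sequentially)"
    by (simp add: case_prod_unfold q_Cc Cc_diff fs)
  moreover have "(\<lambda>n. l2_norm m (fs n - f)) \<longlonglongrightarrow> 0"
  proof -
    have "l2_norm m (fs n - f) = norm (emb m (fs n) - ?F)" for n
      using l2_norm_eq[OF l2_diff[OF Cc_l2[OF fs[of n]] f]] Cc_l2[OF fs[of n]] f
      by (simp add: emb_diff fun_diff_def)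
    then show ?thesis using l1 by (simp add: tendsto_norm_zero_iff LIM_zero_iff)
  qed
  ultimately show ?thesis using fs f by (auto simp: form_convergent_def intro!: exI[of _ fs])
qed

lemma closure_dom_eq: "closure_dom m Cc q = {f \<in> l2 m. form_dom (emb m f)}"
  using form_convergent_exists form_convergent_limits(2)
  by (auto simp: closure_dom_def form_convergent_def)

text \<open>All approximating sequences yield the same limit, as the definite description in
  \<open>closure_form\<close> requires.\<close>

lemma closure_form_eq:
  assumes "f \<in> closure_dom m Cc q" "h \<in> closure_dom m Cc q"
  shows "closure_form m Cc q f h = qb (emb m f) (emb m h)"
proof -
  have lim: "(\<lambda>n. q (fs n) (hs n)) \<longlonglongrightarrow> qb (emb m f) (emb m h)"
    if "form_convergent m Cc q fs f" "form_convergent m Cc q hs h" for fs hs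
  proof -
    have "fs n \<in> Cc" "hs n \<in> Cc" for n using that by (auto simp: form_convergent_def)
    then show ?thesis
      using qb_tendsto[OF form_convergent_limits(1)[OF that(1)] form_convergent_limits(1)[OF that(2)]
          form_convergent_limits(3)[OF that(1)] form_convergent_limits(3)[OF that(2)]]
      by (simp add: q_Cc qb_def[of "emb m f"])
  qed
  obtain fs hs where "form_convergent m Cc q fs f" "form_convergent m Cc q hs h"
    using assms by (auto simp: closure_dom_def)
  then show ?thesis
    unfolding closure_form_def by (intro the_equality) (use lim LIMSEQ_unique in blast)+
qed

lemma qb_unitv:
  assumes "form_dom F"
  shows "qb F (unitv x) = of_real (v x + deg x) * coord F x - coord (A F) x"
proof -
  have d: "form_dom (unitv x)" by (rule form_dom_finite) (auto intro: finite_subset[of _ "{x}"])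
  have "mulo R (unitv x) = cs (R x) (unitv x)" by (rule ell2_eqI) (simp add: coord_R[OF d])
  moreover have "cip G (cs (R x) (unitv x)) = R x * coord G x" for G
    by (subst cip_finite[of "{x}"]) auto
  ultimately show ?thesis
    unfolding qb_def cip_unitv by (simp add: coord_R[OF assms] R_square algebra_simps flip: mult.assoc)
qed

text \<open>Testing the form identity with point masses gives the pointwise formula. Conversely, the
  formula makes the function times the square of \<open>R\<close> square summable, and this places
  the function in the form domain.\<close>

lemma magnetic_op_eq:
  "magnetic_op b m v \<theta> = {(f, g). f \<in> l2 m \<and> g \<in> l2 m \<and>
     (\<forall>x. coord (emb m g) x = of_real (v x + deg x) * coord (emb m f) x - coord (A (emb m f)) x)}"
proof -
  have "(f, g) \<in> magnetic_op b m v \<theta> \<longleftrightarrow> f \<in> l2 m \<and> g \<in> l2 m \<and>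
     (\<forall>x. coord (emb m g) x = of_real (v x + deg x) * coord (emb m f) x - coord (A (emb m f)) x)" for f g
  proof
    assume L: "(f, g) \<in> magnetic_op b m v \<theta>"
    then have f: "f \<in> closure_dom m Cc q" and g: "g \<in> l2 m"
      and eq: "\<And>h. h \<in> closure_dom m Cc q \<Longrightarrow> closure_form m Cc q f h = l2_inner m g h"
      by (auto simp: magnetic_op_def form_operator_def)
    have fl: "f \<in> l2 m" "form_dom (emb m f)" using f by (auto simp: closure_dom_eq)
    have "coord (emb m g) x = of_real (v x + deg x) * coord (emb m f) x - coord (A (emb m f)) x" for x
    proof -
      let ?h = "unemb m (unitv x)"
      have h: "?h \<in> closure_dom m Cc q"
        using form_dom_Cc[OF unemb_unitv_Cc[of x]] by (simp add: closure_dom_eq)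
      have "coord (emb m g) x = l2_inner m g ?h" using g by (simp add: l2_inner_eq cip_unitv)
      also have "\<dots> = qb (emb m f) (unitv x)" using eq[OF h] closure_form_eq[OF f h] by simp
      finally show ?thesis by (simp add: qb_unitv fl)
    qed
    then show "f \<in> l2 m \<and> g \<in> l2 m \<and>
     (\<forall>x. coord (emb m g) x = of_real (v x + deg x) * coord (emb m f) x - coord (A (emb m f)) x)"
      using fl g by blast
  next
    assume Rh: "f \<in> l2 m \<and> g \<in> l2 m \<and>
     (\<forall>x. coord (emb m g) x = of_real (v x + deg x) * coord (emb m f) x - coord (A (emb m f)) x)"
    let ?F = "emb m f" and ?G = "emb m g"
    let ?H = "?G + A ?F + cs (of_real c) ?F"
    have H: "coord ?H x = R x * (R x * coord ?F x)" for x
      using Rh by (simp add: R_square algebra_simps flip: mult.assoc)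
    have dom: "form_dom ?F"
    proof -
      \<comment> \<open>The square of a number is at most its fourth power plus 1, so
        \<open>R\<close> times the function is controlled by the function itself and by its product
        with the square of \<open>R\<close>.\<close>
      have le: "(cmod (R x * coord ?F x))\<^sup>2 \<le> (cmod (coord ?H x))\<^sup>2 + (cmod (coord ?F x))\<^sup>2" for x
      proof -
        let ?r = "cmod (R x)"
        have "2 * ?r\<^sup>2 * 1 \<le> (?r\<^sup>2)\<^sup>2 + 1\<^sup>2" by (rule sum_squares_bound)
        then have "2 * ?r\<^sup>2 \<le> (?r\<^sup>2)\<^sup>2 + 1" by simp
        then have "?r\<^sup>2 \<le> (?r\<^sup>2)\<^sup>2 + 1" using zero_le_power2[of ?r] by linarith
        then have "?r\<^sup>2 \<le> ?r ^ 4 + 1" by (simp flip: power_mult)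
        then have "?r\<^sup>2 * (cmod (coord ?F x))\<^sup>2 \<le> (?r ^ 4 + 1) * (cmod (coord ?F x))\<^sup>2" by (rule mult_right_mono) auto
        then have "(?r * cmod (coord ?F x))\<^sup>2 \<le> (?r * (?r * cmod (coord ?F x)))\<^sup>2 + (cmod (coord ?F x))\<^sup>2"
          by (simp add: power4_eq_xxxx power2_eq_square distrib_left distrib_right mult_ac)
        then show ?thesis unfolding H norm_mult .
      qed
      have "(\<lambda>x. (cmod (coord ?H x))\<^sup>2 + (cmod (coord ?F x))\<^sup>2) summable_on UNIV"
        using coord_sqsum[of ?H] coord_sqsum[of ?F] unfolding sqsum_def by (intro summable_on_add) auto
      then show ?thesis unfolding form_dom_def sqsum_def mem_Collect_eq
        by (rule summable_on_comparison_test) (rule le, simp)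
    qed
    have "closure_form m Cc q f h = l2_inner m g h" if h: "h \<in> closure_dom m Cc q" for h
    proof -
      have hl: "h \<in> l2 m" "form_dom (emb m h)" using h by (auto simp: closure_dom_eq)
      have "cip (mulo R ?F) (mulo R (emb m h)) = cip ?H (emb m h)"
        unfolding cip_def by (intro infsum_cong) (simp only: H, simp add: coord_R dom hl mult_ac)
      also have "\<dots> = cip ?G (emb m h) + cip (A ?F) (emb m h) + of_real c * cip ?F (emb m h)"
        by (simp add: bounded_bilinear.add_left[OF bounded_bilinear_cip])
           (simp add: cip_def mult.assoc infsum_cmult_right cip_summable)
      finally show ?thesis
        using closure_form_eq[OF _ h, of f] Rh dom hl
        by (simp add: qb_def closure_dom_eq l2_inner_eq)
    qed
    then show "(f, g) \<in> magnetic_op b m v \<theta>"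
      using Rh dom by (auto simp: magnetic_op_def form_operator_def closure_dom_eq)
  qed
  then show ?thesis by auto
qed

end

section \<open>Analysis of the paths\<close>

lemma topspace_Xhat: "topspace Xhat = (if finite (UNIV :: 'a set) then range Some else (UNIV :: 'a::countable option set))"
  by (auto simp: Xhat_def intro: option.exhaust)

lemma Some_in_topspace [simp]: "Some z \<in> topspace Xhat"
  by (simp add: topspace_Xhat)

lemma openin_Xhat_Some: "openin Xhat {Some z}"
proof -
  have "openin (Alexandroff_compactification (discrete_topology UNIV)) (Some ` {z})"
    by (subst openin_Alexandroff_compactification_image_Some) simp
  then show ?thesis by (auto simp: Xhat_def openin_subtopology intro!: exI[of _ "{Some z}"])
qed

lemma openin_Xhat_minus_Some: "openin Xhat (topspace Xhat - {Some z})"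
proof -
  let ?A = "Alexandroff_compactification (discrete_topology (UNIV :: 'a set))"
  have "closedin ?A (Some ` {z})"
    by (subst closedin_Alexandroff_compactification_image_Some) auto
  then have "openin ?A (topspace ?A - {Some z})" by (simp add: closedin_def)
  then show ?thesis by (auto simp: Xhat_def openin_subtopology intro!: exI[of _ "topspace ?A - {Some z}"])
qed

text \<open>Each \<open>{Some z}\<close> is both open and closed, so a limit fixes the eventual
  truth value of \<open>f s = Some z\<close>. With infinitely many vertices the point at infinity is
  not isolated; it is treated as the failure of all these equations.\<close>

lemma limitin_Xhat_eventually:
  assumes "limitin Xhat f l \<F>"
  shows "\<forall>\<^sub>F s in \<F>. (f s = Some z) = (l = Some z)"
proof (cases "l = Some z")
  case True
  then have "\<forall>\<^sub>F s in \<F>. f s \<in> {Some z}"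
    using assms openin_Xhat_Some[of z] unfolding limitin_def by blast
  then show ?thesis by (rule eventually_mono) (use True in auto)
next
  case False
  then have "\<forall>\<^sub>F s in \<F>. f s \<in> topspace Xhat - {Some z}"
    using assms openin_Xhat_minus_Some[of z] unfolding limitin_def by blast
  then show ?thesis by (rule eventually_mono) (use False in auto)
qed

definition lval :: "(real \<Rightarrow> 'a::countable option) \<Rightarrow> real \<Rightarrow> 'a option" where
  "lval \<omega> s = (SOME l. limitin Xhat \<omega> l (at_left s))"

lemma path_right:
  assumes "\<omega> \<in> paths" "0 \<le> t"
  shows "\<forall>\<^sub>F s in at_right t. (\<omega> s = Some z) = (\<omega> t = Some z)"
  using assms by (intro limitin_Xhat_eventually) (auto simp: paths_def)

lemma limitin_lval: "\<omega> \<in> paths \<Longrightarrow> 0 < t \<Longrightarrow> limitin Xhat \<omega> (lval \<omega> t) (at_left t)"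
  unfolding lval_def by (rule someI_ex) (auto simp: paths_def)

lemma path_left:
  assumes "\<omega> \<in> paths" "0 < t"
  shows "\<forall>\<^sub>F s in at_left t. (\<omega> s = Some z) = (lval \<omega> t = Some z)"
  by (rule limitin_Xhat_eventually[OF limitin_lval[OF assms]])

lemma path_left_no_jump:
  assumes "0 < t" "t \<notin> jumps \<omega>"
  shows "\<forall>\<^sub>F s in at_left t. (\<omega> s = Some z) = (\<omega> t = Some z)"
  using assms by (intro limitin_Xhat_eventually) (auto simp: jumps_def)

lemma lval_neq: "\<omega> \<in> paths \<Longrightarrow> s \<in> jumps \<omega> \<Longrightarrow> lval \<omega> s \<noteq> \<omega> s"
  using limitin_lval[of \<omega> s] by (auto simp: jumps_def)

lemma option_eqI: "(\<And>z. (p = Some z) = (q = Some z)) \<Longrightarrow> p = q"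
  by (cases p; cases q) auto

text \<open>For each \<open>z\<close> the predicate \<open>\<omega> s = Some z\<close> is locally
  constant on the connected interval \<open>{a..c}\<close>: to the right by right-continuity, to the
  left because there is no jump.\<close>

lemma const_no_jumps:
  assumes \<omega>: "\<omega> \<in> paths" and a: "0 \<le> a" and J: "jumps \<omega> \<inter> {a<..c} = {}" and s: "s \<in> {a..c}"
  shows "\<omega> s = \<omega> a"
proof (rule option_eqI)
  fix z
  let ?P = "\<lambda>r. (\<omega> r = Some z) = (\<omega> a = Some z)"
  show "?P s"
  proof (rule connected_induction_simple[of "{a..c}" a s ?P])
    fix r assume r: "r \<in> {a..c}"
    have "\<forall>\<^sub>F q in at r within {a..c}. (\<omega> q = Some z) = (\<omega> r = Some z)"
    proof -
      have R: "\<forall>\<^sub>F q in at_right r. (\<omega> q = Some z) = (\<omega> r = Some z)"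
        using path_right[OF \<omega>] r a by auto
      \<comment> \<open>The left end point may itself be a jump time; within the interval only its
        right neighbourhood matters.\<close>
      show ?thesis
      proof (cases "r = a")
        case True
        have "at r within {a..c} \<le> at_right r"
          using True by (auto simp: le_filter_def eventually_at_filter elim!: eventually_mono)
        then show ?thesis using R by (simp add: filter_leD)
      next
        case False
        then have "r \<notin> jumps \<omega>" "0 < r" using J r a by auto
        then have L: "\<forall>\<^sub>F q in at_left r. (\<omega> q = Some z) = (\<omega> r = Some z)"
          by (intro path_left_no_jump)
        have "\<forall>\<^sub>F q in at r. (\<omega> q = Some z) = (\<omega> r = Some z)"
          using L R by (simp add: eventually_at_split)
        then show ?thesis using filter_leD[OF at_le[of "{a..c}" UNIV r]] by simp
      qed
    qed
    then obtain S where S: "open S" "r \<in> S" "\<And>q. q \<in> S \<Longrightarrow> q \<noteq> r \<Longrightarrow> q \<in> {a..c} \<Longrightarrow> (\<omega> q = Some z) = (\<omega> r = Some z)"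
      unfolding eventually_at_topological by blast
    show "\<exists>T. openin (top_of_set {a..c}) T \<and> r \<in> T \<and> (\<forall>x\<in>T. \<forall>y\<in>T. ?P x \<longrightarrow> ?P y)"
    proof (intro exI conjI ballI impI)
      show "openin (top_of_set {a..c}) ({a..c} \<inter> S)" using S by (auto simp: openin_open)
      show "r \<in> {a..c} \<inter> S" using r S by auto
      fix x y assume "x \<in> {a..c} \<inter> S" "y \<in> {a..c} \<inter> S" "?P x"
      then show "?P y" using S(3)[of x] S(3)[of y] by auto
    qed
  qed (use s in auto)
qed

lemma lval_eq:
  assumes \<omega>: "\<omega> \<in> paths" and r: "0 \<le> r" "r < s" and J: "jumps \<omega> \<inter> {r<..<s} = {}"
  shows "lval \<omega> s = \<omega> r"
proof (rule option_eqI)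
  fix z
  have "\<forall>\<^sub>F q in at_left s. q \<in> {r<..<s}"
    using r by (intro eventually_at_leftI[of r]) auto
  then have 1: "\<forall>\<^sub>F q in at_left s. \<omega> q = \<omega> r"
  proof eventually_elim
    case (elim q)
    then have "jumps \<omega> \<inter> {r<..q} = {}" using J by auto
    then show ?case using const_no_jumps[OF \<omega> r(1), of q q] elim by simp
  qed
  have "\<forall>\<^sub>F q in at_left s. (\<omega> q = Some z) = (lval \<omega> s = Some z)"
    using path_left[OF \<omega>] r by auto
  with 1 have "\<forall>\<^sub>F q in at_left s. (\<omega> r = Some z) = (lval \<omega> s = Some z)"
    by eventually_elim auto
  then show "(lval \<omega> s = Some z) = (\<omega> r = Some z)"
    using eventually_happens' trivial_limit_at_left_real by fastforce
qed

text \<open>Right-continuity keeps the path outside the finite set for a short time after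
  \<open>s\<close>, and a fine grid has a point in that span. At the right end there is no room, but
  \<open>t\<close> is itself a grid point.\<close>

lemma eventually_grid_avoids:
  assumes \<omega>: "\<omega> \<in> paths" and t: "0 < t" and s: "s \<in> {0..t}" and K: "finite K" "\<omega> s \<notin> Some ` K"
  shows "\<forall>\<^sub>F N in sequentially. \<exists>j\<le>N. \<omega> (real j * (t / real N)) \<notin> Some ` K"
proof (cases "s = t")
  case True
  show ?thesis
    using eventually_gt_at_top[of 0]
  proof eventually_elim
    case (elim N)
    then show ?case using True K by (intro exI[of _ N]) auto
  qed
next
  case False
  then have st: "0 \<le> s" "s < t" using s by auto
  have "\<forall>\<^sub>F r in at_right s. \<forall>z\<in>K. (\<omega> r = Some z) = (\<omega> s = Some z)"
    using K(1) path_right[OF \<omega> st(1)] by (simp add: eventually_ball_finite)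
  then have "\<forall>\<^sub>F r in at_right s. \<omega> r \<notin> Some ` K"
    by (rule eventually_mono) (use K(2) in auto)
  then obtain e where e: "s < e" "\<And>r. s < r \<Longrightarrow> r < e \<Longrightarrow> \<omega> r \<notin> Some ` K"
    unfolding eventually_at_right[OF st(2)] by auto
  let ?e = "min e t - s"
  have "0 < ?e" using e st by simp
  have "\<forall>\<^sub>F N in sequentially. t / real N < ?e"
  proof -
    have "(\<lambda>N. t / real N) \<longlonglongrightarrow> 0" by real_asymp
    then show ?thesis using \<open>0 < ?e\<close> by (rule order_tendstoD(2))
  qed
  with eventually_gt_at_top[of 0] show ?thesis
  proof eventually_elim
    case (elim N)
    let ?h = "t / real N"
    have h: "0 < ?h" using elim t by simp
    \<comment> \<open>Index of the first grid point strictly after \<open>s\<close>, which lies at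
      most one mesh away.\<close>
    define j where "j = nat \<lfloor>s / ?h\<rfloor> + 1"
    have "0 \<le> s / ?h" using st h by simp
    then have j: "s / ?h < real j" "real j \<le> s / ?h + 1" unfolding j_def by linarith+
    have 1: "s < real j * ?h" using j(1) h by (simp only: pos_divide_less_eq)
    have "real j * ?h \<le> (s / ?h + 1) * ?h" using j(2) h by (intro mult_right_mono) auto
    also have "\<dots> = s + ?h" using elim t by (simp add: field_simps)
    finally have 2: "real j * ?h < min e t" using elim by linarith
    have "real j * ?h < real N * ?h" using 2 elim by simp
    then have "j \<le> N" using h by (simp only: mult_less_cancel_right_pos of_nat_less_iff)
    then show ?case using e(2)[OF 1] 2 by (intro exI[of _ j]) auto
  qed
qed

context
  fixes \<omega> :: "real \<Rightarrow> 'a::countable option" and t :: real and K :: "'a set"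
  assumes \<omega>: "\<omega> \<in> paths" and t: "0 \<le> t" and K: "finite K" and inK: "\<And>s. s \<in> {0..t} \<Longrightarrow> \<omega> s \<in> Some ` K"
begin

lemma right_const: 
  assumes "0 \<le> s" "s \<le> t"
  shows "\<forall>\<^sub>F q in at_right s. \<omega> q = \<omega> s"
proof -
  obtain z where z: "\<omega> s = Some z" using inK[of s] assms by auto
  have "\<forall>\<^sub>F q in at_right s. (\<omega> q = Some z) = (\<omega> s = Some z)" by (rule path_right[OF \<omega> assms(1)])
  then show ?thesis by (rule eventually_mono) (use z in auto)
qed

lemma left_const:
  assumes "0 < s" "s \<le> t"
  shows "\<forall>\<^sub>F q in at_left s. \<omega> q = lval \<omega> s"
proof -
  have "\<forall>\<^sub>F q in at_left s. \<forall>z\<in>K. (\<omega> q = Some z) = (lval \<omega> s = Some z)"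
    using K path_left[OF \<omega> assms(1)] by (simp add: eventually_ball_finite)
  moreover have "\<forall>\<^sub>F q in at_left s. q \<in> {0<..<s}"
    using assms by (intro eventually_at_leftI[of 0]) auto
  ultimately show ?thesis
  proof eventually_elim
    case (elim q)
    then have "\<omega> q \<in> Some ` K" using assms by (intro inK) auto
    then show ?case using elim by auto
  qed
qed

lemma no_jump_eventually_const:
  assumes "\<forall>\<^sub>F q in at_right s. \<omega> q = p" "0 \<le> s"
  shows "\<forall>\<^sub>F q in at_right s. q \<notin> jumps \<omega>"
proof -
  obtain e where e: "s < e" "\<And>q. s < q \<Longrightarrow> q < e \<Longrightarrow> \<omega> q = p"
    using assms(1) unfolding eventually_at_right_field by auto
  have "q \<notin> jumps \<omega>" if q: "s < q" "q < e" for q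
  proof -
    have "\<forall>\<^sub>F r in at_left q. r \<in> {s<..<q}"
      using q by (intro eventually_at_leftI[of s]) auto
    then have "\<forall>\<^sub>F r in at_left q. \<omega> r = \<omega> q"
      by (rule eventually_mono) (use e q in auto)
    moreover have "\<omega> q \<in> topspace Xhat" using \<omega> q assms(2) by (auto simp: paths_def PiE_def Pi_def)
    ultimately show ?thesis by (simp add: jumps_def limitin_eventually)
  qed
  then show ?thesis unfolding eventually_at_right_field using e(1) by auto
qed

lemma no_jump_eventually_const_left:
  assumes "\<forall>\<^sub>F q in at_left s. \<omega> q = p" "0 < s"
  shows "\<forall>\<^sub>F q in at_left s. q \<notin> jumps \<omega>"
proof -
  obtain e where e: "e < s" "\<And>q. e < q \<Longrightarrow> q < s \<Longrightarrow> \<omega> q = p"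
    using assms(1) unfolding eventually_at_left_field by auto
  have "q \<notin> jumps \<omega>" if q: "e < q" "q < s" for q
  proof (cases "0 < q")
    case True
    have "\<forall>\<^sub>F r in at_left q. r \<in> {e<..<q}"
      using q by (intro eventually_at_leftI[of e]) auto
    then have "\<forall>\<^sub>F r in at_left q. \<omega> r = \<omega> q"
      by (rule eventually_mono) (use e q in auto)
    moreover have "\<omega> q \<in> topspace Xhat" using \<omega> True by (auto simp: paths_def PiE_def Pi_def)
    ultimately show ?thesis by (simp add: jumps_def limitin_eventually)
  qed (simp add: jumps_def)
  then show ?thesis unfolding eventually_at_left_field using e(1) by auto
qed

text \<open>Infinitely many jumps would accumulate at some time in \<open>{0..t}\<close>. With
  finitely many possible values, the one-sided limits force the path to be constant on each side of
  that time, so there are no jumps nearby.\<close>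

lemma finite_range_finite_jumps: "finite (jumps \<omega> \<inter> {..t})"
proof (rule ccontr)
  let ?J = "jumps \<omega> \<inter> {..t}"
  assume inf: "infinite ?J"
  have sub: "?J \<subseteq> {0..t}" by (auto simp: jumps_def)
  obtain s where s: "s \<in> {0..t}" "s islimpt ?J"
    using compact_Icc[of 0 t] inf sub unfolding compact_eq_Bolzano_Weierstrass by meson
  have R: "\<forall>\<^sub>F q in at_right s. q \<notin> jumps \<omega>"
    using s by (intro no_jump_eventually_const[OF right_const]) auto
  have L: "\<forall>\<^sub>F q in at_left s. q \<notin> jumps \<omega>"
  proof (cases "s = 0")
    case True
    have "\<forall>\<^sub>F q in at_left s. q < s" by (auto simp: eventually_at_filter)
    then show ?thesis by (rule eventually_mono) (use True in \<open>auto simp: jumps_def\<close>)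
  next
    case False
    then show ?thesis using s by (intro no_jump_eventually_const_left[OF left_const]) auto
  qed
  have "\<forall>\<^sub>F q in at s. q \<notin> jumps \<omega>" using R L by (simp add: eventually_at_split)
  then have "\<forall>\<^sub>F q in at s. q \<notin> ?J" by (rule eventually_mono) auto
  then show False using s(2) by (simp add: islimpt_iff_eventually)
qed

end

text \<open>The value at any time was already taken at the last preceding jump, or at time
  0.\<close>

lemma finite_jumps_finite_range:
  assumes \<omega>: "\<omega> \<in> paths" and fin: "finite (jumps \<omega> \<inter> {..t})"
  shows "finite (\<omega> ` {0..t})"
proof -
  have "\<omega> ` {0..t} \<subseteq> \<omega> ` insert 0 (jumps \<omega> \<inter> {..t})"
  proof
    fix p assume "p \<in> \<omega> ` {0..t}"
    then obtain s where s: "0 \<le> s" "s \<le> t" "p = \<omega> s" by auto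
    let ?r = "Max (insert 0 (jumps \<omega> \<inter> {..s}))"
    have fin': "finite (insert 0 (jumps \<omega> \<inter> {..s}))"
      using s by (intro finite.insertI finite_subset[OF _ fin]) auto
    have r: "?r \<in> insert 0 (jumps \<omega> \<inter> {..s})" using fin' by (intro Max_in) auto
    have "jumps \<omega> \<inter> {?r<..s} = {}" using fin' by (auto simp del: Max_insert)
    then have "\<omega> s = \<omega> ?r"
      using r s by (intro const_no_jumps[OF \<omega>]) (auto simp del: Max_insert simp: jumps_def)
    then show "p \<in> \<omega> ` insert 0 (jumps \<omega> \<inter> {..t})" using r s by (auto simp del: Max_insert)
  qed
  then show ?thesis using fin by (meson finite.insertI finite_imageI finite_subset)
qed


section \<open>Multiplicative functionals of a path and their grid approximation\<close>

definition jumps_between :: "(real \<Rightarrow> 'a::countable option) \<Rightarrow> real \<Rightarrow> real \<Rightarrow> real set" where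
  "jumps_between \<omega> a c = jumps \<omega> \<inter> {a<..c}"

text \<open>The half-open intervals of \<open>jumps_between\<close> make this multiplicative under
  concatenation of time intervals.\<close>

definition path_fun :: "('a::countable option \<Rightarrow> complex) \<Rightarrow> ('a option \<Rightarrow> 'a option \<Rightarrow> complex) \<Rightarrow>
    (real \<Rightarrow> 'a option) \<Rightarrow> real \<Rightarrow> real \<Rightarrow> complex" where
  "path_fun w \<Psi> \<omega> a c =
     exp (integral {a..c} (\<lambda>s. w (\<omega> s))) * (\<Prod>s\<in>jumps_between \<omega> a c. \<Psi> (lval \<omega> s) (\<omega> s))"

text \<open>Discrete counterpart of \<open>path_fun\<close> that sees only the end states of a step:
  equal states count as staying, different ones as a single jump, whose holding times are
  neglected.\<close>

definition step_factor :: "('b \<Rightarrow> complex) \<Rightarrow> ('b \<Rightarrow> 'b \<Rightarrow> complex) \<Rightarrow> real \<Rightarrow> 'b \<Rightarrow> 'b \<Rightarrow> complex" where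
  "step_factor w \<Psi> h p q = (if p = q then exp (of_real h * w p) else \<Psi> p q)"

locale kpath =
  fixes \<omega> :: "real \<Rightarrow> 'a::countable option" and t :: real
  assumes \<omega>: "\<omega> \<in> paths" and t: "0 \<le> t" and finite_jumps: "finite (jumps \<omega> \<inter> {..t})"
begin

abbreviation "J \<equiv> jumps_between \<omega>"
lemmas J_def = jumps_between_def

lemma finite_J [simp]: "c \<le> t \<Longrightarrow> finite (J a c)"
  unfolding J_def by (rule finite_subset[OF _ finite_jumps]) auto

lemma J_0: "J 0 t = jumps \<omega> \<inter> {..t}"
  by (auto simp: J_def jumps_def)

lemma J_union: "a \<le> b \<Longrightarrow> b \<le> c \<Longrightarrow> J a c = J a b \<union> J b c" and J_disj: "J a b \<inter> J b c = {}"
  by (auto simp: J_def)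

lemma jump_gap: "\<exists>d>0. \<forall>a c. 0 \<le> a \<longrightarrow> c \<le> t \<longrightarrow> c - a < d \<longrightarrow> J a c = {} \<or> (\<exists>s. J a c = {s})"
proof -
  \<comment> \<open>All distances between distinct jump times; 1 is inserted since there may be
    fewer than two jumps.\<close>
  let ?D = "insert 1 ((\<lambda>(r, s). \<bar>r - s\<bar>) ` {(r, s). r \<in> J 0 t \<and> s \<in> J 0 t \<and> r \<noteq> s})"
  have "finite {(r, s). r \<in> J 0 t \<and> s \<in> J 0 t \<and> r \<noteq> s}"
    by (rule finite_subset[of _ "J 0 t \<times> J 0 t"]) auto
  then have fin: "finite ?D" by simp
  have pos: "0 < Min ?D" using fin by (subst Min_gr_iff) auto
  have "J a c = {} \<or> (\<exists>s. J a c = {s})" if "0 \<le> a" "c \<le> t" "c - a < Min ?D" for a c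
  proof (rule ccontr)
    assume "\<not> ?thesis"
    then obtain r s where rs: "r \<in> J a c" "s \<in> J a c" "r \<noteq> s" by blast
    then have "r \<in> J 0 t" "s \<in> J 0 t" using that by (auto simp: J_def)
    then have "Min ?D \<le> \<bar>r - s\<bar>" using rs fin by (intro Min_le) auto
    moreover have "\<bar>r - s\<bar> < c - a" using rs by (auto simp: J_def)
    ultimately show False using that by simp
  qed
  then show ?thesis using pos by (intro exI[of _ "Min ?D"]) auto
qed

context
  fixes w :: "'a option \<Rightarrow> complex" and \<Psi> :: "'a option \<Rightarrow> 'a option \<Rightarrow> complex"
begin

definition wbound :: real where "wbound = (\<Sum>p\<in>\<omega> ` {0..t}. cmod (w p))"

lemma w_le: "s \<in> {0..t} \<Longrightarrow> cmod (w (\<omega> s)) \<le> wbound"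
  unfolding wbound_def by (rule member_le_sum) (auto intro: finite_jumps_finite_range[OF \<omega> finite_jumps])

text \<open>The integrand is locally constant off the jump times and the end points, hence
  measurable, and it is bounded by \<open>wbound\<close>. Lebesgue integrability links
  \<open>time_integral\<close> with the gauge integral in \<open>path_fun\<close>.\<close>

lemma set_integrable_w: "set_integrable lborel {0..t} (\<lambda>s. w (\<omega> s))"
proof -
  let ?f = "\<lambda>s. indicator {0..t} s *\<^sub>R w (\<omega> s)"
  let ?X = "insert 0 (insert t (J 0 t))"
  have "continuous_on (- ?X) ?f"
  proof (intro continuous_at_imp_continuous_on ballI)
    fix s assume s: "s \<in> - ?X"
    have "\<forall>\<^sub>F q in at s. ?f q = ?f s"
    proof (cases "s \<in> {0..t}")
      case True
      then have st: "0 < s" "s < t" "s \<notin> jumps \<omega>" using s by (auto simp: J_def)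
      have "\<not> s islimpt J 0 t" using islimpt_finite[of "J 0 t" s] by simp
      then have "\<forall>\<^sub>F q in at s. q \<notin> J 0 t" by (simp add: islimpt_iff_eventually)
      then obtain e where e: "0 < e" "\<And>q. q \<noteq> s \<Longrightarrow> dist q s < e \<Longrightarrow> q \<notin> J 0 t"
        unfolding eventually_at by auto
      define a where "a = max (s / 2) (s - e / 2)"
      define c where "c = min ((s + t) / 2) (s + e / 2)"
      have ac: "0 < a" "a < s" "s < c" "c < t" using st e by (auto simp: a_def c_def min_less_iff_disj less_max_iff_disj)
      have "jumps \<omega> \<inter> {a<..c} = {}"
      proof (rule ccontr)
        assume "jumps \<omega> \<inter> {a<..c} \<noteq> {}"
        then obtain q where q: "q \<in> jumps \<omega>" "a < q" "q \<le> c" by auto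
        then have "q \<in> J 0 t" "q \<noteq> s" using ac st by (auto simp: J_def)
        moreover have "dist q s < e" using q e by (auto simp: dist_real_def a_def c_def)
        ultimately show False using e by blast
      qed
      then have const: "\<omega> q = \<omega> a" if "q \<in> {a..c}" for q
        using const_no_jumps[OF \<omega> less_imp_le[OF ac(1)] _ that] by blast
      have "\<forall>\<^sub>F q in at s. q \<in> {a<..<c}"
        using ac by (intro eventually_at_in_open') auto
      then show ?thesis
      proof (rule eventually_mono)
        fix q assume q: "q \<in> {a<..<c}"
        have "\<omega> q = \<omega> a" by (rule const) (use q in auto)
        moreover have "\<omega> s = \<omega> a" by (rule const) (use ac in auto)
        moreover have "q \<in> {0..t}" using q ac by auto
        ultimately show "?f q = ?f s" using True by simp
      qed
    next
      case False
      then have "\<forall>\<^sub>F q in at s. q \<in> - {0..t}" by (intro eventually_at_in_open') auto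
      then show ?thesis by (rule eventually_mono) (use False in auto)
    qed
    then show "isCont ?f s" unfolding continuous_at by (rule tendsto_eventually)
  qed
  then have meas: "?f \<in> borel_measurable borel"
    by (rule borel_measurable_continuous_countable_exceptions[rotated]) (auto intro!: countable_finite)
  have "integrable lborel (\<lambda>s. indicator {0..t} s *\<^sub>R wbound)"
    by (intro integrable_scaleR_left integrable_real_indicator) (auto simp: emeasure_lborel_Icc_eq)
  then show ?thesis unfolding set_integrable_def
    by (rule Bochner_Integration.integrable_bound)
       (use meas w_le in \<open>auto simp: indicator_def intro!: always_eventually split: if_splits intro: order_trans[OF w_le abs_ge_self]\<close>)
qed

lemma integrable_w: "0 \<le> a \<Longrightarrow> c \<le> t \<Longrightarrow> (\<lambda>s. w (\<omega> s)) integrable_on {a..c}"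
  by (rule integrable_on_subinterval[OF set_borel_integral_eq_integral(1)[OF set_integrable_w]]) auto

lemma integral_w_le:
  assumes "0 \<le> a" "a \<le> c" "c \<le> t"
  shows "cmod (integral {a..c} (\<lambda>s. w (\<omega> s))) \<le> (c - a) * wbound"
proof -
  have "cmod (integral {a..c} (\<lambda>s. w (\<omega> s))) \<le> integral {a..c} (\<lambda>_. wbound)"
    using assms by (intro integral_norm_bound_integral integrable_w w_le) auto
  then show ?thesis using assms by simp
qed

abbreviation "PHI \<equiv> path_fun w \<Psi> \<omega>"
lemmas PHI_def = path_fun_def

lemma PHI_combine:
  assumes "0 \<le> a" "a \<le> b" "b \<le> c" "c \<le> t"
  shows "PHI a c = PHI a b * PHI b c"
proof -
  have "integral {a..c} (\<lambda>s. w (\<omega> s)) = integral {a..b} (\<lambda>s. w (\<omega> s)) + integral {b..c} (\<lambda>s. w (\<omega> s))"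
    using assms by (intro Henstock_Kurzweil_Integration.integral_combine[symmetric] integrable_w) auto
  moreover have "(\<Prod>s\<in>J a c. \<Psi> (lval \<omega> s) (\<omega> s)) = (\<Prod>s\<in>J a b. \<Psi> (lval \<omega> s) (\<omega> s)) * (\<Prod>s\<in>J b c. \<Psi> (lval \<omega> s) (\<omega> s))"
    using assms unfolding J_union[OF assms(2,3)] by (intro prod.union_disjoint J_disj) auto
  ultimately show ?thesis by (simp add: PHI_def exp_add)
qed

lemma PHI_refl [simp]: "PHI a a = 1"
  by (simp add: PHI_def J_def)

text \<open>What a grid factor omits: the integral over a step that contains a jump.\<close>

definition defect :: "real \<Rightarrow> real \<Rightarrow> complex" where
  "defect a c = (if J a c = {} then 0 else integral {a..c} (\<lambda>s. w (\<omega> s)))"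

abbreviation "gfac \<equiv> step_factor w \<Psi>"
lemmas gfac_def = step_factor_def

text \<open>The factor \<open>card (J a c)\<close> vanishes for steps without jump and is additive
  over steps, so the bounds add up to the mesh times \<open>wbound\<close> times the number of
  jumps.\<close>

lemma defect_le:
  assumes "0 \<le> a" "a \<le> c" "c \<le> t"
  shows "cmod (defect a c) \<le> (c - a) * wbound * card (J a c)"
proof (cases "J a c = {}")
  case False
  then have "1 \<le> card (J a c)" using assms by (simp add: Suc_leI card_gt_0_iff)
  then have "(c - a) * wbound * 1 \<le> (c - a) * wbound * card (J a c)"
    using assms by (intro mult_left_mono) (auto simp: wbound_def intro!: mult_nonneg_nonneg sum_nonneg)
  then show ?thesis using integral_w_le[OF assms] False by (simp add: defect_def)
qed (simp add: defect_def)

text \<open>With at most one jump in the step, the end states differ exactly when there is a jump,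
  because the value at a jump differs from the left limit. Two jumps could lead back to the same
  state.\<close>

lemma grid_factor:
  assumes a: "0 \<le> a" "a < c" "c \<le> t" and one: "J a c = {} \<or> (\<exists>s. J a c = {s})"
  shows "gfac (c - a) (\<omega> a) (\<omega> c) = PHI a c * exp (- defect a c)"
  using one
proof
  assume e: "J a c = {}"
  then have const: "\<omega> s = \<omega> a" if "s \<in> {a..c}" for s
    using const_no_jumps[OF \<omega> a(1) _ that] by (simp add: J_def)
  have "integral {a..c} (\<lambda>s. w (\<omega> s)) = integral {a..c} (\<lambda>_. w (\<omega> a))"
    by (intro integral_cong arg_cong[of _ _ w] const)
  also have "\<dots> = of_real (c - a) * w (\<omega> a)" using a by (simp add: scaleR_conv_of_real)
  finally show ?thesis using const[of c] a e by (simp add: gfac_def PHI_def defect_def)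
next
  assume "\<exists>s. J a c = {s}"
  then obtain s where s: "J a c = {s}" by blast
  then have sj: "s \<in> jumps \<omega>" "a < s" "s \<le> c" by (auto simp: J_def)
  have "jumps \<omega> \<inter> {a<..<s} = {}" using s sj by (auto simp: J_def)
  then have 1: "lval \<omega> s = \<omega> a" using a sj by (intro lval_eq[OF \<omega>]) auto
  have "jumps \<omega> \<inter> {s<..c} = {}" using s sj by (auto simp: J_def)
  then have 2: "\<omega> c = \<omega> s" using a sj by (intro const_no_jumps[OF \<omega>, of s c c]) auto
  have "\<omega> a \<noteq> \<omega> c" using lval_neq[OF \<omega> sj(1)] 1 2 by simp
  then show ?thesis using s 1 2 by (simp add: gfac_def PHI_def defect_def exp_minus)
qed

lemma grid_product:
  assumes h: "0 < h" and one: "\<And>a c. 0 \<le> a \<Longrightarrow> c \<le> t \<Longrightarrow> c - a < d \<Longrightarrow> J a c = {} \<or> (\<exists>s. J a c = {s})"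
    and d: "h < d" and n: "real n * h \<le> t"
  shows "\<exists>e. (\<Prod>j<n. gfac h (\<omega> (real j * h)) (\<omega> (real (Suc j) * h))) = PHI 0 (real n * h) * exp e
    \<and> cmod e \<le> h * wbound * card (J 0 (real n * h))"
  using n
proof (induction n)
  case 0 then show ?case by (auto simp: J_def intro!: exI[of _ 0])
next
  case (Suc n)
  let ?a = "real n * h" and ?c = "real (Suc n) * h"
  have ac: "0 \<le> ?a" "?a < ?c" "?c \<le> t" "?c - ?a = h" using h Suc.prems by (auto simp: algebra_simps)
  obtain e where e: "(\<Prod>j<n. gfac h (\<omega> (real j * h)) (\<omega> (real (Suc j) * h))) = PHI 0 ?a * exp e"
    "cmod e \<le> h * wbound * card (J 0 ?a)" using Suc.IH ac by auto
  have g: "gfac h (\<omega> ?a) (\<omega> ?c) = PHI ?a ?c * exp (- defect ?a ?c)"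
    using grid_factor[OF ac(1-3)] one[OF ac(1,3)] ac(4) d by simp
  have "(\<Prod>j<Suc n. gfac h (\<omega> (real j * h)) (\<omega> (real (Suc j) * h))) = (PHI 0 ?a * PHI ?a ?c) * (exp e * exp (- defect ?a ?c))"
    unfolding prod.lessThan_Suc e(1) g by (simp only: mult_ac)
  also have "\<dots> = PHI 0 ?c * exp (e - defect ?a ?c)"
    using PHI_combine[of 0 ?a ?c] ac by (simp add: exp_add[symmetric])
  finally have 1: "(\<Prod>j<Suc n. gfac h (\<omega> (real j * h)) (\<omega> (real (Suc j) * h))) = PHI 0 ?c * exp (e - defect ?a ?c)" .
  have card: "card (J 0 ?c) = card (J 0 ?a) + card (J ?a ?c)"
    using ac unfolding J_union[OF ac(1) less_imp_le[OF ac(2)]] by (intro card_Un_disjoint J_disj finite_J) auto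
  have "cmod (e - defect ?a ?c) \<le> cmod e + cmod (defect ?a ?c)" by (rule norm_triangle_ineq4)
  also have "\<dots> \<le> h * wbound * card (J 0 ?a) + h * wbound * card (J ?a ?c)"
    using e(2) defect_le[of ?a ?c] ac by (intro add_mono) auto
  finally have "cmod (e - defect ?a ?c) \<le> h * wbound * card (J 0 ?c)"
    unfolding card by (simp add: distrib_left)
  then show ?case using 1 by blast
qed

text \<open>The number of jumps up to \<open>t\<close> is fixed while the mesh tends to 0, so the
  error exponent of \<open>grid_product\<close> disappears.\<close>

lemma grid_limit:
  assumes "0 < t"
  shows "(\<lambda>N. \<Prod>j<N. gfac (t / real N) (\<omega> (real j * (t / real N))) (\<omega> (real (Suc j) * (t / real N)))) \<longlonglongrightarrow> PHI 0 t"
proof -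
  obtain d where d: "0 < d" and one: "\<And>a c. 0 \<le> a \<Longrightarrow> c \<le> t \<Longrightarrow> c - a < d \<Longrightarrow> J a c = {} \<or> (\<exists>s. J a c = {s})"
    using jump_gap by blast
  have h0: "(\<lambda>N. t / real N) \<longlonglongrightarrow> 0" by real_asymp
  have good: "\<forall>\<^sub>F N in sequentially. 0 < N \<and> t / real N < d"
    using eventually_gt_at_top[of 0] order_tendstoD(2)[OF h0 d] by eventually_elim auto
  let ?P = "\<lambda>N. \<Prod>j<N. gfac (t / real N) (\<omega> (real j * (t / real N))) (\<omega> (real (Suc j) * (t / real N)))"
  let ?Q = "\<lambda>N e. ?P N = PHI 0 t * exp e \<and> cmod e \<le> t / real N * wbound * card (J 0 t)"
  define e where "e N = (SOME e. ?Q N e)" for N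
  have e: "\<forall>\<^sub>F N in sequentially. ?Q N (e N)"
    using good
  proof eventually_elim
    case (elim N)
    have "\<exists>e. ?Q N e" using grid_product[of "t / real N" d N] one elim assms by auto
    then show ?case unfolding e_def by (rule someI_ex)
  qed
  have "e \<longlonglongrightarrow> 0"
  proof (rule Lim_null_comparison)
    show "\<forall>\<^sub>F N in sequentially. norm (e N) \<le> t / real N * wbound * card (J 0 t)"
      using e by eventually_elim auto
    show "(\<lambda>N. t / real N * wbound * card (J 0 t)) \<longlonglongrightarrow> 0"
      using tendsto_mult_right[OF tendsto_mult_right[OF h0, of wbound], of "real (card (J 0 t))"] by simp
  qed
  then have "(\<lambda>N. PHI 0 t * exp (e N)) \<longlonglongrightarrow> PHI 0 t * exp 0" by (intro tendsto_intros)
  moreover have "\<forall>\<^sub>F N in sequentially. PHI 0 t * exp (e N) = ?P N"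
    using e by eventually_elim auto
  ultimately show ?thesis by (simp add: Lim_transform_eventually)
qed

end

text \<open>The recursion by \<open>Inf\<close> is matched with the counting function: the
  \<open>k\<close>-th jump time is where the number of jumps reaches \<open>k\<close>. The infimum
  is a minimum because finitely many jumps lie before \<open>t\<close>, and later ones are
  larger.\<close>

lemma jump_time_props:
  assumes "k \<le> card (J 0 t)"
  shows "0 \<le> jump_time \<omega> k \<and> jump_time \<omega> k \<le> t \<and> card (J 0 (jump_time \<omega> k)) = k \<and>
    (0 < k \<longrightarrow> jump_time \<omega> k \<in> J 0 t \<and> jump_time \<omega> (k - 1) < jump_time \<omega> k \<and>
      lval \<omega> (jump_time \<omega> k) = \<omega> (jump_time \<omega> (k - 1)))"
  using assms
proof (induction k)
  case 0 then show ?case using t by (simp add: J_def)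
next
  case (Suc k)
  let ?r = "jump_time \<omega> k"
  have IH: "0 \<le> ?r" "?r \<le> t" "card (J 0 ?r) = k" using Suc by auto
  have "J ?r t \<noteq> {}"
  proof
    assume "J ?r t = {}"
    then have "J 0 t = J 0 ?r" using J_union[OF IH(1,2)] by simp
    then show False using IH Suc.prems by simp
  qed
  define s where "s = Min (J ?r t)"
  have s: "s \<in> J ?r t" "\<And>q. q \<in> J ?r t \<Longrightarrow> s \<le> q"
    using \<open>J ?r t \<noteq> {}\<close> by (auto simp: s_def)
  then have sr: "?r < s" "s \<le> t" "s \<in> jumps \<omega>" by (auto simp: J_def)
  have eq: "jump_time \<omega> (Suc k) = s"
  proof (simp, rule cInf_eq_minimum)
    show "s \<in> {s \<in> jumps \<omega>. ?r < s}" using sr by simp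
    fix q assume "q \<in> {s \<in> jumps \<omega>. ?r < s}"
    then show "s \<le> q" using s(2)[of q] sr by (cases "q \<le> t") (auto simp: J_def)
  qed
  have none: "jumps \<omega> \<inter> {?r<..<s} = {}" using s(2) sr by (force simp: J_def)
  have "J 0 s = insert s (J 0 ?r)"
  proof -
    have "J ?r s = {s}" using none sr by (auto simp: J_def)
    then show ?thesis using J_union[of 0 ?r s] IH sr by auto
  qed
  moreover have "s \<notin> J 0 ?r" using sr by (auto simp: J_def)
  ultimately have "card (J 0 s) = Suc k" using IH by simp
  moreover have "lval \<omega> s = \<omega> ?r" by (rule lval_eq[OF \<omega> IH(1) sr(1) none])
  ultimately show ?case unfolding eq using IH sr by (auto simp: J_def)
qed

text \<open>The counting function is a left inverse of \<open>jump_time\<close>; surjectivity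
  follows by comparing cardinalities.\<close>

lemma jump_time_bij: "bij_betw (jump_time \<omega>) {1..card (J 0 t)} (J 0 t)"
proof -
  have inj: "inj_on (jump_time \<omega>) {1..card (J 0 t)}"
    by (rule inj_on_inverseI[of _ "\<lambda>s. card (J 0 s)"]) (use jump_time_props in auto)
  moreover have "jump_time \<omega> ` {1..card (J 0 t)} \<subseteq> J 0 t" using jump_time_props by auto
  then have "jump_time \<omega> ` {1..card (J 0 t)} = J 0 t"
    using card_image[OF inj] by (intro card_subset_eq) auto
  ultimately show ?thesis by (simp add: bij_betw_def)
qed

lemma num_jumps_eq: "num_jumps t \<omega> = enat (card (J 0 t))"
  using finite_jumps by (simp add: num_jumps_def J_0)

lemma prod_jump_times:
  "(\<Prod>n=1..card (J 0 t). \<Psi> (\<omega> (jump_time \<omega> (n - 1))) (\<omega> (jump_time \<omega> n))) = (\<Prod>s\<in>J 0 t. \<Psi> (lval \<omega> s) (\<omega> s))"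
proof -
  have "(\<Prod>s\<in>J 0 t. \<Psi> (lval \<omega> s) (\<omega> s)) = (\<Prod>n=1..card (J 0 t). \<Psi> (lval \<omega> (jump_time \<omega> n)) (\<omega> (jump_time \<omega> n)))"
    by (rule prod.reindex_bij_betw[OF jump_time_bij, symmetric])
  also have "\<dots> = (\<Prod>n=1..card (J 0 t). \<Psi> (\<omega> (jump_time \<omega> (n - 1))) (\<omega> (jump_time \<omega> n)))"
    using jump_time_props by (intro prod.cong) auto
  finally show ?thesis ..
qed

end

text \<open>Counting changes of state along grids makes it a measurable property of a path to have
  finitely many jumps.\<close>

definition changes :: "(real \<Rightarrow> 'b) \<Rightarrow> real \<Rightarrow> nat \<Rightarrow> nat" where
  "changes \<omega> t N = card {j. j < N \<and> \<omega> (real j * (t / real N)) \<noteq> \<omega> (real (Suc j) * (t / real N))}"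

text \<open>A step whose end states differ contains a jump, and different steps contain different
  jumps.\<close>

lemma (in kpath) changes_le:
  assumes "0 < t"
  shows "changes \<omega> t N \<le> card (J 0 t)"
proof (cases "N = 0")
  case False
  let ?h = "t / real N"
  let ?I = "{j. j < N \<and> \<omega> (real j * ?h) \<noteq> \<omega> (real (Suc j) * ?h)}"
  have h: "0 < ?h" "real N * ?h = t" using False assms by auto
  have "J (real j * ?h) (real (Suc j) * ?h) \<noteq> {}" if "j \<in> ?I" for j
  proof
    assume "J (real j * ?h) (real (Suc j) * ?h) = {}"
    moreover have "0 \<le> real j * ?h" by (intro mult_nonneg_nonneg of_nat_0_le_iff less_imp_le[OF h(1)])
    moreover have "real j * ?h \<le> real (Suc j) * ?h" by (rule mult_right_mono) (simp, rule less_imp_le[OF h(1)])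
    ultimately have "\<omega> (real (Suc j) * ?h) = \<omega> (real j * ?h)"
      by (intro const_no_jumps[OF \<omega>, of "real j * ?h" "real (Suc j) * ?h"]) (auto simp: J_def)
    then show False using that by auto
  qed
  then have "\<forall>j\<in>?I. \<exists>s. s \<in> J (real j * ?h) (real (Suc j) * ?h)" by blast
  from bchoice[OF this] obtain f where f: "\<And>j. j \<in> ?I \<Longrightarrow> f j \<in> J (real j * ?h) (real (Suc j) * ?h)" by blast
  have "inj_on f ?I"
  proof (rule linorder_inj_onI)
    fix i j assume ij: "i < j" "i \<in> ?I" "j \<in> ?I"
    have "real (Suc i) * ?h \<le> real j * ?h" by (rule mult_right_mono) (use ij in simp, rule less_imp_le[OF h(1)])
    moreover have "f i \<le> real (Suc i) * ?h" "real j * ?h < f j"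
      using f[OF ij(2)] f[OF ij(3)] by (simp_all only: J_def Int_iff greaterThanAtMost_iff)
    ultimately show "f i \<noteq> f j" by linarith
  qed auto
  moreover have "f ` ?I \<subseteq> J 0 t"
  proof
    fix s assume "s \<in> f ` ?I"
    then obtain j where j: "j \<in> ?I" "s = f j" by auto
    have "real (Suc j) * ?h \<le> real N * ?h" by (rule mult_right_mono) (use j in simp, rule less_imp_le[OF h(1)])
    then have "real (Suc j) * ?h \<le> t" unfolding h(2) .
    moreover have "0 \<le> real j * ?h" by (intro mult_nonneg_nonneg of_nat_0_le_iff less_imp_le[OF h(1)])
    moreover have "f j \<in> jumps \<omega>" "real j * ?h < f j" "f j \<le> real (Suc j) * ?h"
      using f[OF j(1)] by (simp_all only: J_def Int_iff greaterThanAtMost_iff)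
    ultimately show "s \<in> J 0 t" unfolding j(2) J_def by simp
  qed
  ultimately show ?thesis unfolding changes_def by (intro card_inj_on_le) auto
qed (simp add: changes_def)

text \<open>Of infinitely many jumps, take one more than \<open>n\<close>. Once the mesh is below
  their mutual distances they fall into different steps, and near each of them a vertex tells the
  two sides apart.\<close>

lemma changes_unbounded:
  assumes \<omega>: "\<omega> \<in> paths" and t: "0 < t" and inf: "infinite (jumps \<omega> \<inter> {..t})"
  shows "\<exists>N. n < changes \<omega> t N"
proof -
  obtain T where T: "finite T" "card T = Suc n" "T \<subseteq> jumps \<omega> \<inter> {..t}"
    using infinite_arbitrarily_large[OF inf] by blast
  \<comment> \<open>Number of the step containing \<open>s\<close>; steps are open on the left, so a
    jump at a grid time belongs to the step that ends there.\<close>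
  define idx where "idx N s = nat \<lceil>s / (t / real N)\<rceil> - 1" for N s
  have idx: "real (idx N s) * (t / real N) < s" "s \<le> real (Suc (idx N s)) * (t / real N)"
    "s - t / real N \<le> real (idx N s) * (t / real N)" "real (Suc (idx N s)) * (t / real N) < s + t / real N"
    "idx N s < N" if s: "s \<in> T" and N: "0 < N" for N s
  proof -
    let ?h = "t / real N"
    have h: "0 < ?h" using t N by simp
    have st: "0 < s" "s \<le> t" using s T by (auto simp: jumps_def)
    have "0 < s / ?h" by (rule divide_pos_pos[OF st(1) h])
    then have i: "real (idx N s) < s / ?h" "s / ?h \<le> real (Suc (idx N s))" unfolding idx_def by linarith+
    then show 1: "real (idx N s) * ?h < s" "s \<le> real (Suc (idx N s)) * ?h"
      using h by (simp_all only: pos_less_divide_eq pos_divide_le_eq)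
    moreover have "real (Suc (idx N s)) * ?h = ?h + real (idx N s) * ?h"
      by (simp only: of_nat_Suc distrib_right mult_1_left)
    ultimately show "s - ?h \<le> real (idx N s) * ?h" "real (Suc (idx N s)) * ?h < s + ?h"
      by linarith+
    have "real (idx N s) * ?h < real N * ?h" using 1 st N by simp
    then show "idx N s < N" using h by (simp only: mult_less_cancel_right_pos of_nat_less_iff)
  qed
  have h0: "(\<lambda>N. t / real N) \<longlonglongrightarrow> 0" by real_asymp
  have ch: "\<forall>\<^sub>F N in sequentially. \<forall>s\<in>T. \<omega> (real (idx N s) * (t / real N)) \<noteq> \<omega> (real (Suc (idx N s)) * (t / real N))"
  proof (intro eventually_ball_finite T(1) ballI)
    fix s assume s: "s \<in> T"
    then have st: "0 < s" "s \<in> jumps \<omega>" using T by (auto simp: jumps_def)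
    \<comment> \<open>The left limit or the value may be the point at infinity, near which the path
      need not be constant; one vertex \<open>z\<close> separating the two is enough.\<close>
    obtain z where z: "(lval \<omega> s = Some z) \<noteq> (\<omega> s = Some z)"
      using lval_neq[OF \<omega> st(2)] option_eqI by metis
    obtain e where e: "e < s" "\<And>q. e < q \<Longrightarrow> q < s \<Longrightarrow> (\<omega> q = Some z) = (lval \<omega> s = Some z)"
      using path_left[OF \<omega> st(1), of z] unfolding eventually_at_left_field by auto
    obtain d where d: "s < d" "\<And>q. s < q \<Longrightarrow> q < d \<Longrightarrow> (\<omega> q = Some z) = (\<omega> s = Some z)"
      using path_right[OF \<omega> less_imp_le[OF st(1)], of z] unfolding eventually_at_right_field by auto
    have "\<forall>\<^sub>F N in sequentially. t / real N < min (s - e) (d - s)"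
      by (rule order_tendstoD(2)[OF h0]) (use e d in auto)
    with eventually_gt_at_top[of 0]
    show "\<forall>\<^sub>F N in sequentially. \<omega> (real (idx N s) * (t / real N)) \<noteq> \<omega> (real (Suc (idx N s)) * (t / real N))"
    proof eventually_elim
      case (elim N)
      note i = idx[OF s elim(1)]
      let ?a = "real (idx N s) * (t / real N)" and ?c = "real (Suc (idx N s)) * (t / real N)"
      have "(\<omega> ?a = Some z) = (lval \<omega> s = Some z)" using i(1,3) elim(2) by (intro e(2)) auto
      moreover have "(\<omega> ?c = Some z) = (\<omega> s = Some z)"
      proof (cases "?c = s")
        case False
        then show ?thesis using i(2,4) elim(2) by (intro d(2)) auto
      qed simp
      ultimately show ?case using z by auto
    qed
  qed
  obtain g where g: "0 < g" "\<And>r s. r \<in> T \<Longrightarrow> s \<in> T \<Longrightarrow> r \<noteq> s \<Longrightarrow> g \<le> \<bar>r - s\<bar>"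
  proof
    let ?D = "insert 1 ((\<lambda>(r, s). \<bar>r - s\<bar>) ` {(r, s). r \<in> T \<and> s \<in> T \<and> r \<noteq> s})"
    have "finite {(r, s). r \<in> T \<and> s \<in> T \<and> r \<noteq> s}"
      by (rule finite_subset[of _ "T \<times> T"]) (use T in auto)
    then have fin: "finite ?D" by simp
    show "0 < Min ?D" using fin by (subst Min_gr_iff) auto
    show "Min ?D \<le> \<bar>r - s\<bar>" if "r \<in> T" "s \<in> T" "r \<noteq> s" for r s
      using fin that by (intro Min_le) auto
  qed
  have "\<forall>\<^sub>F N in sequentially. t / real N < g" by (rule order_tendstoD(2)[OF h0 g(1)])
  with eventually_gt_at_top[of 0] ch have "\<forall>\<^sub>F N in sequentially. Suc n \<le> changes \<omega> t N"
  proof eventually_elim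
    case (elim N)
    have "inj_on (idx N) T"
    proof (rule inj_onI, rule ccontr)
      fix r s assume rs: "r \<in> T" "s \<in> T" "idx N r = idx N s" "r \<noteq> s"
      have "\<bar>r - s\<bar> < t / real N"
        using idx[OF rs(1) elim(1)] idx[OF rs(2) elim(1)] unfolding rs(3) by auto
      then show False using g(2)[OF rs(1,2,4)] elim by simp
    qed
    moreover have "idx N ` T \<subseteq> {j. j < N \<and> \<omega> (real j * (t / real N)) \<noteq> \<omega> (real (Suc j) * (t / real N))}"
      using elim idx(5) by auto
    ultimately have "card T \<le> changes \<omega> t N" unfolding changes_def by (intro card_inj_on_le) auto
    then show ?case using T by simp
  qed
  then obtain N where "Suc n \<le> changes \<omega> t N" using eventually_happens'[OF sequentially_bot] by blast
  then show ?thesis by (intro exI[of _ N]) simp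
qed

lemma finite_jumps_iff_changes:
  assumes "\<omega> \<in> paths" "0 < t"
  shows "finite (jumps \<omega> \<inter> {..t}) \<longleftrightarrow> (\<exists>n. \<forall>N. changes \<omega> t N \<le> n)"
proof
  assume "finite (jumps \<omega> \<inter> {..t})"
  then interpret kpath \<omega> t using assms by unfold_locales auto
  show "\<exists>n. \<forall>N. changes \<omega> t N \<le> n" using changes_le[OF assms(2)] by blast
next
  assume "\<exists>n. \<forall>N. changes \<omega> t N \<le> n"
  then show "finite (jumps \<omega> \<inter> {..t})" using changes_unbounded[OF assms] by (metis not_le)
qed

section \<open>Products of matrices with equal first order expansion\<close>

text \<open>Row \<open>x\<close> of the \<open>n\<close>-th power of \<open>M\<close> as a matrix on
  \<open>K\<close>.\<close>

primrec lit :: "'a set \<Rightarrow> ('a \<Rightarrow> 'a \<Rightarrow> complex) \<Rightarrow> 'a \<Rightarrow> nat \<Rightarrow> 'a \<Rightarrow> complex" where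
  "lit K M x 0 z = (if z = x then 1 else 0)"
| "lit K M x (Suc n) z = (\<Sum>w\<in>K. lit K M x n w * M w z)"

text \<open>Consistency and stability: \<open>M\<close> and \<open>V\<close> agree to first order,
  so a step of length \<open>h\<close> costs \<open>h * \<eta> h\<close> with \<eta> tending to 0;
  row sums of at most \<open>1 + c * h\<close> let errors grow by at most
  \<open>exp (c * t)\<close>; and there are \<open>t / h\<close> steps.\<close>

lemma matrix_limit:
  fixes M V :: "real \<Rightarrow> 'a \<Rightarrow> 'a \<Rightarrow> complex"
  assumes K: "finite K" and x: "x \<in> K" and y: "y \<in> K" and t: "0 < t"
    and V0: "\<And>z. z \<in> K \<Longrightarrow> V 0 x z = (if z = x then 1 else 0)"
    and Vadd: "\<And>s h z. 0 \<le> s \<Longrightarrow> 0 \<le> h \<Longrightarrow> z \<in> K \<Longrightarrow> V (s + h) x z = (\<Sum>w\<in>K. V s x w * V h w z)"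
    and dV: "\<And>w z. w \<in> K \<Longrightarrow> z \<in> K \<Longrightarrow> ((\<lambda>h. (V h w z - (if z = w then 1 else 0)) /\<^sub>R h) \<longlongrightarrow> G w z) (at_right 0)"
    and dM: "\<And>w z. w \<in> K \<Longrightarrow> z \<in> K \<Longrightarrow> ((\<lambda>h. (M h w z - (if z = w then 1 else 0)) /\<^sub>R h) \<longlongrightarrow> G w z) (at_right 0)"
    and U: "\<And>s. s \<in> {0..t} \<Longrightarrow> (\<Sum>w\<in>K. cmod (V s x w)) \<le> U"
  shows "(\<lambda>N. lit K (M (t / real N)) x N y) \<longlonglongrightarrow> V t x y"
proof -
  \<comment> \<open>Summing over all rows bounds each of them; the 1 is slack for replacing the
    difference quotient of \<open>M\<close> by its limit \<open>G w z\<close> at small mesh.\<close>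
  define c where "c = (\<Sum>w\<in>K. \<Sum>z\<in>K. cmod (G w z) + 1)"
  define \<eta> where "\<eta> h = (\<Sum>w\<in>K. \<Sum>z\<in>K. cmod ((M h w z - V h w z) /\<^sub>R h))" for h
  have "0 \<le> (\<Sum>w\<in>K. cmod (V 0 x w))" by (intro sum_nonneg) auto
  then have U0: "0 \<le> U" using U[of 0] t by simp
  have c0: "0 \<le> c" unfolding c_def by (intro sum_nonneg) auto
  have h_lim: "filterlim (\<lambda>N. t / real N) (at_right 0) sequentially"
    using t by real_asymp
  have rows: "\<forall>\<^sub>F h in at_right 0. \<forall>w\<in>K. \<forall>z\<in>K. cmod (M h w z - (if z = w then 1 else 0)) \<le> h * (cmod (G w z) + 1)"
  proof (intro eventually_ball_finite K ballI)
    fix w z assume wz: "w \<in> K" "z \<in> K"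
    have "\<forall>\<^sub>F h in at_right 0. cmod ((M h w z - (if z = w then 1 else 0)) /\<^sub>R h) < cmod (G w z) + 1"
      by (rule order_tendstoD(2)[OF tendsto_norm[OF dM[OF wz]]]) simp
    moreover have "\<forall>\<^sub>F h in at_right (0::real). 0 < h" by (auto simp: eventually_at_filter)
    ultimately show "\<forall>\<^sub>F h in at_right 0. cmod (M h w z - (if z = w then 1 else 0)) \<le> h * (cmod (G w z) + 1)"
    proof eventually_elim
      case (elim h)
      then have "inverse h * cmod (M h w z - (if z = w then 1 else 0)) \<le> cmod (G w z) + 1" by simp
      then show ?case using elim by (simp add: field_simps)
    qed
  qed
  have row_sum: "\<forall>\<^sub>F h in at_right 0. \<forall>w\<in>K. (\<Sum>z\<in>K. cmod (M h w z)) \<le> 1 + c * h"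
    using rows eventually_at_right_less[of "0::real"]
  proof eventually_elim
    case (elim h)
    show ?case
    proof
      fix w assume w: "w \<in> K"
      have "(\<Sum>z\<in>K. cmod (M h w z)) \<le> (\<Sum>z\<in>K. (if z = w then 1 else 0) + h * (cmod (G w z) + 1))"
      proof (rule sum_mono)
        fix z assume z: "z \<in> K"
        have "cmod (M h w z) \<le> cmod (if z = w then 1 else 0) + cmod (M h w z - (if z = w then 1 else 0))"
          by (rule norm_triangle_sub)
        then show "cmod (M h w z) \<le> (if z = w then 1 else 0) + h * (cmod (G w z) + 1)"
          using elim w z by (smt (verit, best) norm_one norm_zero)
      qed
      also have "\<dots> = 1 + h * (\<Sum>z\<in>K. cmod (G w z) + 1)"
        using K w by (subst sum.distrib) (simp add: sum_distrib_left[symmetric])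
      also have "\<dots> \<le> 1 + h * c"
        unfolding c_def using elim K w
        by (intro add_left_mono mult_left_mono member_le_sum[of w K "\<lambda>w. \<Sum>z\<in>K. cmod (G w z) + 1"]) (auto intro!: sum_nonneg)
      finally show "(\<Sum>z\<in>K. cmod (M h w z)) \<le> 1 + c * h" by (simp add: mult.commute)
    qed
  qed
  have eta: "(\<eta> \<longlongrightarrow> 0) (at_right 0)"
  proof -
    have "((\<lambda>h. cmod ((M h w z - V h w z) /\<^sub>R h)) \<longlongrightarrow> 0) (at_right 0)" if "w \<in> K" "z \<in> K" for w z
    proof -
      have "((\<lambda>h. cmod ((M h w z - (if z = w then 1 else 0)) /\<^sub>R h - (V h w z - (if z = w then 1 else 0)) /\<^sub>R h)) \<longlongrightarrow> cmod (G w z - G w z)) (at_right 0)"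
        by (intro tendsto_intros dM dV that)
      then show ?thesis by (simp add: scaleR_diff_right[symmetric])
    qed
    then have "((\<lambda>h. \<eta> h) \<longlongrightarrow> (\<Sum>w\<in>K. \<Sum>z\<in>K. 0)) (at_right 0)" unfolding \<eta>_def
      by (intro tendsto_sum)
    then show ?thesis by simp
  qed
  have err: "(\<Sum>z\<in>K. cmod (lit K (M h) x n z - V (real n * h) x z)) \<le> real n * (U * (h * \<eta> h)) * (1 + c * h) ^ n"
    if h: "0 < h" and rs: "\<forall>w\<in>K. (\<Sum>z\<in>K. cmod (M h w z)) \<le> 1 + c * h" and n: "real n * h \<le> t" for h n
    using n
  proof (induction n)
    case 0 then show ?case by (simp add: V0)
  next
    case (Suc n)
    let ?r = "lit K (M h) x n" and ?\<rho> = "V (real n * h) x"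
    have le: "real n * h \<le> t" using Suc.prems h by (simp add: algebra_simps)
    have eta0: "0 \<le> \<eta> h" unfolding \<eta>_def by (intro sum_nonneg) auto
    have ge1: "1 \<le> 1 + c * h" using c0 h by simp
    \<comment> \<open>Telescoping: the old error is propagated by \<open>M\<close>, and the exact
      row meets the one-step discrepancy of \<open>M\<close> and \<open>V\<close>.\<close>
    have split: "lit K (M h) x (Suc n) z - V (real (Suc n) * h) x z =
      (\<Sum>w\<in>K. (?r w - ?\<rho> w) * M h w z) + (\<Sum>w\<in>K. ?\<rho> w * (M h w z - V h w z))" if "z \<in> K" for z
      using Vadd[of "real n * h" h z] h that
      by (simp add: algebra_simps sum.distrib sum_subtractf)
    have "(\<Sum>z\<in>K. cmod (lit K (M h) x (Suc n) z - V (real (Suc n) * h) x z)) \<le>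
      (\<Sum>z\<in>K. (\<Sum>w\<in>K. cmod (?r w - ?\<rho> w) * cmod (M h w z)) + (\<Sum>w\<in>K. cmod (?\<rho> w) * cmod (M h w z - V h w z)))"
    proof (rule sum_mono)
      fix z assume z: "z \<in> K"
      show "cmod (lit K (M h) x (Suc n) z - V (real (Suc n) * h) x z) \<le>
        (\<Sum>w\<in>K. cmod (?r w - ?\<rho> w) * cmod (M h w z)) + (\<Sum>w\<in>K. cmod (?\<rho> w) * cmod (M h w z - V h w z))"
        unfolding split[OF z] norm_mult[symmetric]
        by (intro order_trans[OF norm_triangle_ineq] add_mono norm_sum)
    qed
    also have "\<dots> = (\<Sum>w\<in>K. cmod (?r w - ?\<rho> w) * (\<Sum>z\<in>K. cmod (M h w z))) + (\<Sum>w\<in>K. cmod (?\<rho> w) * (\<Sum>z\<in>K. cmod (M h w z - V h w z)))"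
      unfolding sum.distrib sum_distrib_left by (intro arg_cong2[of _ _ _ _ "(+)"] sum.swap)
    also have "\<dots> \<le> (\<Sum>w\<in>K. cmod (?r w - ?\<rho> w) * (1 + c * h)) + (\<Sum>w\<in>K. cmod (?\<rho> w) * (h * \<eta> h))"
    proof (intro add_mono sum_mono mult_left_mono)
      fix w assume w: "w \<in> K"
      show "(\<Sum>z\<in>K. cmod (M h w z)) \<le> 1 + c * h" using rs w by blast
      have "(\<Sum>z\<in>K. cmod (M h w z - V h w z)) = h * (\<Sum>z\<in>K. cmod ((M h w z - V h w z) /\<^sub>R h))"
        using h by (simp add: sum_distrib_left mult.assoc[symmetric])
      also have "\<dots> \<le> h * \<eta> h" unfolding \<eta>_def using h K w
        by (intro mult_left_mono member_le_sum[of w K "\<lambda>w. \<Sum>z\<in>K. cmod ((M h w z - V h w z) /\<^sub>R h)"]) (auto intro!: sum_nonneg)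
      finally show "(\<Sum>z\<in>K. cmod (M h w z - V h w z)) \<le> h * \<eta> h" .
    qed auto
    also have "\<dots> = (\<Sum>w\<in>K. cmod (?r w - ?\<rho> w)) * (1 + c * h) + (\<Sum>w\<in>K. cmod (?\<rho> w)) * (h * \<eta> h)"
      by (simp add: sum_distrib_right)
    also have "\<dots> \<le> real n * (U * (h * \<eta> h)) * (1 + c * h) ^ n * (1 + c * h) + U * (h * \<eta> h) * (1 + c * h) ^ Suc n"
    proof (intro add_mono mult_right_mono)
      show "(\<Sum>w\<in>K. cmod (?r w - ?\<rho> w)) \<le> real n * (U * (h * \<eta> h)) * (1 + c * h) ^ n" using Suc.IH le by simp
      show "0 \<le> 1 + c * h" using ge1 by simp
      have "(\<Sum>w\<in>K. cmod (?\<rho> w)) * (h * \<eta> h) \<le> U * (h * \<eta> h)"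
        using h eta0 le by (intro mult_right_mono U) auto
      also have "\<dots> \<le> U * (h * \<eta> h) * (1 + c * h) ^ Suc n"
        using mult_left_mono[OF one_le_power[OF ge1, of "Suc n"], of "U * (h * \<eta> h)"] U0 h eta0 by simp
      finally show "(\<Sum>w\<in>K. cmod (?\<rho> w)) * (h * \<eta> h) \<le> U * (h * \<eta> h) * (1 + c * h) ^ Suc n" .
    qed
    also have "\<dots> = real (Suc n) * (U * (h * \<eta> h)) * (1 + c * h) ^ Suc n" by (simp add: algebra_simps)
    finally show ?case .
  qed
  have "(\<lambda>N. lit K (M (t / real N)) x N y - V t x y) \<longlonglongrightarrow> 0"
  proof (rule Lim_null_comparison)
    have "\<forall>\<^sub>F N in sequentially. \<forall>w\<in>K. (\<Sum>z\<in>K. cmod (M (t / real N) w z)) \<le> 1 + c * (t / real N)"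
      using h_lim row_sum unfolding filterlim_iff by blast
    with eventually_gt_at_top[of 0]
    show "\<forall>\<^sub>F N in sequentially. norm (lit K (M (t / real N)) x N y - V t x y) \<le> t * U * \<eta> (t / real N) * exp (c * t)"
    proof eventually_elim
      case (elim N)
      let ?h = "t / real N"
      have h: "0 < ?h" "real N * ?h = t" using elim t by auto
      have eta0: "0 \<le> \<eta> ?h" unfolding \<eta>_def by (intro sum_nonneg) auto
      have "norm (lit K (M ?h) x N y - V t x y) \<le> (\<Sum>z\<in>K. cmod (lit K (M ?h) x N z - V (real N * ?h) x z))"
        using K y unfolding h(2) by (intro member_le_sum[of y K "\<lambda>z. cmod (lit K (M ?h) x N z - V t x z)"]) auto
      also have "\<dots> \<le> real N * (U * (?h * \<eta> ?h)) * (1 + c * ?h) ^ N"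
        using err[OF h(1), of N] elim h by simp
      also have "real N * (U * (?h * \<eta> ?h)) = real N * ?h * U * \<eta> ?h" by (simp only: mult_ac)
      also have "\<dots> = t * U * \<eta> ?h" unfolding h(2) ..
      also have "t * U * \<eta> ?h * (1 + c * ?h) ^ N \<le> t * U * \<eta> ?h * exp (c * t)"
      proof (rule mult_left_mono)
        have "(1 + c * ?h) ^ N \<le> exp (c * ?h) ^ N"
        proof (intro power_mono exp_ge_add_one_self)
          have "0 \<le> c * ?h" by (intro mult_nonneg_nonneg c0 less_imp_le[OF h(1)])
          then show "0 \<le> 1 + c * ?h" by linarith
        qed
        also have "\<dots> = exp (c * (real N * ?h))"
          unfolding exp_of_nat_mult[symmetric] by (simp only: mult.left_commute)
        also have "\<dots> = exp (c * t)" unfolding h(2) ..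
        finally show "(1 + c * ?h) ^ N \<le> exp (c * t)" .
      qed (use t U0 eta0 in auto)
      finally show ?case .
    qed
    have "(\<lambda>N. t * U * \<eta> (t / real N) * exp (c * t)) \<longlonglongrightarrow> t * U * 0 * exp (c * t)"
      by (intro tendsto_intros filterlim_compose[OF eta h_lim])
    then show "(\<lambda>N. t * U * \<eta> (t / real N) * exp (c * t)) \<longlonglongrightarrow> 0" by simp
  qed
  then show ?thesis by (simp add: LIM_zero_iff)
qed

section \<open>Evolution operators of the graph\<close>

context graph
begin

text \<open>Undoes the symmetrisation: \<open>ratio w z\<close> times a matrix entry on
  \<open>ell2\<close> is the integral kernel times \<open>m z\<close>, the form in which transition
  probabilities occur. It is a cocycle, hence compatible with matrix products.\<close>

definition ratio :: "'a \<Rightarrow> 'a \<Rightarrow> complex" where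
  "ratio w z = of_real (sqrt (m z) / sqrt (m w))"

lemma ratio_refl [simp]: "ratio w w = 1"
  by (simp add: ratio_def)

lemma ratio_mult: "ratio x w * ratio w z = ratio x z"
  unfolding ratio_def of_real_mult[symmetric] by simp

lemma weighted_evolution_kop:
  assumes "bounded_kernel C (kern (\<lambda>_ _. 1))" "\<And>x y. cmod (\<psi> x y) \<le> 1" "\<And>x. Re (\<phi> x) \<le> 0"
  shows "weighted_evolution \<phi> (kop (kern \<psi>)) C m"
proof -
  have bk: "bounded_kernel C (kern \<psi>)" by (rule bounded_kern[OF assms(1,2)])
  have C: "0 \<le> C" using bk by (simp add: bounded_kernel_def)
  show ?thesis
    by (intro weighted_evolution.intro evolution.intro weight_axioms assms(3) C
        bounded_linear_kop[OF bk] norm_kop_le[OF bk] kop_cs[OF bk])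
qed

lemma V_expansion:
  assumes bk: "bounded_kernel C (kern (\<lambda>_ _. 1))" and \<psi>: "\<And>x y. cmod (\<psi> x y) \<le> 1" and \<phi>: "\<And>x. Re (\<phi> x) \<le> 0"
  shows "((\<lambda>h. (ratio w z * coord (evolution.V \<phi> (kop (kern \<psi>)) h (unitv z)) w - (if z = w then 1 else 0)) /\<^sub>R h)
     \<longlongrightarrow> ratio w z * ((if z = w then \<phi> w else 0) + kern \<psi> w z)) (at_right 0)"
proof -
  interpret weighted_evolution \<phi> "kop (kern \<psi>)" C m by (rule weighted_evolution_kop[OF bk \<psi> \<phi>])
  have "((\<lambda>h. coord (V h (unitv z)) w) has_vector_derivative
      (\<phi> w * coord (unitv z) w + coord (kop (kern \<psi>) (unitv z)) w)) (at_right 0)"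
    using V_derivative[of 0 "unitv z" w] by (simp add: at_within_Ici_at_right)
  from has_vector_derivative_at_right_0[OF this] have "((\<lambda>h. ratio w z * ((coord (V h (unitv z)) w - coord (unitv z) w) /\<^sub>R h))
      \<longlongrightarrow> ratio w z * (\<phi> w * coord (unitv z) w + kern \<psi> w z)) (at_right 0)"
    unfolding coord_kop_unitv[OF bounded_kern[OF bk \<psi>]] V_0 by (intro tendsto_intros)
  moreover have "ratio w z * (\<phi> w * coord (unitv z) w + kern \<psi> w z) = ratio w z * ((if z = w then \<phi> w else 0) + kern \<psi> w z)"
    by simp
  moreover have "ratio w z * ((coord (V h (unitv z)) w - coord (unitv z) w) /\<^sub>R h) =
      (ratio w z * coord (V h (unitv z)) w - (if z = w then 1 else 0)) /\<^sub>R h" for h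
    by (auto simp: right_diff_distrib)
  ultimately show ?thesis by (simp only:)
qed

end

context magnetic_graph
begin

text \<open>Serves the heat semigroup with \<open>c0 = -1\<close> and the unitary group with
  \<open>c0 = - \<i>\<close>; modulus 1 preserves the kernel bound and allows division by
  \<open>c0\<close>.\<close>

lemma scale_magnetic_op:
  assumes c0: "cmod c0 = 1" and ev: "weighted_evolution (\<lambda>x. c0 * of_real (v x + deg x)) (kop (kern (\<lambda>x y. - c0 * phase \<theta> x y))) C' m"
  shows "scale_op c0 (magnetic_op b m v \<theta>) =
    weighted_evolution.evol_op (\<lambda>x. c0 * of_real (v x + deg x)) (kop (kern (\<lambda>x y. - c0 * phase \<theta> x y))) m"
proof -
  interpret ev: weighted_evolution "\<lambda>x. c0 * of_real (v x + deg x)" "kop (kern (\<lambda>x y. - c0 * phase \<theta> x y))" C' m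
    by (rule ev)
  have nz: "c0 \<noteq> 0" using c0 by auto
  have bk: "bounded_kernel C (kern (\<lambda>x y. - c0 * phase \<theta> x y))"
    by (rule bounded_kernel_mono[OF adj_bounded]) (simp add: kern_def norm_mult norm_divide c0)
  have B: "coord (kop (kern (\<lambda>x y. - c0 * phase \<theta> x y)) F) x = - c0 * coord (A F) x" for F x
  proof -
    have "kern (\<lambda>x y. - c0 * phase \<theta> x y) x y * coord F y = - c0 * (kern (phase \<theta>) x y * coord F y)" for y
      by (simp add: kern_def)
    then show ?thesis
      unfolding coord_kop[OF bk] coord_kop[OF adj_bounded]
      by (simp only: infsum_cmult_right[OF kernel_summable[OF adj_bounded]])
  qed
  note B = B[unfolded mult_minus_left]
  have "(f, g') \<in> scale_op c0 (magnetic_op b m v \<theta>) \<longleftrightarrow> (f, g') \<in> ev.evol_op" for f g'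
  proof
    assume "(f, g') \<in> scale_op c0 (magnetic_op b m v \<theta>)"
    then obtain g where g: "(f, g) \<in> magnetic_op b m v \<theta>" "g' = (\<lambda>x. c0 * g x)" by (auto simp: scale_op_def)
    then show "(f, g') \<in> ev.evol_op" unfolding ev.evol_op_def
      by (auto simp: magnetic_op_eq l2_mult emb_mult B right_diff_distrib simp del: of_real_add)
  next
    assume R: "(f, g') \<in> ev.evol_op"
    let ?g = "\<lambda>x. (1 / c0) * g' x"
    have R': "f \<in> l2 m" "g' \<in> l2 m"
      "\<And>x. coord (emb m g') x = c0 * of_real (v x + deg x) * coord (emb m f) x - c0 * coord (A (emb m f)) x"
      using R unfolding ev.evol_op_def by (auto simp: B simp del: of_real_add)
    have E: "coord (emb m ?g) x = of_real (v x + deg x) * coord (emb m f) x - coord (A (emb m f)) x" for x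
      unfolding emb_mult[OF R'(2)] coord_cs R'(3) mult.assoc right_diff_distrib[symmetric]
      unfolding mult.assoc[symmetric] using nz by simp
    have "(f, ?g) \<in> magnetic_op b m v \<theta>"
      unfolding magnetic_op_eq mem_Collect_eq case_prod_conv by (intro conjI allI R'(1) l2_mult[OF R'(2)] E)
    moreover have "g' = (\<lambda>x. c0 * ?g x)" using nz by simp
    ultimately show "(f, g') \<in> scale_op c0 (magnetic_op b m v \<theta>)"
      unfolding scale_op_def mem_Collect_eq by (intro exI[of _ f] exI[of _ ?g] conjI) simp_all
  qed
  then show ?thesis by auto
qed

end

context graph
begin

lemma phase_0: "phase (\<lambda>_ _. 0) = (\<lambda>_ _. 1)"
  by (simp add: phase_def fun_eq_iff)

text \<open>The semigroup on \<open>ell2\<close> generated by minus the free Laplacian, which is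
  \<open>deg\<close> minus the adjacency operator.\<close>

definition heat :: "real \<Rightarrow> 'a ell2 \<Rightarrow> 'a ell2" where
  "heat = evolution.V (\<lambda>x. - of_real (deg x)) (kop (kern (\<lambda>_ _. 1)))"

lemma transition_Some:
  assumes bk: "bounded_kernel C (kern (\<lambda>_ _. 1))" and h: "0 \<le> h"
  shows "transition b m h (Some y) (Some z) = ratio y z * coord (heat h (unitv z)) y"
proof -
  interpret mg: magnetic_graph b m "\<lambda>_. 0" "\<lambda>_ _. 0" C 0
    by unfold_locales (use bk deg_nonneg in \<open>auto simp: magnetic_potential_def phase_0\<close>)
  have ev: "weighted_evolution (\<lambda>x. - of_real (deg x)) (kop (kern (\<lambda>_ _. 1))) C m"
    by (rule weighted_evolution_kop[OF bk]) (auto simp: deg_nonneg)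
  interpret ev: weighted_evolution "\<lambda>x. - of_real (deg x)" "kop (kern (\<lambda>_ _. 1))" C m by (rule ev)
  have "scale_op (-1) (magnetic_op b m (\<lambda>_. 0) (\<lambda>_ _. 0)) = ev.evol_op"
    using mg.scale_magnetic_op[of "-1" C] ev by (simp add: phase_0)
  then have "transition b m h (Some y) (Some z) = integral_kernel m (exp_op m ev.evol_op h) y z * of_real (m z)"
    by (simp add: transition_def)
  also have "\<dots> = coord (ev.V h (unitv z)) y / of_real (sqrt (m y) * sqrt (m z)) * of_real (m z)"
    by (simp add: ev.integral_kernel_exp_op[OF h])
  also have "complex_of_real (m z) = of_real (sqrt (m z)) * of_real (sqrt (m z))"
    by (simp flip: of_real_mult)
  finally show ?thesis by (simp add: ratio_def heat_def)
qed

end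

section \<open>Expectations of path functionals\<close>

text \<open>Skeletons are indexed from 1, as the constrained times in \<open>process_law\<close>;
  the fixed start is put in front.\<close>

definition start_at :: "'a \<Rightarrow> (nat \<Rightarrow> 'a) \<Rightarrow> nat \<Rightarrow> 'a" where
  "start_at x xs j = (if j = 0 then x else xs j)"

text \<open>A matrix power as a sum over discrete paths, obtained by splitting off the last
  step.\<close>

lemma lit_eq_sum_paths:
  assumes K: "finite K" and x: "x \<in> K" and z: "z \<in> K"
  shows "lit K M x n z = (\<Sum>xs\<in>PiE {1..n} (\<lambda>_. K). if start_at x xs n = z
    then \<Prod>j<n. M (start_at x xs j) (start_at x xs (Suc j)) else 0)"
  using z
proof (induction n arbitrary: z)
  case 0 then show ?case by (auto simp: start_at_def)
next
  case (Suc n)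
  let ?P = "\<lambda>xs. \<Prod>j<n. M (start_at x xs j) (start_at x xs (Suc j))"
  let ?A = "PiE {1..n} (\<lambda>_. K)"
  have ext: "start_at x (xs(Suc n := v)) j = start_at x xs j" if "j \<le> n" for xs v j
    using that by (simp add: start_at_def)
  have ext': "start_at x (xs(Suc n := v)) (Suc n) = v" for xs v by (simp add: start_at_def)
  have P: "?P (xs(Suc n := v)) = ?P xs" for xs v by (intro prod.cong) (auto simp: ext)
  have inK: "start_at x xs n \<in> K" if "xs \<in> ?A" for xs
    using that x by (auto simp: start_at_def PiE_def Pi_def)
  have fin: "finite ?A" using K by (intro finite_PiE) auto
  have "{1..Suc n} = insert (Suc n) {1..n}" by auto
  then have "(\<Sum>xs\<in>PiE {1..Suc n} (\<lambda>_. K). if start_at x xs (Suc n) = z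
      then \<Prod>j<Suc n. M (start_at x xs j) (start_at x xs (Suc j)) else 0)
    = (\<Sum>xs\<in>(\<lambda>(v, g). g(Suc n := v)) ` (K \<times> ?A). if start_at x xs (Suc n) = z
      then \<Prod>j<Suc n. M (start_at x xs j) (start_at x xs (Suc j)) else 0)"
    by (simp add: PiE_insert_eq)
  also have "\<dots> = (\<Sum>(v, xs)\<in>K \<times> ?A. if v = z then ?P xs * M (start_at x xs n) v else 0)"
    by (subst sum.reindex[OF inj_combinator]) (auto simp: ext ext' P intro!: sum.cong)
  also have "\<dots> = (\<Sum>v\<in>K. if v = z then (\<Sum>xs\<in>?A. ?P xs * M (start_at x xs n) v) else 0)"
    by (subst sum.cartesian_product[symmetric]) (auto intro!: sum.cong)
  also have "\<dots> = (\<Sum>xs\<in>?A. ?P xs * M (start_at x xs n) z)"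
    using K Suc.prems by (simp add: sum.delta)
  also have "\<dots> = (\<Sum>xs\<in>?A. \<Sum>w\<in>K. (if start_at x xs n = w then ?P xs else 0) * M w z)"
  proof (rule sum.cong[OF refl])
    fix xs assume "xs \<in> ?A"
    have "(\<Sum>w\<in>K. (if start_at x xs n = w then ?P xs else 0) * M w z)
      = (\<Sum>w\<in>K. if start_at x xs n = w then ?P xs * M w z else 0)"
      by (intro sum.cong) auto
    then show "?P xs * M (start_at x xs n) z = (\<Sum>w\<in>K. (if start_at x xs n = w then ?P xs else 0) * M w z)"
      using inK[OF \<open>xs \<in> ?A\<close>] K by (simp add: sum.delta')
  qed
  also have "\<dots> = (\<Sum>w\<in>K. (\<Sum>xs\<in>?A. if start_at x xs n = w then ?P xs else 0) * M w z)"
    unfolding sum_distrib_right by (rule sum.swap)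
  also have "\<dots> = (\<Sum>w\<in>K. lit K M x n w * M w z)"
    by (rule sum.cong[OF refl]) (simp only: Suc.IH)
  finally show ?case by simp
qed

section \<open>Finite-dimensional laws of the process\<close>

locale graph_process = graph b m for b :: "'a::countable \<Rightarrow> 'a \<Rightarrow> real" and m +
  fixes C :: real and P :: "(real \<Rightarrow> 'a option) measure" and x :: 'a
  assumes bk: "bounded_kernel C (kern (\<lambda>_ _. 1))" and law: "process_law b m x P"
begin

sublocale prob_space P
  using law by (simp add: process_law_def)

lemma space_P: "space P = paths" and sets_P: "sets P = sets path_space"
proof -
  have "paths \<subseteq> space (Pi\<^sub>M {0..} (\<lambda>_. count_space (topspace Xhat)) :: (real \<Rightarrow> 'a option) measure)"
    by (auto simp: paths_def space_PiM)
  then show "space P = paths" "sets P = sets path_space"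
    using law by (auto simp: process_law_def path_space_def space_restrict_space)
qed

lemma coordinate_measurable [measurable]:
  assumes "0 \<le> s"
  shows "(\<lambda>\<omega>. \<omega> s) \<in> measurable P (count_space UNIV)"
proof -
  have "(\<lambda>\<omega>. \<omega> s) \<in> measurable path_space (count_space (topspace Xhat))"
    unfolding path_space_def using assms by (intro measurable_restrict_space1 measurable_component_singleton) auto
  then have "(\<lambda>\<omega>. \<omega> s) \<in> measurable path_space (count_space UNIV)"
    by (rule measurable_compose[OF _ measurable_count_space_eq1[THEN iffD2]]) auto
  then show ?thesis using measurable_cong_sets[OF sets_P refl] by blast
qed

lemma fun_measurable:
  assumes "0 \<le> s" "0 \<le> r" shows "(\<lambda>\<omega>. f (\<omega> s) (\<omega> r)) \<in> measurable P (count_space UNIV)"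
proof -
  have "(\<lambda>\<omega>. (\<omega> s, \<omega> r)) \<in> measurable P (count_space UNIV)"
    by (rule measurable_compose_countable[OF _ coordinate_measurable[OF assms(1)], of "\<lambda>p \<omega>. (p, \<omega> r)"])
       (rule measurable_compose[OF coordinate_measurable[OF assms(2)]], simp)
  from measurable_compose[OF this, of "\<lambda>(p, q). f p q"] show ?thesis by simp
qed

lemma complex_fun_measurable:
  fixes f :: "'a option \<Rightarrow> 'a option \<Rightarrow> complex"
  assumes "0 \<le> s" "0 \<le> r" shows "(\<lambda>\<omega>. f (\<omega> s) (\<omega> r)) \<in> borel_measurable P"
  by (rule measurable_compose[OF fun_measurable[OF assms]]) simp

lemma pred_measurable:
  assumes "0 \<le> s" shows "{\<omega> \<in> space P. Q (\<omega> s)} \<in> sets P"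
proof -
  have "(\<lambda>\<omega>. \<omega> s) -` {p. Q p} \<inter> space P = {\<omega> \<in> space P. Q (\<omega> s)}" by auto
  then show ?thesis using measurable_sets[OF coordinate_measurable[OF assms], of "{p. Q p}"] by simp
qed

definition trans :: "real \<Rightarrow> 'a \<Rightarrow> 'a \<Rightarrow> complex" where
  "trans h y z = transition b m h (Some y) (Some z)"

lemma trans_eq: "0 \<le> h \<Longrightarrow> trans h y z = ratio y z * coord (heat h (unitv z)) y"
  unfolding trans_def by (rule transition_Some[OF bk])

lemma trans_expansion: "((\<lambda>h. (trans h w z - (if z = w then 1 else 0)) /\<^sub>R h)
     \<longlongrightarrow> ratio w z * ((if z = w then - of_real (deg w) else 0) + kern (\<lambda>_ _. 1) w z)) (at_right 0)"
proof -
  have "((\<lambda>h. (ratio w z * coord (heat h (unitv z)) w - (if z = w then 1 else 0)) /\<^sub>R h)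
     \<longlongrightarrow> ratio w z * ((if z = w then - of_real (deg w) else 0) + kern (\<lambda>_ _. 1) w z)) (at_right 0)"
    unfolding heat_def by (rule V_expansion[OF bk]) (auto simp: deg_nonneg)
  then show ?thesis
    by (rule Lim_transform_eventually) (auto simp: eventually_at_filter trans_eq intro!: always_eventually)
qed

lemma trans_tendsto_1: "((\<lambda>h. trans h x x) \<longlongrightarrow> 1) (at_right 0)"
proof -
  have "((\<lambda>h. of_real h * ((trans h x x - 1) /\<^sub>R h) + 1) \<longlongrightarrow>
      of_real 0 * (ratio x x * (- of_real (deg x) + kern (\<lambda>_ _. 1) x x)) + 1) (at_right 0)"
    using trans_expansion[of x x] by (intro tendsto_intros) simp
  then have "((\<lambda>h. of_real h * ((trans h x x - 1) /\<^sub>R h) + 1) \<longlongrightarrow> 1) (at_right 0)" by simp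
  then show ?thesis
    by (rule Lim_transform_eventually)
       (auto simp: eventually_at_filter scaleR_conv_of_real mult.assoc[symmetric] intro!: always_eventually)
qed

lemma grid_law:
  assumes h: "0 < h"
  shows "complex_of_real (measure P {\<omega> \<in> space P. \<forall>j\<in>{1..N}. \<omega> (real j * h) = Some (xs j)})
    = (\<Prod>j<N. trans h (start_at x xs j) (start_at x xs (Suc j)))"
proof -
  let ?ts = "\<lambda>j. real j * h" and ?xs = "\<lambda>j. Some (start_at x xs j)"
  have "complex_of_real (measure P {\<omega> \<in> space P. \<forall>j\<in>{1..N}. \<omega> (?ts j) = ?xs j})
    = (\<Prod>j<N. transition b m (?ts (Suc j) - ?ts j) (?xs j) (?xs (Suc j)))"
  proof -
    have "?ts 0 = 0 \<and> (\<forall>j<N. ?ts j < ?ts (Suc j)) \<and> ?xs 0 = Some x \<and> (\<forall>j\<in>{1..N}. ?xs j \<in> topspace Xhat)"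
      using h by (simp add: start_at_def)
    then show ?thesis
      by (rule mp[OF law[unfolded process_law_def, THEN conjunct2, THEN conjunct2, THEN conjunct2,
          THEN spec, of N, THEN spec, of ?ts, THEN spec, of ?xs]])
  qed
  moreover have "?ts (Suc j) - ?ts j = h" for j by (simp add: distrib_right)
  moreover have "{\<omega> \<in> space P. \<forall>j\<in>{1..N}. \<omega> (?ts j) = ?xs j} = {\<omega> \<in> space P. \<forall>j\<in>{1..N}. \<omega> (?ts j) = Some (xs j)}"
    by (auto simp: start_at_def)
  ultimately show ?thesis by (simp add: trans_def)
qed

text \<open>The law constrains the path at positive times only. The start follows from
  right-continuity and from the return probability to \<open>x\<close> at time \<open>h\<close>,
  which tends to 1 as \<open>h\<close> tends to 0.\<close>

lemma AE_start: "AE \<omega> in P. \<omega> 0 = Some x"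
proof -
  let ?h = "\<lambda>n::nat. 1 / (1 + real n)"
  have h_lim: "filterlim ?h (at_right 0) sequentially" by real_asymp
  let ?f = "\<lambda>n \<omega>. indicator {\<omega>. \<omega> (?h n) = Some x} \<omega> :: real"
  have set: "{\<omega> \<in> space P. \<omega> s = Some x} \<in> sets P" if "0 \<le> s" for s by (rule pred_measurable[OF that])
  have meas: "(\<lambda>\<omega>. indicator {\<omega>. \<omega> s = Some x} \<omega> :: real) \<in> borel_measurable P" if "0 \<le> s" for s
    using set[OF that] by (intro borel_measurable_indicator') auto
  have int: "(\<integral>\<omega>. indicator {\<omega>. \<omega> s = Some x} \<omega> \<partial>P) = measure P {\<omega> \<in> space P. \<omega> s = Some x}" for s
  proof -
    have "{\<omega>. \<omega> s = Some x} \<inter> space P = {\<omega> \<in> space P. \<omega> s = Some x}" by auto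
    then show ?thesis by (simp only: Bochner_Integration.integral_indicator)
  qed
  have "(\<lambda>n. \<integral>\<omega>. ?f n \<omega> \<partial>P) \<longlonglongrightarrow> (\<integral>\<omega>. indicator {\<omega>. \<omega> 0 = Some x} \<omega> \<partial>P)"
  proof (rule integral_dominated_convergence[where w = "\<lambda>_. 1"])
    show "AE \<omega> in P. (\<lambda>n. ?f n \<omega>) \<longlonglongrightarrow> indicator {\<omega>. \<omega> 0 = Some x} \<omega>"
    proof (rule AE_I2)
      fix \<omega> assume "\<omega> \<in> space P"
      then have "\<forall>\<^sub>F s in at_right 0. (\<omega> s = Some x) = (\<omega> 0 = Some x)"
        by (intro path_right) (auto simp: space_P)
      then have "\<forall>\<^sub>F n in sequentially. (\<omega> (?h n) = Some x) = (\<omega> 0 = Some x)"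
        using h_lim unfolding filterlim_iff by blast
      then show "(\<lambda>n. ?f n \<omega>) \<longlonglongrightarrow> indicator {\<omega>. \<omega> 0 = Some x} \<omega>"
        by (intro tendsto_eventually) (auto elim!: eventually_mono simp: indicator_def)
    qed
  qed (auto intro!: meas simp: indicator_def)
  then have lim: "(\<lambda>n. measure P {\<omega> \<in> space P. \<omega> (?h n) = Some x}) \<longlonglongrightarrow> measure P {\<omega> \<in> space P. \<omega> 0 = Some x}"
    unfolding int .
  have "complex_of_real (measure P {\<omega> \<in> space P. \<omega> (?h n) = Some x}) = trans (?h n) x x" for n
    using grid_law[of "?h n" 1 "\<lambda>_. x"] by (simp add: start_at_def)
  then have "(\<lambda>n. complex_of_real (measure P {\<omega> \<in> space P. \<omega> (?h n) = Some x})) \<longlonglongrightarrow> 1"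
    using filterlim_compose[OF trans_tendsto_1 h_lim] by simp
  then have "complex_of_real (measure P {\<omega> \<in> space P. \<omega> 0 = Some x}) = 1"
    using tendsto_of_real[OF lim, where 'a = complex] LIMSEQ_unique by blast
  then have "prob {\<omega> \<in> space P. \<omega> 0 = Some x} = 1" by simp
  then show ?thesis using prob_Collect_eq_1[OF set[of 0]] by simp
qed

section \<open>Functionals of paths confined to a finite set\<close>

definition grid_fun :: "'a set \<Rightarrow> ('a option \<Rightarrow> complex) \<Rightarrow> ('a option \<Rightarrow> 'a option \<Rightarrow> complex) \<Rightarrow>
    real \<Rightarrow> 'a \<Rightarrow> nat \<Rightarrow> (real \<Rightarrow> 'a option) \<Rightarrow> complex" where
  "grid_fun K w \<Psi> h y N \<omega> = (if \<omega> 0 = Some x \<and> (\<forall>j\<in>{1..N}. \<omega> (real j * h) \<in> Some ` K) \<and> \<omega> (real N * h) = Some y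
     then \<Prod>j<N. step_factor w \<Psi> h (\<omega> (real j * h)) (\<omega> (real (Suc j) * h)) else 0)"

definition step_matrix :: "('a option \<Rightarrow> complex) \<Rightarrow> ('a option \<Rightarrow> 'a option \<Rightarrow> complex) \<Rightarrow> real \<Rightarrow> 'a \<Rightarrow> 'a \<Rightarrow> complex" where
  "step_matrix w \<Psi> h y z = trans h y z * step_factor w \<Psi> h (Some y) (Some z)"

lemma grid_fun_measurable:
  assumes h: "0 \<le> h"
  shows "grid_fun K w \<Psi> h y N \<in> borel_measurable P"
proof -
  have j: "0 \<le> real j * h" for j using h by simp
  have "{\<omega> \<in> space P. \<omega> 0 = Some x \<and> (\<forall>j\<in>{1..N}. \<omega> (real j * h) \<in> Some ` K) \<and> \<omega> (real N * h) = Some y} \<in> sets P"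
    by (intro sets.sets_Collect_conj sets.sets_Collect_finite_All pred_measurable j) (auto intro: pred_measurable)
  moreover have "(\<lambda>\<omega>. \<Prod>j<N. step_factor w \<Psi> h (\<omega> (real j * h)) (\<omega> (real (Suc j) * h))) \<in> borel_measurable P"
    by (intro borel_measurable_prod complex_fun_measurable j)
  ultimately show ?thesis unfolding grid_fun_def[abs_def] by (intro measurable_If) auto
qed

text \<open>The functional is constant on each of the finitely many skeleton events with states in
  \<open>K\<close>; their probabilities are products of transition probabilities, so the sum is an
  entry of a matrix power.\<close>

lemma grid_fun_expectation:
  assumes K: "finite K" "x \<in> K" "y \<in> K" and h: "0 < h" and N: "0 < N"
  shows "(\<integral>\<omega>. grid_fun K w \<Psi> h y N \<omega> \<partial>P) = lit K (step_matrix w \<Psi> h) x N y"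
proof -
  let ?A = "PiE {1..N} (\<lambda>_. K)"
  let ?E = "\<lambda>xs. {\<omega> \<in> space P. \<forall>j\<in>{1..N}. \<omega> (real j * h) = Some (xs j)}"
  let ?G = "\<lambda>xs. \<Prod>j<N. step_factor w \<Psi> h (Some (start_at x xs j)) (Some (start_at x xs (Suc j)))"
  let ?val = "\<lambda>xs. if start_at x xs N = y then ?G xs else 0"
  have fin: "finite ?A" using K by (intro finite_PiE) auto
  have E: "?E xs \<in> sets P" for xs
    using h by (intro sets.sets_Collect_finite_All pred_measurable) auto
  have pt: "grid_fun K w \<Psi> h y N \<omega> = (\<Sum>xs\<in>?A. indicator (?E xs) \<omega> *\<^sub>R ?val xs)"
    if \<omega>: "\<omega> \<in> space P" "\<omega> 0 = Some x" for \<omega>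
  proof (cases "\<forall>j\<in>{1..N}. \<omega> (real j * h) \<in> Some ` K")
    case False
    then obtain j where j: "j \<in> {1..N}" "\<omega> (real j * h) \<notin> Some ` K" by blast
    then have "\<omega> \<notin> ?E xs" if "xs \<in> ?A" for xs using that by (auto simp: PiE_def Pi_def)
    then have "(\<Sum>xs\<in>?A. indicator (?E xs) \<omega> *\<^sub>R ?val xs) = 0" by (intro sum.neutral) auto
    then show ?thesis using False by (auto simp: grid_fun_def)
  next
    case True
    \<comment> \<open>The only skeleton in \<open>K\<close> that the path realises.\<close>
    define ys where "ys = restrict (\<lambda>j. the (\<omega> (real j * h))) {1..N}"
    have ys: "ys \<in> ?A" using True unfolding ys_def by (intro restrict_PiE_iff[THEN iffD2]) force
    have val: "\<omega> (real j * h) = Some (ys j)" if "j \<in> {1..N}" for j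
      using True that unfolding ys_def by force
    have val': "\<omega> (real j * h) = Some (start_at x ys j)" if "j \<le> N" for j
      using val[of j] \<omega> that by (cases "j = 0") (auto simp: start_at_def)
    have uniq: "xs = ys" if "xs \<in> ?A" "\<omega> \<in> ?E xs" for xs
    proof (rule PiE_ext[OF that(1) ys])
      fix j assume "j \<in> {1..N}" then show "xs j = ys j" using that(2) val[of j] by auto
    qed
    have "(\<Sum>xs\<in>?A. indicator (?E xs) \<omega> *\<^sub>R ?val xs) = (\<Sum>xs\<in>{ys}. indicator (?E xs) \<omega> *\<^sub>R ?val xs)"
      by (rule sum.mono_neutral_right[OF fin]) (use ys uniq in \<open>auto simp: indicator_def\<close>)
    also have "\<dots> = indicator (?E ys) \<omega> *\<^sub>R ?val ys"
      by (simp only: sum.insert[OF finite.emptyI] sum.empty add_0_right empty_iff not_False_eq_True)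
    also have "indicator (?E ys) \<omega> = (1::real)" using \<omega> val by (intro indicator_eq_1_iff[THEN iffD2]) auto
    also have "1 *\<^sub>R ?val ys = ?val ys" by (rule scaleR_one)
    also have "\<dots> = grid_fun K w \<Psi> h y N \<omega>"
    proof -
      have "(\<Prod>j<N. step_factor w \<Psi> h (\<omega> (real j * h)) (\<omega> (real (Suc j) * h))) = ?G ys"
        by (intro prod.cong) (auto simp: val' simp del: of_nat_Suc)
      then show ?thesis using True \<omega> val'[of N] by (simp add: grid_fun_def del: of_nat_Suc)
    qed
    finally show ?thesis ..
  qed
  have "(\<integral>\<omega>. grid_fun K w \<Psi> h y N \<omega> \<partial>P) = (\<integral>\<omega>. (\<Sum>xs\<in>?A. indicator (?E xs) \<omega> *\<^sub>R ?val xs) \<partial>P)"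
  proof (rule integral_cong_AE)
    show "grid_fun K w \<Psi> h y N \<in> borel_measurable P" using h by (intro grid_fun_measurable) auto
    show "(\<lambda>\<omega>. \<Sum>xs\<in>?A. indicator (?E xs) \<omega> *\<^sub>R ?val xs) \<in> borel_measurable P"
      using E by (intro borel_measurable_sum borel_measurable_scaleR borel_measurable_indicator) auto
    show "AE \<omega> in P. grid_fun K w \<Psi> h y N \<omega> = (\<Sum>xs\<in>?A. indicator (?E xs) \<omega> *\<^sub>R ?val xs)"
      using AE_start AE_space by eventually_elim (use pt in auto)
  qed
  also have "\<dots> = (\<Sum>xs\<in>?A. \<integral>\<omega>. indicator (?E xs) \<omega> *\<^sub>R ?val xs \<partial>P)"
    using E by (intro Bochner_Integration.integral_sum integrable_scaleR_left integrable_real_indicator) (auto simp: emeasure_eq_measure)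
  also have "\<dots> = (\<Sum>xs\<in>?A. of_real (measure P (?E xs)) * ?val xs)"
  proof (rule sum.cong[OF refl])
    fix xs
    have "?E xs \<inter> space P = ?E xs" by auto
    moreover have "integrable P (indicator (?E xs) :: _ \<Rightarrow> real)"
      using E by (intro integrable_real_indicator) (auto simp: emeasure_eq_measure)
    ultimately show "(\<integral>\<omega>. indicator (?E xs) \<omega> *\<^sub>R ?val xs \<partial>P) = of_real (measure P (?E xs)) * ?val xs"
      by (subst integral_scaleR_left) (auto simp: scaleR_conv_of_real)
  qed
  also have "\<dots> = (\<Sum>xs\<in>?A. if start_at x xs N = y then
      \<Prod>j<N. step_matrix w \<Psi> h (start_at x xs j) (start_at x xs (Suc j)) else 0)"
    unfolding grid_law[OF h] step_matrix_def prod.distrib by (rule sum.cong[OF refl]) simp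
  also have "\<dots> = lit K (step_matrix w \<Psi> h) x N y"
    by (rule lit_eq_sum_paths[symmetric]) (use K in auto)
  finally show ?thesis .
qed

text \<open>Product rule on the diagonal: the rate \<open>- deg y\<close> and the potential
  \<open>w0\<close> add up. Off the diagonal the transition probability is already of first order
  and \<Psi> multiplies its rate.\<close>

lemma step_matrix_expansion:
  assumes w: "w (Some y) = w0" 
  shows "((\<lambda>h. (step_matrix w \<Psi> h y z - (if z = y then 1 else 0)) /\<^sub>R h)
     \<longlongrightarrow> ratio y z * ((if z = y then w0 - of_real (deg y) else 0) + kern (\<lambda>y z. \<Psi> (Some y) (Some z)) y z)) (at_right 0)"
proof (cases "z = y")
  case True
  have "((\<lambda>z. exp (z * w0)) has_field_derivative exp (of_real 0 * w0) * w0) (at (of_real 0))"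
    by (auto intro!: derivative_eq_intros)
  from has_vector_derivative_at_right_0[OF has_vector_derivative_real_field[OF this]]
  have e: "((\<lambda>h. (exp (of_real h * w0) - 1) /\<^sub>R h) \<longlongrightarrow> w0) (at_right 0)" by simp
  have k0: "kern \<psi> y y = 0" for \<psi> by (simp add: kern_def)
  have t1: "((\<lambda>h. (trans h y y - 1) /\<^sub>R h) \<longlongrightarrow> - of_real (deg y)) (at_right 0)"
    using trans_expansion[of y y] by (simp add: k0)
  have "((\<lambda>h. (trans h y y - 1) /\<^sub>R h * exp (of_real h * w0) + (exp (of_real h * w0) - 1) /\<^sub>R h)
      \<longlongrightarrow> - of_real (deg y) * exp (of_real 0 * w0) + w0) (at_right 0)"
    by (intro tendsto_intros t1 e)
  moreover have "(trans h y y - 1) /\<^sub>R h * exp (of_real h * w0) + (exp (of_real h * w0) - 1) /\<^sub>R h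
    = (step_matrix w \<Psi> h y z - (if z = y then 1 else 0)) /\<^sub>R h" for h
    using True by (simp add: step_matrix_def step_factor_def w algebra_simps flip: scaleR_add_right)
  ultimately show ?thesis using True by (simp add: k0)
next
  case False
  have "((\<lambda>h. (trans h y z - 0) /\<^sub>R h * \<Psi> (Some y) (Some z)) \<longlongrightarrow>
      ratio y z * kern (\<lambda>_ _. 1) y z * \<Psi> (Some y) (Some z)) (at_right 0)"
    using trans_expansion[of y z] False by (intro tendsto_intros) simp
  then show ?thesis using False by (simp add: step_matrix_def step_factor_def kern_def mult.assoc)
qed

definition local_fun :: "'a set \<Rightarrow> ('a option \<Rightarrow> complex) \<Rightarrow> ('a option \<Rightarrow> 'a option \<Rightarrow> complex) \<Rightarrow>
    real \<Rightarrow> 'a \<Rightarrow> (real \<Rightarrow> 'a option) \<Rightarrow> complex" where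
  "local_fun K w \<Psi> t y \<omega> = (if \<omega> 0 = Some x \<and> (\<forall>s\<in>{0..t}. \<omega> s \<in> Some ` K) \<and> \<omega> t = Some y
     then path_fun w \<Psi> \<omega> 0 t else 0)"

text \<open>Compression of the kernel to \<open>K\<close>. The multiplication part stays
  unrestricted, since orbits starting in \<open>K\<close> remain supported there.\<close>

definition local_kernel :: "'a set \<Rightarrow> ('a option \<Rightarrow> 'a option \<Rightarrow> complex) \<Rightarrow> 'a \<Rightarrow> 'a \<Rightarrow> complex" where
  "local_kernel K \<Psi> = kern (\<lambda>y z. if y \<in> K \<and> z \<in> K then \<Psi> (Some y) (Some z) else 0)"

text \<open>A path that starts in \<open>K\<close> and leaves it is detected by fine grids, so its
  limit is 0; a path staying in \<open>K\<close> has finitely many jumps, and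
  \<open>grid_limit\<close> applies.\<close>

lemma grid_fun_tendsto:
  assumes K: "finite K" "x \<in> K" and t: "0 < t" and \<omega>: "\<omega> \<in> space P"
  shows "(\<lambda>N. grid_fun K w \<Psi> (t / real N) y N \<omega>) \<longlonglongrightarrow> local_fun K w \<Psi> t y \<omega>"
proof -
  have p: "\<omega> \<in> paths" using \<omega> by (simp add: space_P)
  have Nh: "\<forall>\<^sub>F N in sequentially. real N * (t / real N) = t"
    using eventually_gt_at_top[of 0] by eventually_elim simp
  consider "\<omega> 0 \<noteq> Some x" | "\<omega> t \<noteq> Some y" | s where "\<omega> 0 = Some x" "s \<in> {0..t}" "\<omega> s \<notin> Some ` K"
    | "\<omega> 0 = Some x" "\<omega> t = Some y" "\<forall>s\<in>{0..t}. \<omega> s \<in> Some ` K" by blast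
  then show ?thesis
  proof cases
    case 1 then show ?thesis by (simp add: grid_fun_def local_fun_def)
  next
    case 2
    have "\<forall>\<^sub>F N in sequentially. grid_fun K w \<Psi> (t / real N) y N \<omega> = local_fun K w \<Psi> t y \<omega>"
      using Nh by eventually_elim (simp only: grid_fun_def local_fun_def 2 simp_thms if_False)
    then show ?thesis by (rule tendsto_eventually)
  next
    case (3 s)
    have "\<forall>\<^sub>F N in sequentially. \<exists>j\<le>N. \<omega> (real j * (t / real N)) \<notin> Some ` K"
      by (rule eventually_grid_avoids[OF p t 3(2) K(1) 3(3)])
    then have "\<forall>\<^sub>F N in sequentially. grid_fun K w \<Psi> (t / real N) y N \<omega> = local_fun K w \<Psi> t y \<omega>"
    proof eventually_elim
      case (elim N)
      then obtain j where j: "j \<le> N" "\<omega> (real j * (t / real N)) \<notin> Some ` K" by blast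
      have "j \<noteq> 0"
      proof
        assume "j = 0" then show False using j 3(1) K(2) by simp
      qed
      then have "j \<in> {1..N}" using j by simp
      then have "\<not> (\<forall>j\<in>{1..N}. \<omega> (real j * (t / real N)) \<in> Some ` K)" using j by blast
      moreover have "\<not> (\<forall>s\<in>{0..t}. \<omega> s \<in> Some ` K)" using 3 by blast
      ultimately show ?case unfolding grid_fun_def local_fun_def by (simp only: simp_thms if_False)
    qed
    then show ?thesis by (rule tendsto_eventually)
  next
    case 4
    note tpos = t
    interpret kpath \<omega> t
    proof
      show "\<omega> \<in> paths" "0 \<le> t" using p t by auto
      show "finite (jumps \<omega> \<inter> {..t})"
        by (rule finite_range_finite_jumps[of \<omega> t K]) (use p t K 4 in auto)
    qed
    have "local_fun K w \<Psi> t y \<omega> = path_fun w \<Psi> \<omega> 0 t" using 4 by (simp add: local_fun_def)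
    moreover have "\<forall>\<^sub>F N in sequentially. (\<Prod>j<N. step_factor w \<Psi> (t / real N) (\<omega> (real j * (t / real N))) (\<omega> (real (Suc j) * (t / real N))))
        = grid_fun K w \<Psi> (t / real N) y N \<omega>"
      using Nh eventually_gt_at_top[of 0]
    proof eventually_elim
      case (elim N)
      have "\<omega> (real j * (t / real N)) \<in> Some ` K" if "j \<in> {1..N}" for j
      proof -
        have "real j * (t / real N) \<le> real N * (t / real N)" using that t by (intro mult_right_mono) auto
        then show ?thesis using 4(3) elim(1) t by simp
      qed
      then show ?case unfolding grid_fun_def elim(1) using 4 by simp
    qed
    ultimately show ?thesis
      using Lim_transform_eventually[OF grid_limit[OF tpos]] by simp
  qed
qed

text \<open>The potential is bounded on the finite set \<open>K\<close>, which gives a constant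
  bound uniform in the grid, integrable under a probability measure.\<close>

lemma grid_fun_bound:
  assumes K: "finite K" "x \<in> K" and t: "0 < t" and \<Psi>: "\<And>p q. cmod (\<Psi> p q) \<le> 1"
  shows "cmod (grid_fun K w \<Psi> (t / real N) y N \<omega>) \<le> exp (t * (\<Sum>z\<in>K. cmod (w (Some z))))"
proof -
  let ?W = "\<Sum>z\<in>K. cmod (w (Some z))" and ?h = "t / real N"
  have W: "0 \<le> ?W" by (intro sum_nonneg) auto
  have fac: "cmod (step_factor w \<Psi> ?h p q) \<le> exp (?h * ?W)" if p: "p \<in> Some ` K" for p q
  proof (cases "p = q")
    case True
    have "Re (of_real ?h * w p) \<le> cmod (of_real ?h * w p)" by (rule complex_Re_le_cmod)
    also have "\<dots> = ?h * cmod (w p)" using t by (simp add: norm_mult norm_divide)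
    also have "\<dots> \<le> ?h * ?W" using p K t by (intro mult_left_mono) (auto intro!: member_le_sum)
    finally show ?thesis using True by (simp add: step_factor_def)
  next
    case False
    have "1 \<le> exp (?h * ?W)" using W t by (simp add: divide_nonneg_nonneg)
    from order_trans[OF \<Psi>[of p q] this] show ?thesis using False by (simp only: step_factor_def if_False)
  qed
  show ?thesis
  proof (cases "\<omega> 0 = Some x \<and> (\<forall>j\<in>{1..N}. \<omega> (real j * ?h) \<in> Some ` K) \<and> \<omega> (real N * ?h) = Some y")
    case False
    then have "grid_fun K w \<Psi> ?h y N \<omega> = 0" unfolding grid_fun_def by (simp only: if_False)
    then show ?thesis by simp
  next
    case True
    have "\<omega> (real j * ?h) \<in> Some ` K" if "j < N" for j
      using True that K by (cases "j = 0") auto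
    then have "cmod (\<Prod>j<N. step_factor w \<Psi> ?h (\<omega> (real j * ?h)) (\<omega> (real (Suc j) * ?h))) \<le> (\<Prod>j<N. exp (?h * ?W))"
      unfolding prod_norm[symmetric] by (intro prod_mono conjI norm_ge_zero fac) auto
    also have "\<dots> = exp (real N * (?h * ?W))" by (simp only: prod_constant card_lessThan exp_of_nat_mult)
    also have "\<dots> \<le> exp (t * ?W)" using W t by simp
    finally show ?thesis unfolding grid_fun_def if_P[OF True] .
  qed
qed

text \<open>The truncated orbit solves the same equation with the same initial value. Thus the
  entries of \<open>V\<close> on \<open>K\<close> multiply like matrices, as
  \<open>matrix_limit\<close> demands.\<close>

lemma V_local_support:
  assumes \<Psi>: "\<And>p q. cmod (\<Psi> p q) \<le> 1" and \<phi>: "\<And>z. Re (\<phi> z) \<le> 0" and z: "z \<in> K" and s: "0 \<le> s"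
  shows "trunc K (evolution.V \<phi> (kop (local_kernel K \<Psi>)) s (unitv z)) = evolution.V \<phi> (kop (local_kernel K \<Psi>)) s (unitv z)"
proof -
  let ?B = "kop (local_kernel K \<Psi>)"
  have \<Psi>': "cmod (if y \<in> K \<and> z \<in> K then \<Psi> (Some y) (Some z) else 0) \<le> 1" for y z using \<Psi> by simp
  interpret weighted_evolution \<phi> ?B C m unfolding local_kernel_def by (rule weighted_evolution_kop[OF bk \<Psi>' \<phi>])
  have bl: "bounded_kernel C (local_kernel K \<Psi>)" unfolding local_kernel_def by (rule bounded_kern[OF bk \<Psi>'])
  have B0: "coord (?B F) y = 0" if "y \<notin> K" for F y
    unfolding coord_kop[OF bl] using that by (simp add: local_kernel_def kern_def)
  have BT: "?B (trunc K F) = ?B F" for F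
  proof (rule ell2_eqI)
    show "coord (?B (trunc K F)) y = coord (?B F) y" for y
      unfolding coord_kop[OF bl] by (rule infsum_cong) (simp add: local_kernel_def kern_def)
  qed
  have "evol \<phi> ?B (\<lambda>s. trunc K (V s (unitv z)))"
    unfolding evol_def
  proof (intro conjI allI impI)
    show "continuous_on {0..} (\<lambda>s. trunc K (V s (unitv z)))"
      by (rule bounded_linear.continuous_on[OF bounded_linear_trunc V_continuous])
    fix y and s :: real assume "0 \<le> s"
    then show "((\<lambda>s. coord (trunc K (V s (unitv z))) y) has_vector_derivative
        \<phi> y * coord (trunc K (V s (unitv z))) y + coord (?B (trunc K (V s (unitv z)))) y) (at s within {0..})"
      using V_derivative[of s "unitv z" y] by (auto simp: BT B0)
  qed
  from V_eqI[OF this s] have "V s (trunc K (unitv z)) = trunc K (V s (unitv z))" by simp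
  moreover have "trunc K (unitv z) = unitv z" using z by (auto intro!: ell2_eqI)
  ultimately show ?thesis by simp
qed

text \<open>The grid expectations converge in two ways: to the expectation of the local functional,
  by dominated convergence, and to the entry of the compressed semigroup, by
  \<open>matrix_limit\<close>. The summand \<open>deg\<close> in \<open>w\<close> cancels the rate
  found in \<open>step_matrix_expansion\<close>.\<close>

theorem local_fun_expectation:
  assumes K: "finite K" "x \<in> K" "y \<in> K" and t: "0 < t" and \<Psi>: "\<And>p q. cmod (\<Psi> p q) \<le> 1"
    and w: "\<And>z. w (Some z) = \<phi> z + of_real (deg z)" and \<phi>: "\<And>z. Re (\<phi> z) \<le> 0"
  shows "local_fun K w \<Psi> t y \<in> borel_measurable P" "integrable P (local_fun K w \<Psi> t y)"
    "(\<integral>\<omega>. local_fun K w \<Psi> t y \<omega> \<partial>P) = ratio x y * coord (evolution.V \<phi> (kop (local_kernel K \<Psi>)) t (unitv y)) x"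
proof -
  let ?f = "local_fun K w \<Psi> t y" and ?g = "\<lambda>N. grid_fun K w \<Psi> (t / real N) y N"
  have meas_g: "?g N \<in> borel_measurable P" for N using t by (intro grid_fun_measurable) simp
  have lim: "\<And>\<omega>. \<omega> \<in> space P \<Longrightarrow> (\<lambda>N. ?g N \<omega>) \<longlonglongrightarrow> ?f \<omega>" by (rule grid_fun_tendsto[OF K(1,2) t])
  show meas: "?f \<in> borel_measurable P"
    by (rule borel_measurable_LIMSEQ_metric[OF meas_g lim])
  note dom = meas meas_g _ AE_I2[OF lim] AE_I2[OF grid_fun_bound[OF K(1,2) t \<Psi>]]
  show int: "integrable P ?f"
    by (rule integrable_dominated_convergence[OF dom]) auto
  have L1: "(\<lambda>N. \<integral>\<omega>. ?g N \<omega> \<partial>P) \<longlonglongrightarrow> (\<integral>\<omega>. ?f \<omega> \<partial>P)"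
    by (rule integral_dominated_convergence[OF dom]) auto
  have \<Psi>': "cmod (if y \<in> K \<and> z \<in> K then \<Psi> (Some y) (Some z) else 0) \<le> 1" for y z using \<Psi> by simp
  interpret ev: weighted_evolution \<phi> "kop (local_kernel K \<Psi>)" C m
    unfolding local_kernel_def by (rule weighted_evolution_kop[OF bk \<Psi>' \<phi>])
  let ?V = "\<lambda>s w z. ratio w z * coord (ev.V s (unitv z)) w"
  have "(\<lambda>N. lit K (step_matrix w \<Psi> (t / real N)) x N y) \<longlonglongrightarrow> ?V t x y"
  proof (rule matrix_limit[OF K(1,2,3) t, where G = "\<lambda>w z. ratio w z * ((if z = w then \<phi> w else 0) + local_kernel K \<Psi> w z)"
        and U = "\<Sum>w\<in>K. cmod (ratio x w) * exp (C * t)"])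
    fix z show "?V 0 x z = (if z = x then 1 else 0)" by simp
  next
    fix s h :: real and z assume sh: "0 \<le> s" "0 \<le> h" and z: "z \<in> K"
    \<comment> \<open>Expanding the inner orbit in the unit vectors of \<open>K\<close> turns the
      semigroup law into a matrix product.\<close>
    have "ev.V (s + h) (unitv z) = ev.V s (trunc K (ev.V h (unitv z)))"
      using ev.V_semigroup[OF sh(2,1)] V_local_support[OF \<Psi> \<phi> z sh(2)] by (simp add: add.commute)
    also have "\<dots> = (\<Sum>w\<in>K. ev.V s (cs (coord (ev.V h (unitv z)) w) (unitv w)))"
      unfolding trunc_finite[OF K(1)] by (rule linear_sum[OF bounded_linear.linear[OF ev.V_bounded_linear[OF sh(1)]]])
    finally have "coord (ev.V (s + h) (unitv z)) x = (\<Sum>w\<in>K. coord (ev.V h (unitv z)) w * coord (ev.V s (unitv w)) x)"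
      using K sh by (simp add: coord_sum ev.V_cs)
    then have "?V (s + h) x z = (\<Sum>w\<in>K. (ratio x w * ratio w z) * (coord (ev.V h (unitv z)) w * coord (ev.V s (unitv w)) x))"
      unfolding ratio_mult by (simp only: sum_distrib_left)
    then show "?V (s + h) x z = (\<Sum>w\<in>K. ?V s x w * ?V h w z)" by (simp only: mult_ac)
  next
    fix w z
    show "((\<lambda>h. (?V h w z - (if z = w then 1 else 0)) /\<^sub>R h) \<longlongrightarrow>
        ratio w z * ((if z = w then \<phi> w else 0) + local_kernel K \<Psi> w z)) (at_right 0)"
      unfolding local_kernel_def by (rule V_expansion[OF bk \<Psi>' \<phi>])
  next
    fix y z assume "y \<in> K" "z \<in> K"
    then have "local_kernel K \<Psi> y z = kern (\<lambda>y z. \<Psi> (Some y) (Some z)) y z" by (simp add: local_kernel_def kern_def)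
    then show "((\<lambda>h. (step_matrix w \<Psi> h y z - (if z = y then 1 else 0)) /\<^sub>R h) \<longlongrightarrow>
        ratio y z * ((if z = y then \<phi> y else 0) + local_kernel K \<Psi> y z)) (at_right 0)"
      using step_matrix_expansion[of w y "\<phi> y + of_real (deg y)" \<Psi> z] w[of y]
      by (simp only: add_diff_cancel_right' simp_thms)
  next
    fix s assume s: "s \<in> {0..t}"
    have "cmod (coord (ev.V s (unitv w)) x) \<le> exp (C * t)" for w
    proof -
      have "cmod (coord (ev.V s (unitv w)) x) \<le> exp (C * s) * norm (unitv w)"
        using s by (intro order_trans[OF coord_le_norm ev.norm_V_le]) auto
      also have "\<dots> \<le> exp (C * t) * 1"
        using s ev.C by (intro mult_mono norm_unitv_le) (auto intro!: mult_left_mono)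
      finally show ?thesis by simp
    qed
    then show "(\<Sum>w\<in>K. cmod (?V s x w)) \<le> (\<Sum>w\<in>K. cmod (ratio x w) * exp (C * t))"
      by (intro sum_mono) (auto simp: norm_mult intro!: mult_left_mono)
  qed
  moreover have "\<forall>\<^sub>F N in sequentially. lit K (step_matrix w \<Psi> (t / real N)) x N y = (\<integral>\<omega>. ?g N \<omega> \<partial>P)"
    using eventually_gt_at_top[of 0]
    by eventually_elim (rule grid_fun_expectation[symmetric], use K t in auto)
  ultimately have "(\<lambda>N. \<integral>\<omega>. ?g N \<omega> \<partial>P) \<longlonglongrightarrow> ?V t x y" by (rule Lim_transform_eventually)
  then show "(\<integral>\<omega>. ?f \<omega> \<partial>P) = ?V t x y" using L1 LIMSEQ_unique by blast
qed

end

section \<open>The Feynman path integral\<close>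

text \<open>With potential 0 its functional is the indicator that all jumps are along edges.\<close>

definition edge_weight :: "('a \<Rightarrow> 'a \<Rightarrow> real) \<Rightarrow> 'a option \<Rightarrow> 'a option \<Rightarrow> complex" where
  "edge_weight b p q = (if edge_step b p q then 1 else 0)"

definition feynman_weight :: "('a \<Rightarrow> 'a \<Rightarrow> real) \<Rightarrow> ('a \<Rightarrow> 'a \<Rightarrow> real) \<Rightarrow> 'a option \<Rightarrow> 'a option \<Rightarrow> complex" where
  "feynman_weight b \<theta> p q = (if edge_step b p q then \<i> * exp (\<i> * of_real (\<theta> (the p) (the q))) else 0)"

text \<open>On vertices this is \<open>deg\<close> plus \<phi> for \<phi> equal to
  \<open>- \<i> * (v + deg)\<close>, the shape required by \<open>local_fun_expectation\<close>; at
  infinity it is 0, as in \<open>time_integral\<close>.\<close>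

definition feynman_potential :: "('a \<Rightarrow> 'a \<Rightarrow> real) \<Rightarrow> ('a \<Rightarrow> real) \<Rightarrow> ('a \<Rightarrow> real) \<Rightarrow> 'a option \<Rightarrow> complex" where
  "feynman_potential b m v = case_option 0 (\<lambda>z. - \<i> * of_real (v z + weighted_deg b m z) + of_real (weighted_deg b m z))"

text \<open>The same shape with \<phi> equal to 0; it belongs to the dominating functional.\<close>

definition deg_potential :: "('a \<Rightarrow> 'a \<Rightarrow> real) \<Rightarrow> ('a \<Rightarrow> real) \<Rightarrow> 'a option \<Rightarrow> complex" where
  "deg_potential b m = case_option 0 (\<lambda>z. of_real (weighted_deg b m z))"

context kpath
begin

lemma time_integral_eq:
  "complex_of_real (time_integral f t \<omega>) = integral {0..t} (\<lambda>s. case_option 0 (\<lambda>z. complex_of_real (f z)) (\<omega> s))"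
proof -
  have eq: "case_option 0 (\<lambda>z. complex_of_real (f z)) p = of_real (case_option 0 f p)" for p
    by (cases p) auto
  have "complex_of_real (time_integral f t \<omega>) = of_real (\<integral>s. indicator {0..t} s *\<^sub>R case_option 0 f (\<omega> s) \<partial>lborel)"
    by (simp add: time_integral_def num_jumps_eq set_lebesgue_integral_def)
  also have "\<dots> = (\<integral>s. of_real (indicator {0..t} s *\<^sub>R case_option 0 f (\<omega> s)) \<partial>lborel)"
    by (rule integral_complex_of_real[symmetric])
  also have "\<dots> = (LINT s:{0..t}|lborel. case_option 0 (\<lambda>z. complex_of_real (f z)) (\<omega> s))"
    unfolding set_lebesgue_integral_def eq by (simp add: scaleR_conv_of_real)
  also have "\<dots> = integral {0..t} (\<lambda>s. case_option 0 (\<lambda>z. complex_of_real (f z)) (\<omega> s))"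
    by (rule set_borel_integral_eq_integral(2)[OF set_integrable_w])
  finally show ?thesis .
qed

lemma feynman_potential_integral:
  "integral {0..t} (\<lambda>s. feynman_potential b m v (\<omega> s)) =
     - \<i> * of_real (time_integral (\<lambda>z. v z + weighted_deg b m z) t \<omega>) + of_real (time_integral (weighted_deg b m) t \<omega>)"
proof -
  let ?f = "case_option 0 (\<lambda>z. complex_of_real (v z + weighted_deg b m z))"
  let ?g = "case_option 0 (\<lambda>z. complex_of_real (weighted_deg b m z))"
  have "feynman_potential b m v p = - \<i> * ?f p + ?g p" for p
    by (cases p) (auto simp: feynman_potential_def)
  then have "integral {0..t} (\<lambda>s. feynman_potential b m v (\<omega> s)) = integral {0..t} (\<lambda>s. - \<i> * ?f (\<omega> s) + ?g (\<omega> s))"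
    by simp
  also have "\<dots> = integral {0..t} (\<lambda>s. - \<i> * ?f (\<omega> s)) + integral {0..t} (\<lambda>s. ?g (\<omega> s))"
    by (intro integral_add integrable_on_mult_right integrable_w) auto
  also have "integral {0..t} (\<lambda>s. - \<i> * ?f (\<omega> s)) = - \<i> * integral {0..t} (\<lambda>s. ?f (\<omega> s))"
    by (rule integral_mult_right)
  finally show ?thesis by (simp only: time_integral_eq)
qed

lemma edge_weight_path_fun:
  "path_fun (\<lambda>_. 0) (edge_weight b) \<omega> 0 t =
    (if \<forall>n\<in>{1..card (J 0 t)}. edge_step b (\<omega> (jump_time \<omega> (n - 1))) (\<omega> (jump_time \<omega> n)) then 1 else 0)"
  unfolding path_fun_def prod_jump_times[symmetric] by (auto simp: edge_weight_def)

text \<open>When some jump is not along an edge, the line integral is 0 by convention while the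
  power of \<i> stays, which gives the second functional. That branch is shown to be null later;
  measurability is proved with all branches.\<close>

lemma feynman_integrand_eq:
  "feynman_integrand b m v \<theta> t y \<omega> = (if \<omega> t = Some y then
     (if path_fun (\<lambda>_. 0) (edge_weight b) \<omega> 0 t = 1
      then path_fun (feynman_potential b m v) (feynman_weight b \<theta>) \<omega> 0 t
      else path_fun (feynman_potential b m v) (\<lambda>_ _. \<i>) \<omega> 0 t) else 0)"
proof (cases "\<omega> t = Some y")
  case True
  let ?N = "card (J 0 t)" and ?\<tau> = "jump_time \<omega>"
  let ?all = "\<forall>n\<in>{1..?N}. edge_step b (\<omega> (?\<tau> (n - 1))) (\<omega> (?\<tau> n))"
  let ?I = "integral {0..t} (\<lambda>s. feynman_potential b m v (\<omega> s))"
  have "feynman_integrand b m v \<theta> t y \<omega> = \<i> ^ ?N * exp (action b m v \<theta> t \<omega>)"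
    using True by (simp add: feynman_integrand_def num_jumps_eq)
  also have "action b m v \<theta> t \<omega> = \<i> * of_real (line_integral b \<theta> t \<omega>) + ?I"
    unfolding action_def feynman_potential_integral by simp
  finally have f: "feynman_integrand b m v \<theta> t y \<omega> = exp ?I * (\<i> ^ ?N * exp (\<i> * of_real (line_integral b \<theta> t \<omega>)))"
    by (simp add: exp_add mult_ac)
  show ?thesis
  proof (cases ?all)
    case al: True
    have "line_integral b \<theta> t \<omega> = (\<Sum>n=1..?N. \<theta> (the (\<omega> (?\<tau> (n - 1)))) (the (\<omega> (?\<tau> n))))"
      using al by (auto simp: line_integral_def num_jumps_eq zero_enat_def)
    then have "exp (\<i> * of_real (line_integral b \<theta> t \<omega>)) = (\<Prod>n=1..?N. exp (\<i> * of_real (\<theta> (the (\<omega> (?\<tau> (n - 1)))) (the (\<omega> (?\<tau> n))))))"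
      by (simp add: sum_distrib_left exp_sum)
    moreover have "\<i> ^ ?N = (\<Prod>n=1..?N. \<i>)" by simp
    ultimately have "\<i> ^ ?N * exp (\<i> * of_real (line_integral b \<theta> t \<omega>)) =
        (\<Prod>n=1..?N. \<i> * exp (\<i> * of_real (\<theta> (the (\<omega> (?\<tau> (n - 1)))) (the (\<omega> (?\<tau> n))))))"
      by (simp only: prod.distrib)
    also have "\<dots> = (\<Prod>n=1..?N. feynman_weight b \<theta> (\<omega> (?\<tau> (n - 1))) (\<omega> (?\<tau> n)))"
      using al by (intro prod.cong) (auto simp: feynman_weight_def)
    finally have prod: "\<i> ^ ?N * exp (\<i> * of_real (line_integral b \<theta> t \<omega>)) =
        (\<Prod>n=1..?N. feynman_weight b \<theta> (\<omega> (?\<tau> (n - 1))) (\<omega> (?\<tau> n)))" .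
    have "path_fun (\<lambda>_. 0) (edge_weight b) \<omega> 0 t = 1" unfolding edge_weight_path_fun by (rule if_P[OF al])
    then show ?thesis
      unfolding f prod if_P[OF True] by (simp only: path_fun_def prod_jump_times[symmetric] simp_thms if_True)
  next
    case al: False
    have "line_integral b \<theta> t \<omega> = 0" using al by (auto simp: line_integral_def num_jumps_eq)
    then show ?thesis
      using True al unfolding f edge_weight_path_fun by (auto simp: path_fun_def)
  qed
qed (simp add: feynman_integrand_def)

lemma Re_feynman_potential_integral:
  "Re (integral {0..t} (\<lambda>s. feynman_potential b m v (\<omega> s))) = Re (integral {0..t} (\<lambda>s. deg_potential b m (\<omega> s)))"
  unfolding feynman_potential_integral deg_potential_def time_integral_eq[symmetric] by simp

lemma deg_path_fun: "path_fun (deg_potential b m) (\<lambda>_ _. 1) \<omega> 0 t = of_real (exp (time_integral (weighted_deg b m) t \<omega>))"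
  unfolding path_fun_def deg_potential_def time_integral_eq[symmetric] by (simp add: exp_of_real)

text \<open>Jump weights have modulus at most 1 and the potential has real part \<open>deg\<close>,
  so only the integral of \<open>deg\<close> remains in the modulus.\<close>

lemma feynman_path_fun_bound:
  "cmod (path_fun (feynman_potential b m v) (feynman_weight b \<theta>) \<omega> 0 t) \<le> Re (path_fun (deg_potential b m) (\<lambda>_ _. 1) \<omega> 0 t)"
proof -
  have "cmod (\<Prod>s\<in>J 0 t. feynman_weight b \<theta> (lval \<omega> s) (\<omega> s)) \<le> 1"
    unfolding prod_norm[symmetric] by (intro prod_le_1) (auto simp: feynman_weight_def norm_mult)
  then have "cmod (path_fun (feynman_potential b m v) (feynman_weight b \<theta>) \<omega> 0 t)
      \<le> exp (Re (integral {0..t} (\<lambda>s. feynman_potential b m v (\<omega> s)))) * 1"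
    unfolding path_fun_def norm_mult norm_exp_eq_Re by (intro mult_left_mono) auto
  also have "\<dots> = Re (path_fun (deg_potential b m) (\<lambda>_ _. 1) \<omega> 0 t)"
    unfolding Re_feynman_potential_integral deg_path_fun
    unfolding deg_potential_def time_integral_eq[symmetric] by simp
  finally show ?thesis .
qed

end

lemma feynman_integrand_infinite_jumps:
  "infinite (jumps \<omega> \<inter> {..t}) \<Longrightarrow> feynman_integrand b m v \<theta> t y \<omega> = 0"
  by (simp add: feynman_integrand_def num_jumps_def)

section \<open>Measurability, null events and passage to the whole graph\<close>

context graph_process
begin

lemma finite_jumps_measurable:
  assumes t: "0 < t"
  shows "{\<omega> \<in> space P. finite (jumps \<omega> \<inter> {..t})} \<in> sets P"
proof -
  have ch: "{\<omega> \<in> space P. changes \<omega> t N \<le> n} \<in> sets P" for N n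
  proof -
    let ?f = "\<lambda>\<omega>. \<Sum>j<N. (\<lambda>p q. if p \<noteq> q then 1 else 0 :: complex) (\<omega> (real j * (t / real N))) (\<omega> (real (Suc j) * (t / real N)))"
    have "?f \<in> borel_measurable P"
      using t by (intro borel_measurable_sum complex_fun_measurable) auto
    then have m: "(\<lambda>\<omega>. Re (?f \<omega>)) \<in> borel_measurable P" by measurable
    have eq: "Re (?f \<omega>) = real (changes \<omega> t N)" for \<omega>
    proof -
      have "?f \<omega> = (\<Sum>j\<in>{j. j < N \<and> \<omega> (real j * (t / real N)) \<noteq> \<omega> (real (Suc j) * (t / real N))}. 1)"
        by (intro sum.mono_neutral_cong_right) auto
      then show ?thesis by (simp add: changes_def)
    qed
    have iff: "changes \<omega> t N \<le> n \<longleftrightarrow> Re (?f \<omega>) \<le> real n" for \<omega>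
      using eq[of \<omega>] by (simp only: of_nat_le_iff)
    have "{\<omega> \<in> space P. changes \<omega> t N \<le> n} = {\<omega> \<in> space P. Re (?f \<omega>) \<le> real n}"
      by (intro Collect_cong conj_cong refl iff)
    then show ?thesis using borel_measurable_le[OF m borel_measurable_const[of "real n"]] by simp
  qed
  have "{\<omega> \<in> space P. finite (jumps \<omega> \<inter> {..t})} = {\<omega> \<in> space P. \<exists>n. \<forall>N. changes \<omega> t N \<le> n}"
    using finite_jumps_iff_changes[OF _ t] by (auto simp: space_P)
  then show ?thesis using sets.sets_Collect_countable_Ex[OF sets.sets_Collect_countable_All[OF ch]] by simp
qed

text \<open>A pointwise limit of grid products; setting it to 0 on paths with infinitely many jumps
  makes the limit exist everywhere.\<close>

lemma path_fun_measurable: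
  assumes t: "0 < t"
  shows "(\<lambda>\<omega>. if finite (jumps \<omega> \<inter> {..t}) then path_fun w \<Psi> \<omega> 0 t else 0) \<in> borel_measurable P"
proof (rule borel_measurable_LIMSEQ_metric)
  let ?g = "\<lambda>N \<omega>. \<Prod>j<N. step_factor w \<Psi> (t / real N) (\<omega> (real j * (t / real N))) (\<omega> (real (Suc j) * (t / real N)))"
  show "(\<lambda>\<omega>. if finite (jumps \<omega> \<inter> {..t}) then ?g N \<omega> else 0) \<in> borel_measurable P" for N
    using t by (intro measurable_If finite_jumps_measurable borel_measurable_prod complex_fun_measurable) auto
  fix \<omega> assume \<omega>: "\<omega> \<in> space P"
  show "(\<lambda>N. if finite (jumps \<omega> \<inter> {..t}) then ?g N \<omega> else 0) \<longlonglongrightarrow> (if finite (jumps \<omega> \<inter> {..t}) then path_fun w \<Psi> \<omega> 0 t else 0)"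
  proof (cases "finite (jumps \<omega> \<inter> {..t})")
    case True
    then interpret kp: kpath \<omega> t using \<omega> t by unfold_locales (auto simp: space_P)
    show ?thesis using True kp.grid_limit[OF t] by simp
  qed simp
qed

lemma feynman_integrand_measurable:
  assumes t: "0 < t"
  shows "feynman_integrand b m v \<theta> t y \<in> borel_measurable P"
proof -
  define q where "q w \<Psi> \<omega> = (if finite (jumps \<omega> \<inter> {..t}) then path_fun w \<Psi> \<omega> 0 t else 0)" for w \<Psi> and \<omega> :: "real \<Rightarrow> 'a option"
  have q: "q w \<Psi> \<in> borel_measurable P" for w \<Psi>
    using path_fun_measurable[OF t, of w \<Psi>] unfolding q_def[abs_def] .
  let ?g = "\<lambda>\<omega>. if finite (jumps \<omega> \<inter> {..t}) then if \<omega> t = Some y then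
      if q (\<lambda>_. 0) (edge_weight b) \<omega> = 1 then q (feynman_potential b m v) (feynman_weight b \<theta>) \<omega>
      else q (feynman_potential b m v) (\<lambda>_ _. \<i>) \<omega> else 0 else 0"
  have "q (\<lambda>_. 0) (edge_weight b) -` {1} \<inter> space P = {\<omega> \<in> space P. q (\<lambda>_. 0) (edge_weight b) \<omega> = 1}" by auto
  then have E: "{\<omega> \<in> space P. q (\<lambda>_. 0) (edge_weight b) \<omega> = 1} \<in> sets P"
    using measurable_sets[OF q[of "\<lambda>_. 0" "edge_weight b"], of "{1}"] by simp
  have "?g \<in> borel_measurable P"
    using t by (intro measurable_If q E finite_jumps_measurable pred_measurable) auto
  moreover have "feynman_integrand b m v \<theta> t y \<omega> = ?g \<omega>" if \<omega>: "\<omega> \<in> space P" for \<omega>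
  proof (cases "finite (jumps \<omega> \<inter> {..t})")
    case True
    then interpret kp: kpath \<omega> t using \<omega> t by unfold_locales (auto simp: space_P)
    show ?thesis using True by (simp add: kp.feynman_integrand_eq q_def)
  next
    case False then show ?thesis by (simp add: feynman_integrand_infinite_jumps)
  qed
  ultimately show ?thesis by (subst measurable_cong[where g = ?g]) auto
qed

text \<open>Infinity is absorbing for the transition function. Rational times form a countable
  family of null events, and a path that is at infinity with no jump right afterwards is still there
  at a rational time.\<close>

lemma AE_no_return:
  "AE \<omega> in P. \<forall>r\<in>\<rat>. 0 < r \<longrightarrow> r < t \<longrightarrow> \<not> (\<omega> r = None \<and> \<omega> t = Some y)"
proof -
  have "AE \<omega> in P. 0 < r \<longrightarrow> r < t \<longrightarrow> \<not> (\<omega> r = None \<and> \<omega> t = Some y)" for r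
  proof (cases "0 < r \<and> r < t \<and> (None :: 'a option) \<in> topspace Xhat")
    case True
    let ?ts = "\<lambda>j::nat. if j = 0 then 0 else if j = 1 then r else t"
    let ?xs = "\<lambda>j::nat. if j = 0 then Some x else if j = 1 then None else Some y"
    let ?E = "{\<omega> \<in> space P. \<forall>j\<in>{1..2}. \<omega> (?ts j) = ?xs j}"
    have "?ts 0 = 0 \<and> (\<forall>j<2. ?ts j < ?ts (Suc j)) \<and> ?xs 0 = Some x \<and> (\<forall>j\<in>{1..2}. ?xs j \<in> topspace Xhat)"
      using True by (auto simp: less_2_cases_iff)
    then have "complex_of_real (measure P ?E) = (\<Prod>j<2. transition b m (?ts (Suc j) - ?ts j) (?xs j) (?xs (Suc j)))"
      by (rule mp[OF law[unfolded process_law_def, THEN conjunct2, THEN conjunct2, THEN conjunct2,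
          THEN spec, of 2, THEN spec, of ?ts, THEN spec, of ?xs]])
    also have "\<dots> = 0" by (simp add: numeral_2_eq_2 transition_def)
    finally have m0: "measure P ?E = 0" by simp
    have E: "?E = {\<omega> \<in> space P. \<omega> r = None \<and> \<omega> t = Some y}"
      by (auto simp: numeral_2_eq_2 atLeastAtMostSuc_conv)
    have "?E \<in> sets P" unfolding E using True by (intro sets.sets_Collect_conj pred_measurable) auto
    then have "?E \<in> null_sets P" using m0 by (auto simp: null_sets_def emeasure_eq_measure)
    then show ?thesis by (rule AE_I'[of ?E]) (auto simp: E)
  next
    case False
    show ?thesis
    proof (rule AE_I2)
      fix \<omega> assume "\<omega> \<in> space P"
      then have "0 < r \<Longrightarrow> \<omega> r \<in> topspace Xhat" by (auto simp: space_P paths_def PiE_def Pi_def)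
      then show "0 < r \<longrightarrow> r < t \<longrightarrow> \<not> (\<omega> r = None \<and> \<omega> t = Some y)" using False by auto
    qed
  qed
  then show ?thesis by (simp add: AE_ball_countable countable_rat)
qed

text \<open>An exhaustion by the enumeration of the vertices, not by distance; \<open>x\<close> and
  \<open>y\<close> are adjoined so that every member contains both end points.\<close>

definition ball_n :: "'a \<Rightarrow> nat \<Rightarrow> 'a set" where
  "ball_n y n = {z. to_nat z < n} \<union> {x, y}"

lemma ball_n: "finite (ball_n y n)" "x \<in> ball_n y n" "y \<in> ball_n y n" "n \<le> k \<Longrightarrow> ball_n y n \<subseteq> ball_n y k"
  by (auto simp: ball_n_def intro: finite_imageD[of to_nat] finite_subset[of _ "{..<n}"])

lemma eventually_ball_n: "\<forall>\<^sub>F n in sequentially. z \<in> ball_n y n"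
  using eventually_gt_at_top[of "to_nat z"] by eventually_elim (simp add: ball_n_def)

text \<open>The compressed operator is the full one with \<open>trunc\<close> on both sides; it
  converges strongly, with the same bound \<open>C\<close>, so \<open>V_convergence\<close>
  applies.\<close>

lemma local_V_convergence:
  assumes \<Psi>: "\<And>p q. cmod (\<Psi> p q) \<le> 1" and \<phi>: "\<And>z. Re (\<phi> z) \<le> 0" and t: "0 \<le> t"
  shows "(\<lambda>n. ratio x y * coord (evolution.V \<phi> (kop (local_kernel (ball_n y n) \<Psi>)) t (unitv y)) x)
    \<longlonglongrightarrow> ratio x y * coord (evolution.V \<phi> (kop (kern (\<lambda>y z. \<Psi> (Some y) (Some z)))) t (unitv y)) x"
proof -
  let ?B = "kop (kern (\<lambda>y z. \<Psi> (Some y) (Some z)))" and ?Bn = "\<lambda>n. kop (local_kernel (ball_n y n) \<Psi>)"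
  have \<Psi>': "cmod (if u \<in> K \<and> z \<in> K then \<Psi> (Some u) (Some z) else 0) \<le> 1" for u z K using \<Psi> by simp
  have ev: "weighted_evolution \<phi> ?B C m" by (rule weighted_evolution_kop[OF bk \<Psi> \<phi>])
  have evn: "weighted_evolution \<phi> (?Bn n) C m" for n
    unfolding local_kernel_def by (rule weighted_evolution_kop[OF bk \<Psi>' \<phi>])
  have bB: "bounded_kernel C (kern (\<lambda>y z. \<Psi> (Some y) (Some z)))" by (rule bounded_kern[OF bk \<Psi>])
  have bBn: "bounded_kernel C (local_kernel (ball_n y n) \<Psi>)" for n
    unfolding local_kernel_def by (rule bounded_kern[OF bk \<Psi>'])
  have eq: "?Bn n F = trunc (ball_n y n) (?B (trunc (ball_n y n) F))" for n F
  proof (rule ell2_eqI)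
    show "coord (?Bn n F) u = coord (trunc (ball_n y n) (?B (trunc (ball_n y n) F))) u" for u
      unfolding coord_trunc coord_kop[OF bBn] coord_kop[OF bB]
      by (cases "u \<in> ball_n y n") (auto simp: local_kernel_def kern_def intro!: infsum_cong infsum_0)
  qed
  have lim: "(\<lambda>n. ?Bn n F) \<longlonglongrightarrow> ?B F" for F
  proof -
    let ?T = "\<lambda>n. trunc (ball_n y n)"
    have 1: "(\<lambda>n. ?B (?T n F)) \<longlonglongrightarrow> ?B F"
      by (rule bounded_linear.tendsto[OF bounded_linear_kop[OF bB] tendsto_trunc[OF eventually_ball_n]])
    have "(\<lambda>n. ?T n (?B (?T n F) - ?B F)) \<longlonglongrightarrow> 0"
    proof (rule Lim_null_comparison)
      show "\<forall>\<^sub>F n in sequentially. norm (?T n (?B (?T n F) - ?B F)) \<le> norm (?B (?T n F) - ?B F)"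
        by (intro always_eventually allI norm_trunc_le)
      show "(\<lambda>n. norm (?B (?T n F) - ?B F)) \<longlonglongrightarrow> 0" using 1 by (simp add: tendsto_norm_zero_iff LIM_zero_iff)
    qed
    from tendsto_add[OF this tendsto_trunc[OF eventually_ball_n[where y = y], where F = "?B F"]] show ?thesis
      by (simp add: eq linear_diff[OF bounded_linear.linear[OF bounded_linear_trunc]])
  qed
  show ?thesis
    by (intro tendsto_intros V_convergence[OF _ _ lim t])
       (use ev evn in \<open>auto simp: weighted_evolution_def\<close>)
qed

lemma local_fun_kpath:
  assumes \<omega>: "\<omega> \<in> space P" and t: "0 < t" and K: "finite K" and nz: "local_fun K w \<Psi> t y \<omega> \<noteq> 0"
  shows "kpath \<omega> t" "\<omega> t = Some y"
proof -
  have "\<forall>s\<in>{0..t}. \<omega> s \<in> Some ` K" and y: "\<omega> t = Some y"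
    using nz unfolding local_fun_def by (auto split: if_splits)
  then have "finite (jumps \<omega> \<inter> {..t})"
    using \<omega> t K by (intro finite_range_finite_jumps[of \<omega> t K]) (auto simp: space_P)
  then show "kpath \<omega> t" using \<omega> t by unfold_locales (auto simp: space_P)
  show "\<omega> t = Some y" by (rule y)
qed

lemma edge_weight_le: "cmod (edge_weight b p q) \<le> 1" and feynman_weight_le: "cmod (feynman_weight b \<theta> p q) \<le> 1"
  by (auto simp: edge_weight_def feynman_weight_def norm_mult)

text \<open>The set enters only through the condition on the path, so a nonzero value persists for
  larger sets.\<close>

lemma local_fun_mono:
  assumes "K \<subseteq> K'" and nz: "local_fun K w \<Psi> t y \<omega> \<noteq> 0"
  shows "local_fun K' w \<Psi> t y \<omega> = local_fun K w \<Psi> t y \<omega>"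
proof -
  have c: "\<omega> 0 = Some x \<and> (\<forall>s\<in>{0..t}. \<omega> s \<in> Some ` K) \<and> \<omega> t = Some y"
    using nz unfolding local_fun_def by (rule contrapos_np) (rule if_not_P)
  then have c': "\<omega> 0 = Some x \<and> (\<forall>s\<in>{0..t}. \<omega> s \<in> Some ` K') \<and> \<omega> t = Some y"
    using image_mono[OF assms(1), of Some] by blast
  show ?thesis unfolding local_fun_def if_P[OF c] if_P[OF c'] ..
qed

text \<open>The two weights have the same expectation, since the kernel of the Laplacian does not see
  non-edges.\<close>

lemma AE_edges:
  assumes K: "finite K" "x \<in> K" "y \<in> K" and t: "0 < t"
  shows "AE \<omega> in P. local_fun K (\<lambda>_. 0) (edge_weight b) t y \<omega> = local_fun K (\<lambda>_. 0) (\<lambda>_ _. 1) t y \<omega>"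
proof -
  let ?f = "\<lambda>\<Psi>. local_fun K (\<lambda>_. 0) \<Psi> t y"
  let ?\<phi> = "\<lambda>z. - complex_of_real (deg z)"
  have one: "\<And>p q. cmod ((\<lambda>_ _. 1) p q :: complex) \<le> 1" by simp
  have w: "\<And>z. (0::complex) = ?\<phi> z + of_real (deg z)" and \<phi>: "\<And>z. Re (?\<phi> z) \<le> 0" by (auto simp: deg_nonneg)
  note E = local_fun_expectation[where w = "\<lambda>_. 0" and \<phi> = ?\<phi>, OF K t edge_weight_le w \<phi>]
  note I = local_fun_expectation[where w = "\<lambda>_. 0" and \<phi> = ?\<phi> and \<Psi> = "\<lambda>_ _. 1", OF K t one w \<phi>]
  have "local_kernel K (edge_weight b) = local_kernel K (\<lambda>_ _. 1)"
    by (intro ext) (auto simp: local_kernel_def kern_def edge_weight_def edge_step_def)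
  then have "(\<integral>\<omega>. ?f (\<lambda>_ _. 1) \<omega> - ?f (edge_weight b) \<omega> \<partial>P) = 0"
    using E I by (subst Bochner_Integration.integral_diff) auto
  then have "(\<integral>\<omega>. Re (?f (\<lambda>_ _. 1) \<omega> - ?f (edge_weight b) \<omega>) \<partial>P) = 0"
    using E I by (subst integral_Re) auto
  moreover have val: "?f (\<lambda>_ _. 1) \<omega> = 1 \<or> ?f (\<lambda>_ _. 1) \<omega> = 0"
      "?f (edge_weight b) \<omega> = 0 \<or> ?f (edge_weight b) \<omega> = 1 \<and> ?f (\<lambda>_ _. 1) \<omega> = 1" if "\<omega> \<in> space P" for \<omega>
  proof -
    show "?f (\<lambda>_ _. 1) \<omega> = 1 \<or> ?f (\<lambda>_ _. 1) \<omega> = 0" by (simp add: local_fun_def path_fun_def)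
    show "?f (edge_weight b) \<omega> = 0 \<or> ?f (edge_weight b) \<omega> = 1 \<and> ?f (\<lambda>_ _. 1) \<omega> = 1"
    proof (cases "?f (edge_weight b) \<omega> = 0")
      case False
      interpret kp: kpath \<omega> t by (rule local_fun_kpath[OF that t K(1) False])
      show ?thesis using False kp.edge_weight_path_fun[of b]
        by (auto simp: local_fun_def path_fun_def[of "\<lambda>_. 0" "\<lambda>_ _. 1"] split: if_splits)
    qed simp
  qed
  \<comment> \<open>Both functionals take the values 0 and 1 and the edge functional never exceeds
    the other; a nonnegative difference with vanishing integral is null.\<close>
  have nn: "AE \<omega> in P. 0 \<le> Re (?f (\<lambda>_ _. 1) \<omega> - ?f (edge_weight b) \<omega>)"
    by (rule AE_I2) (use val in fastforce)
  have int: "integrable P (\<lambda>\<omega>. Re (?f (\<lambda>_ _. 1) \<omega> - ?f (edge_weight b) \<omega>))"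
    using E I by (intro integrable_Re Bochner_Integration.integrable_diff) auto
  ultimately have "AE \<omega> in P. Re (?f (\<lambda>_ _. 1) \<omega> - ?f (edge_weight b) \<omega>) = 0"
    using integral_nonneg_eq_0_iff_AE[OF int nn] by simp
  with AE_space show ?thesis
  proof eventually_elim
    case (elim \<omega>)
    then show ?case using val[OF elim(1)] by auto
  qed
qed

text \<open>Finitely many jumps give a finite range, and \<open>AE_no_return\<close> removes
  infinity from it; so the path lies in \<open>ball_n y n\<close> for large \<open>n\<close>, where
  the local functional equals the global one. Comparing the two weights there shows that all jumps
  are along edges.\<close>

lemma AE_eventually_local:
  assumes t: "0 < t"
  shows "AE \<omega> in P. finite (jumps \<omega> \<inter> {..t}) \<longrightarrow> \<omega> t = Some y \<longrightarrow>
    path_fun (\<lambda>_. 0) (edge_weight b) \<omega> 0 t = 1 \<and>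
    (\<forall>\<^sub>F n in sequentially. \<forall>w \<Psi>. local_fun (ball_n y n) w \<Psi> t y \<omega> = path_fun w \<Psi> \<omega> 0 t)"
proof -
  have edges: "AE \<omega> in P. \<forall>n. local_fun (ball_n y n) (\<lambda>_. 0) (edge_weight b) t y \<omega> = local_fun (ball_n y n) (\<lambda>_. 0) (\<lambda>_ _. 1) t y \<omega>"
    unfolding AE_all_countable by (intro allI AE_edges ball_n t)
  from AE_space AE_start AE_no_return[of t y] edges show ?thesis
  proof eventually_elim
    case (elim \<omega>)
    show ?case
    proof (intro impI)
      assume fin: "finite (jumps \<omega> \<inter> {..t})" and y: "\<omega> t = Some y"
      have \<omega>: "\<omega> \<in> paths" using elim(1) by (simp add: space_P)
      have fr: "finite (\<omega> ` {0..t})" by (rule finite_jumps_finite_range[OF \<omega> fin])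
      have some: "\<omega> s \<noteq> None" if s: "s \<in> {0..t}" for s
      proof
        assume None: "\<omega> s = None"
        then have st: "0 < s" "s < t" using elim(2) y s by (force simp: less_le)+
        have "finite (jumps \<omega> \<inter> {s<..t})" by (rule finite_subset[OF _ fin]) auto
        \<comment> \<open>A jump-free interval after \<open>s\<close>; a rational time in it sees
          the same value as \<open>s\<close>.\<close>
        then obtain c where c: "s < c" "c < t" "jumps \<omega> \<inter> {s<..c} = {}"
        proof (cases "jumps \<omega> \<inter> {s<..t} = {}")
          case True
          then show ?thesis using st by (intro that[of "(s + t) / 2"]) auto
        next
          case False
          let ?d = "Min (jumps \<omega> \<inter> {s<..t})"
          have fin': "finite (jumps \<omega> \<inter> {s<..t})" by fact
          have d: "?d \<in> jumps \<omega> \<inter> {s<..t}" using fin' False by (rule Min_in)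
          have "jumps \<omega> \<inter> {s<..(s + ?d) / 2} = {}"
          proof (rule ccontr)
            assume "jumps \<omega> \<inter> {s<..(s + ?d) / 2} \<noteq> {}"
            then obtain q where q: "q \<in> jumps \<omega>" "s < q" "q \<le> (s + ?d) / 2" by auto
            then have "q \<in> jumps \<omega> \<inter> {s<..t}" using d by auto
            then have "?d \<le> q" by (rule Min_le[OF fin'])
            then show False using q d by auto
          qed
          then show ?thesis using d st by (intro that[of "(s + ?d) / 2"]) auto
        qed
        obtain r where r: "r \<in> \<rat>" "s < r" "r < c" using Rats_dense_in_real[OF c(1)] by auto
        have "jumps \<omega> \<inter> {s<..r} = {}" using c(3) r by auto
        then have "\<omega> r = \<omega> s" by (rule const_no_jumps[OF \<omega> less_imp_le[OF st(1)]]) (use r in auto)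
        then show False using elim(3) r c st y None by auto
      qed
      have "\<forall>\<^sub>F n in sequentially. \<forall>p\<in>\<omega> ` {0..t}. the p \<in> ball_n y n"
        by (intro eventually_ball_finite[OF fr] ballI eventually_ball_n)
      then have ev: "\<forall>\<^sub>F n in sequentially. \<forall>w \<Psi>. local_fun (ball_n y n) w \<Psi> t y \<omega> = path_fun w \<Psi> \<omega> 0 t"
      proof eventually_elim
        case (elim n)
        have "\<omega> s \<in> Some ` ball_n y n" if s: "s \<in> {0..t}" for s
        proof -
          obtain z where z: "\<omega> s = Some z" using some[OF s] by auto
          then have "z \<in> ball_n y n" using elim s by force
          then show ?thesis using z by simp
        qed
        then show ?case using y \<open>\<omega> 0 = Some x\<close> by (auto simp: local_fun_def)
      qed
      obtain n where n: "\<And>w \<Psi>. local_fun (ball_n y n) w \<Psi> t y \<omega> = path_fun w \<Psi> \<omega> 0 t"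
        using eventually_happens'[OF sequentially_bot ev] by blast
      have "path_fun (\<lambda>_. 0) (edge_weight b) \<omega> 0 t = path_fun (\<lambda>_. 0) (\<lambda>_ _. 1) \<omega> 0 t"
        using elim(4) n by metis
      then have "path_fun (\<lambda>_. 0) (edge_weight b) \<omega> 0 t = 1" by (simp add: path_fun_def)
      then show "path_fun (\<lambda>_. 0) (edge_weight b) \<omega> 0 t = 1 \<and>
        (\<forall>\<^sub>F n in sequentially. \<forall>w \<Psi>. local_fun (ball_n y n) w \<Psi> t y \<omega> = path_fun w \<Psi> \<omega> 0 t)"
        using ev by blast
    qed
  qed
qed

lemma feynman_integrand_tendsto:
  assumes t: "0 < t"
  shows "AE \<omega> in P. (\<lambda>n. local_fun (ball_n y n) (feynman_potential b m v) (feynman_weight b \<theta>) t y \<omega>)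
    \<longlonglongrightarrow> feynman_integrand b m v \<theta> t y \<omega>"
  using AE_space AE_eventually_local[OF t, of y]
proof eventually_elim
  case (elim \<omega>)
  let ?f = "\<lambda>n. local_fun (ball_n y n) (feynman_potential b m v) (feynman_weight b \<theta>) t y \<omega>"
  show ?case
  proof (cases "finite (jumps \<omega> \<inter> {..t}) \<and> \<omega> t = Some y")
    case True
    then interpret kp: kpath \<omega> t using elim t by unfold_locales (auto simp: space_P)
    have "\<forall>\<^sub>F n in sequentially. ?f n = feynman_integrand b m v \<theta> t y \<omega>"
      using elim(2) True by (auto simp: kp.feynman_integrand_eq elim: eventually_mono)
    then show ?thesis by (rule tendsto_eventually)
  next
    case False
    have "?f n = 0" for n
    proof (rule ccontr)
      assume nz: "?f n \<noteq> 0"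
      interpret kp: kpath \<omega> t by (rule local_fun_kpath[OF elim(1) t ball_n(1) nz])
      show False using False kp.finite_jumps local_fun_kpath(2)[OF elim(1) t ball_n(1) nz] by blast
    qed
    moreover have "feynman_integrand b m v \<theta> t y \<omega> = 0"
      using False feynman_integrand_infinite_jumps[of \<omega> t] by (auto simp: feynman_integrand_def)
    ultimately show ?thesis by simp
  qed
qed

lemma deg_local_fun_mono:
  assumes t: "0 < t" and \<omega>: "\<omega> \<in> space P"
  shows "mono (\<lambda>n. Re (local_fun (ball_n y n) (deg_potential b m) (\<lambda>_ _. 1) t y \<omega>))"
proof (rule monoI)
  fix k n :: nat assume "k \<le> n"
  let ?f = "\<lambda>n. local_fun (ball_n y n) (deg_potential b m) (\<lambda>_ _. 1) t y \<omega>"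
  show "Re (?f k) \<le> Re (?f n)"
  proof (cases "?f k = 0")
    case True
    have "0 \<le> Re (?f n)"
    proof (cases "?f n = 0")
      case False
      interpret kp: kpath \<omega> t by (rule local_fun_kpath[OF \<omega> t ball_n(1) False])
      show ?thesis by (simp add: local_fun_def kp.deg_path_fun)
    qed simp
    then show ?thesis using True by simp
  next
    case False
    then have "?f n = ?f k" by (rule local_fun_mono[OF ball_n(4)[OF \<open>k \<le> n\<close>]])
    then show ?thesis by simp
  qed
qed

text \<open>The dominating local functionals increase with the set, and their expectations converge
  by \<open>local_V_convergence\<close> with \<phi> equal to 0. Monotone convergence then makes
  their limit \<open>d\<close> integrable.\<close>

theorem feynman_expectation:
  assumes t: "0 < t" and vb: "\<And>z. Re (\<phi> z) \<le> 0" "\<And>z. \<phi> z = - \<i> * of_real (v z + deg z)"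
  shows "integrable P (feynman_integrand b m v \<theta> t y)"
    "(\<integral>\<omega>. feynman_integrand b m v \<theta> t y \<omega> \<partial>P) =
      ratio x y * coord (evolution.V \<phi> (kop (kern (\<lambda>u z. \<i> * phase \<theta> u z))) t (unitv y)) x"
proof -
  let ?F = "\<lambda>n. local_fun (ball_n y n) (feynman_potential b m v) (feynman_weight b \<theta>) t y"
  let ?D = "\<lambda>n. local_fun (ball_n y n) (deg_potential b m) (\<lambda>_ _. 1) t y"
  have wF: "feynman_potential b m v (Some z) = \<phi> z + of_real (deg z)" for z
    by (simp add: feynman_potential_def vb(2))
  have wD: "deg_potential b m (Some z) = 0 + of_real (deg z)" for z by (simp add: deg_potential_def)
  have one: "\<And>p q. cmod ((\<lambda>_ _. 1) p q :: complex) \<le> 1" by simp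
  have zero: "\<And>z. Re ((\<lambda>_. 0) z) \<le> 0" by simp
  note F = local_fun_expectation[where \<Psi> = "feynman_weight b \<theta>" and w = "feynman_potential b m v" and \<phi> = \<phi>,
      OF ball_n(1-3) t feynman_weight_le wF vb(1)]
  note D = local_fun_expectation[where \<Psi> = "\<lambda>_ _. 1" and w = "deg_potential b m" and \<phi> = "\<lambda>_. 0",
      OF ball_n(1-3) t one wD zero]
  have meas: "feynman_integrand b m v \<theta> t y \<in> borel_measurable P" by (rule feynman_integrand_measurable[OF t])
  \<comment> \<open>A genuine limit on every path: the sequence is 0 until the set contains the
    range, and constant from then on.\<close>
  define d where "d \<omega> = lim (\<lambda>n. Re (?D n \<omega>))" for \<omega>
  have Dlim: "(\<lambda>n. Re (?D n \<omega>)) \<longlonglongrightarrow> d \<omega>" and Dle: "Re (?D n \<omega>) \<le> d \<omega>" if \<omega>: "\<omega> \<in> space P" for \<omega> n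
  proof -
    have "convergent (\<lambda>n. Re (?D n \<omega>))"
    proof (cases "\<exists>k. ?D k \<omega> \<noteq> 0")
      case True
      then obtain k where k: "?D k \<omega> \<noteq> 0" by blast
      have "?D n \<omega> = ?D k \<omega>" if "k \<le> n" for n
        by (rule local_fun_mono[OF ball_n(4)[OF that] k])
      then have "\<forall>\<^sub>F n in sequentially. Re (?D n \<omega>) = Re (?D k \<omega>)"
        unfolding eventually_sequentially by (intro exI[of _ k] allI impI arg_cong[of _ _ Re])
      then have "(\<lambda>n. Re (?D n \<omega>)) \<longlonglongrightarrow> Re (?D k \<omega>)"
        by (rule tendsto_eventually)
      then show ?thesis by (rule convergentI)
    qed (simp add: convergent_const)
    then show "(\<lambda>n. Re (?D n \<omega>)) \<longlonglongrightarrow> d \<omega>" unfolding d_def by (simp add: convergent_LIMSEQ_iff)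
    then show "Re (?D n \<omega>) \<le> d \<omega>"
      by (rule incseq_le[OF deg_local_fun_mono[OF t \<omega>]])
  qed
  have measD: "d \<in> borel_measurable P"
    by (rule borel_measurable_LIMSEQ_real[OF Dlim]) (use D(1) in measurable)
  have "integrable P d"
  proof (rule integrable_monotone_convergence)
    show "integrable P (\<lambda>\<omega>. Re (?D n \<omega>))" for n by (intro integrable_Re D(2))
    show "AE \<omega> in P. mono (\<lambda>n. Re (?D n \<omega>))" by (rule AE_I2) (rule deg_local_fun_mono[OF t])
    show "AE \<omega> in P. (\<lambda>n. Re (?D n \<omega>)) \<longlonglongrightarrow> d \<omega>" by (rule AE_I2) (rule Dlim)
    show "d \<in> borel_measurable P" by (rule measD)
    have "(\<integral>\<omega>. Re (?D n \<omega>) \<partial>P) = Re (ratio x y * coord (evolution.V (\<lambda>_. 0) (kop (local_kernel (ball_n y n) (\<lambda>_ _. 1))) t (unitv y)) x)" for n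
      using D(2,3) by (subst integral_Re) auto
    then show "(\<lambda>n. \<integral>\<omega>. Re (?D n \<omega>) \<partial>P) \<longlonglongrightarrow>
        Re (ratio x y * coord (evolution.V (\<lambda>_. 0) (kop (kern (\<lambda>y z. 1))) t (unitv y)) x)"
      using tendsto_Re[OF local_V_convergence[where \<Psi> = "\<lambda>_ _. 1" and \<phi> = "\<lambda>_. 0" and y = y, OF one zero less_imp_le[OF t]]] by simp
  qed
  moreover have bound: "AE \<omega> in P. norm (?F n \<omega>) \<le> d \<omega>" for n
  proof (rule AE_I2)
    fix \<omega> assume \<omega>: "\<omega> \<in> space P"
    have "norm (?F n \<omega>) \<le> Re (?D n \<omega>)"
    proof (cases "?F n \<omega> = 0")
      case True
      have "0 \<le> Re (?D n \<omega>)"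
      proof (cases "?D n \<omega> = 0")
        case False
        interpret kp: kpath \<omega> t by (rule local_fun_kpath[OF \<omega> t ball_n(1) False])
        show ?thesis by (simp add: local_fun_def kp.deg_path_fun)
      qed simp
      then show ?thesis using True by simp
    next
      case False
      interpret kp: kpath \<omega> t by (rule local_fun_kpath[OF \<omega> t ball_n(1) False])
      show ?thesis using False kp.feynman_path_fun_bound[of b m v \<theta>]
        by (auto simp: local_fun_def split: if_splits)
    qed
    then show "norm (?F n \<omega>) \<le> d \<omega>" using Dle[OF \<omega>, of n] by linarith
  qed
  ultimately have dom: "integrable P d" "\<And>n. AE \<omega> in P. norm (?F n \<omega>) \<le> d \<omega>" by auto
  note conv = meas F(1) dom(1) feynman_integrand_tendsto[OF t] dom(2)
  show "integrable P (feynman_integrand b m v \<theta> t y)"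
    by (rule integrable_dominated_convergence[OF conv])
  have L: "(\<lambda>n. \<integral>\<omega>. ?F n \<omega> \<partial>P) \<longlonglongrightarrow> (\<integral>\<omega>. feynman_integrand b m v \<theta> t y \<omega> \<partial>P)"
    by (rule integral_dominated_convergence[OF conv])
  \<comment> \<open>Off the edges both kernels vanish because of the factor
    \<open>b\<close>.\<close>
  have "kern (\<lambda>u z. feynman_weight b \<theta> (Some u) (Some z)) = kern (\<lambda>u z. \<i> * phase \<theta> u z)"
    by (intro ext) (auto simp: kern_def feynman_weight_def edge_step_def phase_def)
  then have "(\<lambda>n. \<integral>\<omega>. ?F n \<omega> \<partial>P) \<longlonglongrightarrow> ratio x y * coord (evolution.V \<phi> (kop (kern (\<lambda>u z. \<i> * phase \<theta> u z))) t (unitv y)) x"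
    using local_V_convergence[where \<Psi> = "feynman_weight b \<theta>" and \<phi> = \<phi> and y = y, OF feynman_weight_le vb(1) less_imp_le[OF t]] F(3) by simp
  then show "(\<integral>\<omega>. feynman_integrand b m v \<theta> t y \<omega> \<partial>P) =
      ratio x y * coord (evolution.V \<phi> (kop (kern (\<lambda>u z. \<i> * phase \<theta> u z))) t (unitv y)) x"
    using L LIMSEQ_unique by blast
qed

text \<open>Time 0 is separate because the grids need a positive mesh. No jump occurs up to time 0
  and the time integrals run over a null set.\<close>

lemma feynman_integrand_0: "feynman_integrand b m v \<theta> 0 y \<omega> = (if \<omega> 0 = Some y then 1 else 0)"
proof -
  have "jumps \<omega> \<inter> {..0} = {}" by (auto simp: jumps_def)
  then have n: "num_jumps 0 \<omega> = 0" by (simp add: num_jumps_def zero_enat_def)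
  have "time_integral w 0 \<omega> = 0" for w
  proof -
    have "AE s in lborel. indicator {0..0} s *\<^sub>R case_option 0 w (\<omega> s) = 0"
      using AE_lborel_singleton[of 0] by eventually_elim simp
    then have "(LINT s:{0..0}|lborel. case_option 0 w (\<omega> s)) = 0"
      unfolding set_lebesgue_integral_def by (rule integral_eq_zero_AE)
    then show ?thesis by (simp only: time_integral_def if_cancel)
  qed
  then show ?thesis
    unfolding feynman_integrand_def indicator_def mem_Collect_eq n action_def line_integral_def
    by (simp add: zero_enat_def)
qed

end

theorem theorem4p1:
  fixes b :: "'a::countable \<Rightarrow> 'a \<Rightarrow> real" and m :: "'a \<Rightarrow> real"
    and \<theta> :: "'a \<Rightarrow> 'a \<Rightarrow> real" and v :: "'a \<Rightarrow> real"
    and P :: "'a \<Rightarrow> (real \<Rightarrow> 'a option) measure"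
    and t :: real and x y :: 'a
  assumes "weighted_graph b m"
    and "magnetic_potential b \<theta>"
    and "semibounded_form m Cc (magnetic_form b m v \<theta>)"
    and "closable_form m Cc (magnetic_form b m v \<theta>)"
    and "semibounded_form m Cc (magnetic_form b m (\<lambda>x. - weighted_deg b m x) (\<lambda>_ _. 0))"
    and "closable_form m Cc (magnetic_form b m (\<lambda>x. - weighted_deg b m x) (\<lambda>_ _. 0))"
    and "\<And>x. process_law b m x (P x)"
    and "0 \<le> t"
  shows "integrable (P x) (feynman_integrand b m v \<theta> t y) \<and>
         integral_kernel m (exp_op m (scale_op (-\<i>) (magnetic_op b m v \<theta>)) t) x y
         = 1 / of_real (m y) * (LINT \<omega>|P x. feynman_integrand b m v \<theta> t y \<omega>)"
proof -
  interpret graph b m by unfold_locales (rule assms(1))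
  obtain C where C: "bounded_kernel C (kern (\<lambda>_ _. 1))" using bounded_adjacency[OF assms(5)] by blast
  obtain c where c: "\<And>z. 0 \<le> v z + deg z + c" using potential_bounded_below[OF assms(2,3)] by blast
  interpret mg: magnetic_graph b m v \<theta> C c
    by unfold_locales (use assms(2) c bounded_kern[OF C, of "phase \<theta>"] in auto)
  interpret pr: graph_process b m C "P x" x by unfold_locales (use C assms(7) in auto)
  \<comment> \<open>The double sign is the literal form of the kernel in
    \<open>scale_magnetic_op\<close> for \<open>c0 = - \<i>\<close>.\<close>
  let ?\<phi> = "\<lambda>z. - \<i> * of_real (v z + deg z)" and ?\<psi> = "\<lambda>u z. - (- \<i>) * phase \<theta> u z"
  have ev: "weighted_evolution ?\<phi> (kop (kern ?\<psi>)) C m"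
    by (rule weighted_evolution_kop[OF C]) (auto simp: norm_mult)
  interpret ev: weighted_evolution ?\<phi> "kop (kern ?\<psi>)" C m by (rule ev)
  have "scale_op (-\<i>) (magnetic_op b m v \<theta>) = ev.evol_op"
    by (rule mg.scale_magnetic_op[OF _ ev]) simp
  then have kernel: "integral_kernel m (exp_op m (scale_op (-\<i>) (magnetic_op b m v \<theta>)) t) x y
      = coord (ev.V t (unitv y)) x / of_real (sqrt (m x) * sqrt (m y))"
    using ev.integral_kernel_exp_op[OF assms(8)] by simp
  have "complex_of_real (m y) = of_real (sqrt (m y)) * of_real (sqrt (m y))"
    by (simp flip: of_real_mult)
  \<comment> \<open>The kernel is symmetric in the roots of the weights while the expectation
    carries \<open>ratio x y\<close>; they differ by the factor \<open>1 / m y\<close> of the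
    claim.\<close>
  then have norm: "1 / of_real (m y) * (ratio x y * z) = z / of_real (sqrt (m x) * sqrt (m y))" for z
    by (simp add: ratio_def)
  show ?thesis
  proof (cases "t = 0")
    case True
    have AE: "AE \<omega> in P x. feynman_integrand b m v \<theta> 0 y \<omega> = (if x = y then 1 else 0)"
      using pr.AE_start by eventually_elim (simp add: pr.feynman_integrand_0)
    have meas: "feynman_integrand b m v \<theta> 0 y \<in> borel_measurable (P x)"
      using pr.complex_fun_measurable[of 0 0 "\<lambda>p _. if p = Some y then 1 else 0"]
      by (simp add: pr.feynman_integrand_0[abs_def])
    have "integrable (P x) (feynman_integrand b m v \<theta> 0 y)"
      by (rule integrable_cong_AE_imp[OF _ meas AE[THEN AE_symmetric]]) simp
    moreover have "(LINT \<omega>|P x. feynman_integrand b m v \<theta> 0 y \<omega>) = (if x = y then 1 else 0)"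
      using integral_cong_AE[OF meas _ AE] by (simp add: pr.prob_space)
    moreover have "ratio x y * (if x = y then 1 else 0) = (if x = y then 1 else 0)" by simp
    moreover have "integral_kernel m (exp_op m (scale_op (-\<i>) (magnetic_op b m v \<theta>)) t) x y
        = (if x = y then 1 else 0) / of_real (sqrt (m x) * sqrt (m y))"
      unfolding kernel unfolding True ev.V_0 coord_unitv ..
    ultimately show ?thesis unfolding True using norm[of "if x = y then 1 else 0"] by (simp only: simp_thms)
  next
    case False
    then have t: "0 < t" using assms(8) by simp
    have \<phi>: "\<And>z. Re (?\<phi> z) \<le> 0" by simp
    note fe = pr.feynman_expectation[where \<phi> = ?\<phi> and v = v, OF t \<phi> refl, of \<theta> y]
    have "?\<psi> = (\<lambda>u z. \<i> * phase \<theta> u z)" by simp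
    then show ?thesis using fe kernel norm by simp
  qed
qed

end
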